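(* Let $n \geq 1$, let $1 \leq d_1 \leq d_2 \leq \cdots \leq d_n$ be integers, let $u \in \mathbb{R}^n$ be generic, and let $f \in \mathbb{R}[x_1,\ldots,x_n]$ be a polynomial with Newton polytope \[ \mathrm{Newt}(f) = \mathrm{Conv}\{0, d_1 e_1, \ldots, d_n e_n\} \] whose non-zero coefficients are generic. Then the algebraic degree of the problem $\min_{x \in \mathbb{R}^n} u^T x$ subject to $f(x) = 0$ is \[ d_1 \cdot (d_2 - 1) \cdots (d_n - 1). \] Moreover, all solutions of the Lagrange system $\mathcal{L}_{u,f}(x,\lambda) = 0$ can be found via the homotopy \[ H(x,\lambda;t) = (1-t)\,B(x,\lambda) + \gamma\, t\, \mathcal{L}_{u,f}(x,\lambda), \qquad t\in[0,1], \] where $\gamma \in \mathbb{C}$ is generic and $B(x,\lambda)$ is the system of $n+1$ polynomials \[ B(x,\lambda) = \left( u_1 - d_1 \lambda c_1 x_1^{d_1-1},\ \ldots,\ u_n - d_n \lambda c_n x_n^{d_n-1},\ c_0 + c_1 x_1^{d_1} \right) \] with $c_0,c_1,\ldots,c_n$ generic constants. That is, the limits as $t \to 1$ of the solution paths of $H(x,\lambda;t)=0$ that start at $t=0$ at the solutions of $B(x,\lambda)=0$ include all complex solutions of $\mathcal{L}_{u,f}(x,\lambda)=0$.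
   Context: For $f = \sum_{\alpha \in \mathcal{A}} c_\alpha x^\alpha$ with monomial support $\mathcal{A} \subset \mathbb{N}^n$, $\mathrm{Newt}(f) = \mathrm{Conv}\{\alpha : \alpha \in \mathcal{A}\}$; $e_1,\dots,e_n$ are the standard basis vectors of $\mathbb{R}^n$. The Lagrange system of $\min u^T x$ s.t. $f(x)=0$ is $\mathcal{L}_{u,f} = \{\ell_1,\ldots,\ell_n,f\}$ with $\ell_i = u_i - \lambda \frac{\partial f}{\partial x_i}(x)$, in the unknowns $(x,\lambda)$. The algebraic degree is the number of complex solutions $(x,\lambda)\in\mathbb{C}^{n+1}$ of $\mathcal{L}_{u,f}=0$. Systems are combined componentwise (the $i$-th component of $B$ with $\ell_i$, the last with $f$). "Generic" for $u$, for the coefficients of $f$ on its fixed monomial support, and for the $c_i$ means lying outside some proper algebraic subvariety of the corresponding complex parameter space. "Generic" for $\gamma$ means lying in some open dense (Euclidean topology) subset of $\mathbb{C}$, which may depend on the other data. A solution path is a continuous path $t \mapsto (x(t),\lambda(t)) \in \mathbb{C}^{n+1}$, $t \in [0,1)$, with $H(x(t),\lambda(t);t)=0$. *)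

theory Defs
  imports "HOL-Analysis.Analysis" "HOL-Library.Poly_Mapping"
begin

section \<open>Multivariate polynomials\<close>

text \<open>A polynomial with variables indexed by \<open>'v\<close> is a finitely supported map from
  exponent vectors \<open>'v \<Rightarrow>\<^sub>0 nat\<close> to coefficients.  Its \<^const>\<open>Poly_Mapping.keys\<close> are its
  monomial support.\<close>

type_synonym ('v, 'a) mpoly = "('v \<Rightarrow>\<^sub>0 nat) \<Rightarrow>\<^sub>0 'a"

definition mpoly_eval :: "('v, 'a::comm_semiring_1) mpoly \<Rightarrow> ('v \<Rightarrow> 'a) \<Rightarrow> 'a" where
  "mpoly_eval p x =
     (\<Sum>\<alpha>\<in>Poly_Mapping.keys p. Poly_Mapping.lookup p \<alpha> *
        (\<Prod>v\<in>Poly_Mapping.keys \<alpha>. x v ^ Poly_Mapping.lookup \<alpha> v))"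

text \<open>The formal partial derivative.  The subtraction of exponents is truncated, which is
  harmless because the monomials not containing \<open>v\<close> get the coefficient \<open>0\<close>.\<close>

definition mpoly_pderiv :: "'v \<Rightarrow> ('v, 'a::comm_semiring_1) mpoly \<Rightarrow> ('v, 'a) mpoly" where
  "mpoly_pderiv v p =
     (\<Sum>\<alpha>\<in>Poly_Mapping.keys p.
        Poly_Mapping.single (\<alpha> - Poly_Mapping.single v 1)
          (of_nat (Poly_Mapping.lookup \<alpha> v) * Poly_Mapping.lookup p \<alpha>))"

definition complexify :: "('v, real) mpoly \<Rightarrow> ('v, complex) mpoly" where
  "complexify p = Poly_Mapping.map complex_of_real p"

definition newton_polytope :: "('n::finite, 'a::zero) mpoly \<Rightarrow> (real ^ 'n) set" where
  "newton_polytope f =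
     convex hull ((\<lambda>\<alpha>. \<chi> i. real (Poly_Mapping.lookup \<alpha> i)) ` Poly_Mapping.keys f)"


section \<open>Proper subvarieties of complex parameter spaces\<close>

text \<open>The parameter space with coordinates indexed by \<open>V\<close> is the set of extensional functions
  \<open>V \<rightarrow>\<^sub>E UNIV\<close>, that is, a copy of the affine space of dimension \<open>card V\<close>.\<close>

definition algebraic_subvariety :: "'v set \<Rightarrow> ('v \<Rightarrow> complex) set \<Rightarrow> bool" where
  "algebraic_subvariety V Z \<longleftrightarrow>
     (\<exists>S :: ('v, complex) mpoly set.
        (\<forall>p\<in>S. \<forall>\<alpha>\<in>Poly_Mapping.keys p. Poly_Mapping.keys \<alpha> \<subseteq> V) \<and>
        Z = {z \<in> V \<rightarrow>\<^sub>E UNIV. \<forall>p\<in>S. mpoly_eval p z = 0})"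

definition proper_subvariety :: "'v set \<Rightarrow> ('v \<Rightarrow> complex) set \<Rightarrow> bool" where
  "proper_subvariety V Z \<longleftrightarrow> algebraic_subvariety V Z \<and> Z \<noteq> (V \<rightarrow>\<^sub>E UNIV)"

text \<open>\<open>Cost i\<close> is the coordinate of $u_i$, \<open>Coeff \<alpha>\<close> that of the coefficient of $x^\alpha$
  in $f$, \<open>Start0\<close> that of $c_0$, and \<open>Start i\<close> that of $c_i$.\<close>

datatype 'n param = Cost 'n | Coeff "'n \<Rightarrow>\<^sub>0 nat" | Start0 | Start 'n

definition problem_params :: "('n \<Rightarrow>\<^sub>0 nat) set \<Rightarrow> 'n param set" where
  "problem_params A = range Cost \<union> Coeff ` A"

definition problem_point :: "real ^ 'n \<Rightarrow> ('n::finite, real) mpoly \<Rightarrow> 'n param \<Rightarrow> complex" where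
  "problem_point u f =
     (\<lambda>v\<in>problem_params (Poly_Mapping.keys f).
        case v of Cost i \<Rightarrow> of_real (u $ i) | Coeff \<alpha> \<Rightarrow> of_real (Poly_Mapping.lookup f \<alpha>))"

definition homotopy_params :: "('n \<Rightarrow>\<^sub>0 nat) set \<Rightarrow> 'n param set" where
  "homotopy_params A = problem_params A \<union> {Start0} \<union> range Start"

definition homotopy_point ::
  "real ^ 'n \<Rightarrow> ('n::finite, real) mpoly \<Rightarrow> complex \<Rightarrow> complex ^ 'n \<Rightarrow> 'n param \<Rightarrow> complex" where
  "homotopy_point u f c0 c =
     (\<lambda>v\<in>homotopy_params (Poly_Mapping.keys f).
        case v of Cost i \<Rightarrow> of_real (u $ i) | Coeff \<alpha> \<Rightarrow> of_real (Poly_Mapping.lookup f \<alpha>)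
          | Start0 \<Rightarrow> c0 | Start i \<Rightarrow> c $ i)"


section \<open>The Lagrange system and the homotopy\<close>

text \<open>A square system in the unknowns $(x,\lambda)$ is given by its evaluation map.  The first
  component of the value collects the $n$ equations indexed by \<open>'n\<close>, the second one is the last
  equation.\<close>

type_synonym 'n system = "(complex ^ 'n) \<times> complex \<Rightarrow> (complex ^ 'n) \<times> complex"

definition lagrange_system :: "real ^ 'n \<Rightarrow> ('n::finite, real) mpoly \<Rightarrow> 'n system" where
  "lagrange_system u f = (\<lambda>(x, l).
     (\<chi> i. of_real (u $ i) - l * mpoly_eval (mpoly_pderiv i (complexify f)) (($) x),
      mpoly_eval (complexify f) (($) x)))"

definition zeros :: "'n::finite system \<Rightarrow> ((complex ^ 'n) \<times> complex) set" where
  "zeros F = {z. F z = 0}"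

text \<open>Solutions are counted without multiplicity.  As \<^const>\<open>card\<close> is \<open>0\<close> on infinite sets,
  finiteness is part of the notion.\<close>

definition has_algebraic_degree :: "real ^ 'n \<Rightarrow> ('n::finite, real) mpoly \<Rightarrow> nat \<Rightarrow> bool" where
  "has_algebraic_degree u f N \<longleftrightarrow>
     finite (zeros (lagrange_system u f)) \<and> card (zeros (lagrange_system u f)) = N"

text \<open>The variables are ordered by the order of \<open>'n\<close>, so \<open>Min UNIV\<close> is the index of $x_1$.\<close>

definition start_system ::
  "(real, 'n::{finite,linorder}) vec \<Rightarrow> ('n \<Rightarrow> nat) \<Rightarrow> complex \<Rightarrow> (complex, 'n) vec \<Rightarrow> 'n system" where
  "start_system u d c0 c = (\<lambda>(x, l).
     (\<chi> i. of_real (u $ i) - of_nat (d i) * l * c $ i * (x $ i) ^ (d i - 1),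
      c0 + c $ Min UNIV * (x $ Min UNIV) ^ d (Min UNIV)))"

definition homotopy :: "'n::finite system \<Rightarrow> complex \<Rightarrow> 'n system \<Rightarrow> real \<Rightarrow> 'n system" where
  "homotopy B \<gamma> L t z =
     ((1 - of_real t) *s fst (B z) + (\<gamma> * of_real t) *s fst (L z),
      (1 - of_real t) * snd (B z) + (\<gamma> * of_real t) * snd (L z))"

definition solution_path ::
  "(real \<Rightarrow> 'n::finite system) \<Rightarrow> (real \<Rightarrow> (complex ^ 'n) \<times> complex) \<Rightarrow> bool" where
  "solution_path H p \<longleftrightarrow> continuous_on {0..<1} p \<and> (\<forall>t\<in>{0..<1}. H t (p t) = 0)"

end

theory Submission
  imports Defs
begin

text \<open>
  In the Lagrange system every equation can be solved for a parameter of its own: the $i$-th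
  equation gives $u_i$, and $f = 0$ gives the constant coefficient of $f$.  So the zeros, taken over
  all parameters at once, are the points of an affine space, and their parameters are the values of a
  polynomial map \<open>\<Phi>\<close> between affine spaces of the same dimension.  Counting monomials shows that
  each unknown satisfies a nontrivial relation whose coefficients are polynomials in \<open>\<Phi>\<close>
  (\<open>algebraic_dependence\<close>).  Take such a relation of least degree.  Off a hypersurface of the
  parameter space its leading coefficient does not vanish, so that the zeros stay bounded, and the
  unknown is a simple root of it, so that the zeros are nondegenerate (\<open>generic_fibres\<close>; that the
  multiple roots lie over a hypersurface is \<open>image_of_hypersurface\<close>, again by counting).  Off this
  hypersurface the zeros therefore vary like the sheets of a finite covering: their number is constant
  along connected sets of parameters (\<open>card_zeros_constant\<close>), and a zero can be continued along a path
  of parameters (\<open>zero_path_lifting\<close>).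

  The hypersurface is not explicit, and the start system may lie on it.  But the zeros of the start
  system can be written down: there are $d_1 (d_2 - 1) \cdots (d_n - 1)$ of them, all nondegenerate
  (\<open>card_zeros_start\<close>, \<open>start_nondegenerate\<close>).  Here the Newton polytope enters: if $x_i$ has weight
  $1/d_i$, then all monomials have weight at most $1$, and a comparison of leading terms shows that
  no zero escapes to infinity as a system with this support approaches the start system
  (\<open>zeros_bounded_near_start\<close>).

  For the degree, $f$ and $u$ are joined to a start system by a one-parameter deformation that scales
  the monomials of $f$ by powers of \<open>\<epsilon>\<close>: at \<open>\<epsilon> = 1\<close> it is the Lagrange system, at \<open>\<epsilon> = 0\<close> it is
  a start system, and for all but finitely many other \<open>\<epsilon>\<close> it is equivalent to the Lagrange system of
  good parameters (\<open>degree_of_generic_lagrange_system\<close>).  For the homotopy, the system at time $t$ is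
  a multiple of the member of the pencil $B + s \mathcal{L}$ with $s = \gamma t / (1 - t)$.  Only
  finitely many members of a generic pencil are bad, and the ray of these $s$ avoids them unless
  \<open>\<gamma>\<close> lies on one of finitely many real lines.  So every nondegenerate solution at $t = 1$ can be
  continued back to $t = 0$ (\<open>homotopy_reaches_all_solutions\<close>).

  All this needs $d_i \geq 2$ for $i \geq 2$.  Otherwise $x_1$ and some other $x_i$ occur in $f$ only
  as linear terms, generic parameters admit no solution, and the formula gives $0$.
\<close>

abbreviation (input) "lookup \<equiv> Poly_Mapping.lookup"
abbreviation (input) "single \<equiv> Poly_Mapping.single"
abbreviation (input) "keys \<equiv> Poly_Mapping.keys"

section \<open>Polynomial functions\<close>

text \<open>Polynomials enter as functions of finitely many coordinates.  This keeps substitution, restriction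
  to curves and differentiation elementary; formal polynomials are recovered only where a subvariety
  has to be named.\<close>

inductive poly_fun :: "'v set \<Rightarrow> (('v \<Rightarrow> complex) \<Rightarrow> complex) \<Rightarrow> bool" for V where
  const: "poly_fun V (\<lambda>x. c)"
| var: "v \<in> V \<Longrightarrow> poly_fun V (\<lambda>x. x v)"
| add: "poly_fun V f \<Longrightarrow> poly_fun V g \<Longrightarrow> poly_fun V (\<lambda>x. f x + g x)"
| mult: "poly_fun V f \<Longrightarrow> poly_fun V g \<Longrightarrow> poly_fun V (\<lambda>x. f x * g x)"

lemma poly_fun_sum: "(\<And>i. i \<in> I \<Longrightarrow> poly_fun V (f i)) \<Longrightarrow> poly_fun V (\<lambda>x. \<Sum>i\<in>I. f i x)"
  by (induction I rule: infinite_finite_induct) (auto intro: poly_fun.intros)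

lemma poly_fun_prod: "(\<And>i. i \<in> I \<Longrightarrow> poly_fun V (f i)) \<Longrightarrow> poly_fun V (\<lambda>x. \<Prod>i\<in>I. f i x)"
  by (induction I rule: infinite_finite_induct) (auto intro: poly_fun.intros)

lemma poly_fun_power: "poly_fun V f \<Longrightarrow> poly_fun V (\<lambda>x. f x ^ k)"
  by (induction k) (auto intro: poly_fun.intros)

lemma poly_fun_uminus: "poly_fun V f \<Longrightarrow> poly_fun V (\<lambda>x. - f x)"
  using poly_fun.mult[OF poly_fun.const[where c = "-1"], of V f] by simp

lemma poly_fun_diff: "poly_fun V f \<Longrightarrow> poly_fun V g \<Longrightarrow> poly_fun V (\<lambda>x. f x - g x)"
  using poly_fun.add[OF _ poly_fun_uminus, of V f g] by simp

lemmas poly_fun_intros =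
  poly_fun.intros poly_fun_sum poly_fun_prod poly_fun_power poly_fun_uminus poly_fun_diff

lemma poly_fun_cong_vars: "poly_fun V f \<Longrightarrow> (\<And>v. v \<in> V \<Longrightarrow> x v = y v) \<Longrightarrow> f x = f y"
  by (induction rule: poly_fun.induct) auto

lemma poly_fun_subst:
  "poly_fun V f \<Longrightarrow> (\<And>v. v \<in> V \<Longrightarrow> poly_fun V' (g v)) \<Longrightarrow> poly_fun V' (\<lambda>x. f (\<lambda>v. g v x))"
  by (induction rule: poly_fun.induct) (auto intro: poly_fun.intros)

lemma poly_fun_mono: "poly_fun V f \<Longrightarrow> V \<subseteq> V' \<Longrightarrow> poly_fun V' f"
  using poly_fun_subst[of V f V' "\<lambda>v x. x v"] by (auto intro: poly_fun.intros)

lemma poly_fun_tendsto: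
  "poly_fun V f \<Longrightarrow> (\<And>v. v \<in> V \<Longrightarrow> ((\<lambda>t. g t v) \<longlongrightarrow> y v) F) \<Longrightarrow> ((\<lambda>t. f (g t)) \<longlongrightarrow> f y) F"
  by (induction rule: poly_fun.induct) (auto intro: tendsto_intros)

text \<open>The chain rule for vanishing velocities, which does not mention the partial derivatives of the
  polynomial: in \<open>generic_fibres\<close> the parameters are stationary.\<close>

lemma poly_fun_stationary:
  assumes "poly_fun V f" "\<And>v. v \<in> V \<Longrightarrow> ((\<lambda>r::real. g r v) has_vector_derivative 0) (at t)"
  shows "((\<lambda>r. f (g r)) has_vector_derivative 0) (at t)"
  using assms
proof (induction rule: poly_fun.induct)
  case (mult f h)
  have "((\<lambda>r. f (g r) * h (g r)) has_vector_derivative (f (g t) * 0 + 0 * h (g t))) (at t)"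
    using mult by (intro has_vector_derivative_mult) auto
  then show ?case by simp
next
  case (add f h)
  have "((\<lambda>r. f (g r) + h (g r)) has_vector_derivative (0 + 0)) (at t)"
    using add by (intro has_vector_derivative_add) auto
  then show ?case by simp
qed auto

lemma poly_fun_split_var:
  assumes "poly_fun (insert k V) f"
  shows "\<exists>R q. (\<forall>r. poly_fun V (q r)) \<and> (\<forall>x. f x = (\<Sum>r\<le>R. q r x * x k ^ r))"
proof -
  have "\<exists>R q. (\<forall>r. poly_fun V (q r)) \<and> (\<forall>r>R. q r = (\<lambda>x. 0)) \<and>
          (\<forall>x. f x = (\<Sum>r\<le>R. q r x * x k ^ r))"
    using assms
  proof (induction rule: poly_fun.induct)
    case (const c)
    show ?case
      by (rule exI[of _ 0], rule exI[of _ "\<lambda>r x. if r = 0 then c else 0"])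
        (simp add: poly_fun.const)
  next
    case (var v)
    show ?case
    proof (cases "v \<in> V")
      case True
      then show ?thesis
        by (intro exI[of _ 0] exI[of _ "\<lambda>r. if r = 0 then (\<lambda>x. x v) else (\<lambda>x. 0)"])
          (auto intro: poly_fun.intros)
    next
      case False
      with var have "v = k" by auto
      then show ?thesis
        by (intro exI[of _ 1] exI[of _ "\<lambda>r x. if r = 1 then 1 else 0"])
          (auto intro: poly_fun.intros)
    qed
  next
    case (add f g)
    obtain R q where
      q: "\<And>r. poly_fun V (q r)" "\<And>r. r > R \<Longrightarrow> q r = (\<lambda>x. 0)"
        "\<And>x. f x = (\<Sum>r\<le>R. q r x * x k ^ r)" using add.IH(1) by blast
    obtain R' q' where
      q': "\<And>r. poly_fun V (q' r)" "\<And>r. r > R' \<Longrightarrow> q' r = (\<lambda>x. 0)"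
        "\<And>x. g x = (\<Sum>r\<le>R'. q' r x * x k ^ r)" using add.IH(2) by blast
    have 1: "f x = (\<Sum>r\<le>max R R'. q r x * x k ^ r)" for x
      unfolding q(3) by (rule sum.mono_neutral_left) (auto simp: q(2))
    have 2: "g x = (\<Sum>r\<le>max R R'. q' r x * x k ^ r)" for x
      unfolding q'(3) by (rule sum.mono_neutral_left) (auto simp: q'(2))
    show ?case
      by (rule exI[of _ "max R R'"], rule exI[of _ "\<lambda>r x. q r x + q' r x"])
        (auto simp: 1 2 q(2) q'(2) sum.distrib[symmetric] algebra_simps
          intro: poly_fun.intros q(1) q'(1))
  next
    case (mult f g)
    obtain R q where
      q: "\<And>r. poly_fun V (q r)" "\<And>r. r > R \<Longrightarrow> q r = (\<lambda>x. 0)"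
        "\<And>x. f x = (\<Sum>r\<le>R. q r x * x k ^ r)" using mult.IH(1) by blast
    obtain R' q' where
      q': "\<And>r. poly_fun V (q' r)" "\<And>r. r > R' \<Longrightarrow> q' r = (\<lambda>x. 0)"
        "\<And>x. g x = (\<Sum>r\<le>R'. q' r x * x k ^ r)" using mult.IH(2) by blast
    have eq: "f x * g x = (\<Sum>r\<le>R + R'. (\<Sum>j\<le>r. q j x * q' (r - j) x) * x k ^ r)" for x
      unfolding q(3) q'(3) by (rule polynomial_product) (auto simp: q(2) q'(2))
    have "q j x * q' (r - j) x = 0" if "r > R + R'" for r j x
      using that by (cases "j > R") (auto simp: q(2) q'(2))
    then show ?case
      by (intro exI[of _ "R + R'"] exI[of _ "\<lambda>r x. \<Sum>j\<le>r. q j x * q' (r - j) x"])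
        (auto simp: eq fun_eq_iff intro!: poly_fun_intros q(1) q'(1) sum.neutral)
  qed
  then show ?thesis by blast
qed

lemma poly_fun_single_var:
  assumes "poly_fun {()} f"
  shows "\<exists>R c. \<forall>s. f (\<lambda>_. s) = (\<Sum>r\<le>R. c r * s ^ r)"
proof -
  from poly_fun_split_var[OF assms] obtain R q where
    q: "\<And>r. poly_fun {} (q r)" "\<And>x. f x = (\<Sum>r\<le>R. q r x * x () ^ r)" by blast
  have eq: "q r (\<lambda>_. s) = q r (\<lambda>_. 0)" for r s by (rule poly_fun_cong_vars[OF q(1)]) auto
  have "f (\<lambda>_. s) = (\<Sum>r\<le>R. q r (\<lambda>_. 0) * s ^ r)" for s
    unfolding q(2) by (intro sum.cong arg_cong2[where f = "(*)"] eq refl)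
  then show ?thesis
    by (intro exI allI)
qed

text \<open>Restriction to a polynomial curve turns statements about hypersurfaces into statements about the
  roots of a polynomial in one variable.\<close>

lemma poly_fun_curve_finite_zeros:
  assumes "poly_fun V f" "\<And>v. v \<in> V \<Longrightarrow> poly_fun {()} (\<lambda>x. g (x ()) v)" "f (g s0) \<noteq> 0"
  shows "finite {s. f (g s) = 0}"
proof -
  have "poly_fun {()} (\<lambda>x. f (\<lambda>v. g (x ()) v))"
    by (rule poly_fun_subst[OF assms(1)]) (rule assms(2))
  from poly_fun_single_var[OF this] obtain R c where
    c: "\<And>s. f (g s) = (\<Sum>r\<le>R. c r * s ^ r)" by auto
  have "\<exists>r\<le>R. c r \<noteq> 0" using assms(3) unfolding c by (auto intro: ccontr)
  then obtain r where "r \<le> R" "c r \<noteq> 0" by auto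
  then show ?thesis unfolding c by (intro polyfun_rootbound_finite) auto
qed

text \<open>On the complex line through a non-zero of \<open>f\<close> and a non-zero of \<open>g\<close> each factor has only finitely
  many zeros.\<close>

lemma poly_fun_mult_nonzero:
  assumes "poly_fun V f" "poly_fun V g" "f x \<noteq> 0" "g y \<noteq> 0"
  shows "\<exists>z. f z * g z \<noteq> 0"
proof -
  define l where "l s v = x v + s * (y v - x v)" for s :: complex and v
  have l: "poly_fun {()} (\<lambda>x. l (x ()) v)" for v
    unfolding l_def by (intro poly_fun_intros) auto
  have l01: "l 0 = x" "l 1 = y" by (auto simp: l_def)
  have "finite {s. f (l s) = 0}"
    by (rule poly_fun_curve_finite_zeros[OF assms(1) l, where ?s0.0 = 0]) (simp add: l01 assms)
  moreover have "finite {s. g (l s) = 0}"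
    by (rule poly_fun_curve_finite_zeros[OF assms(2) l, where ?s0.0 = 1]) (simp add: l01 assms)
  ultimately have "finite ({s. f (l s) = 0} \<union> {s. g (l s) = 0})" by simp
  then obtain s where "s \<notin> {s. f (l s) = 0} \<union> {s. g (l s) = 0}"
    using ex_new_if_finite[OF infinite_UNIV_char_0] by blast
  then show ?thesis by auto
qed

lemma poly_fun_prod_nonzero:
  assumes "finite I" "\<And>i. i \<in> I \<Longrightarrow> poly_fun V (f i)" "\<And>i. i \<in> I \<Longrightarrow> \<exists>x. f i x \<noteq> 0"
  shows "\<exists>x. (\<Prod>i\<in>I. f i x) \<noteq> 0"
  using assms
proof (induction I rule: finite_induct)
  case (insert i I)
  obtain x where "f i x \<noteq> 0" using insert.prems by blast
  moreover obtain y where "(\<Prod>i\<in>I. f i y) \<noteq> 0" using insert by auto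
  ultimately have "\<exists>z. f i z * (\<Prod>i\<in>I. f i z) \<noteq> 0"
    using insert.prems by (intro poly_fun_mult_nonzero[of V]) (auto intro!: poly_fun_prod)
  then show ?case using insert by simp
qed simp

subsection \<open>Monomials\<close>

definition monomial :: "'v set \<Rightarrow> ('v \<Rightarrow> nat) \<Rightarrow> ('v \<Rightarrow> complex) \<Rightarrow> complex" where
  "monomial V a x = (\<Prod>v\<in>V. x v ^ a v)"

definition exp_box :: "'v set \<Rightarrow> nat \<Rightarrow> ('v \<Rightarrow> nat) set" where
  "exp_box V K = V \<rightarrow>\<^sub>E {..K}"

text \<open>Bounding every exponent by the same \<open>K\<close>, rather than the total degree, makes the dimension of the
  space of polynomials the plain power \<open>(K + 1) ^ card V\<close>.\<close>

definition box_poly :: "'v set \<Rightarrow> nat \<Rightarrow> (('v \<Rightarrow> complex) \<Rightarrow> complex) \<Rightarrow> bool" where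
  "box_poly V K f \<longleftrightarrow> (\<exists>c. \<forall>x. f x = (\<Sum>a\<in>exp_box V K. c a * monomial V a x))"

lemma finite_exp_box: "finite V \<Longrightarrow> finite (exp_box V K)"
  by (simp add: exp_box_def finite_PiE)

lemma card_exp_box: "finite V \<Longrightarrow> card (exp_box V K) = (K + 1) ^ card V"
  by (simp add: exp_box_def card_PiE)

lemma box_poly_monomial:
  assumes "finite V" "\<And>v. v \<in> V \<Longrightarrow> a v \<le> K"
  shows "box_poly V K (monomial V a)"
proof -
  have "monomial V a x = (\<Sum>b\<in>exp_box V K. (if b = restrict a V then 1 else 0) * monomial V b x)" for x
  proof -
    have "(\<Sum>b\<in>exp_box V K. (if b = restrict a V then 1 else 0) * monomial V b x)
        = (\<Sum>b\<in>exp_box V K. if b = restrict a V then monomial V b x else 0)"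
      by (rule sum.cong) auto
    also have "\<dots> = monomial V (restrict a V) x"
      using assms by (subst sum.delta) (auto simp: finite_exp_box, auto simp: exp_box_def)
    finally show ?thesis by (simp add: monomial_def)
  qed
  then show ?thesis unfolding box_poly_def by (intro exI allI)
qed

lemma box_poly_sum:
  assumes "\<And>i. i \<in> I \<Longrightarrow> box_poly V K (f i)"
  shows "box_poly V K (\<lambda>x. \<Sum>i\<in>I. c i * f i x)"
proof -
  have "\<forall>i\<in>I. \<exists>c. \<forall>x. f i x = (\<Sum>a\<in>exp_box V K. c a * monomial V a x)"
    using assms unfolding box_poly_def by blast
  then obtain e where e: "\<And>i x. i \<in> I \<Longrightarrow> f i x = (\<Sum>a\<in>exp_box V K. e i a * monomial V a x)" by metis
  have "(\<Sum>i\<in>I. c i * f i x) = (\<Sum>a\<in>exp_box V K. (\<Sum>i\<in>I. c i * e i a) * monomial V a x)" for x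
  proof -
    have "(\<Sum>i\<in>I. c i * f i x) = (\<Sum>i\<in>I. \<Sum>a\<in>exp_box V K. c i * e i a * monomial V a x)"
      by (intro sum.cong) (auto simp: e sum_distrib_left mult.assoc)
    also have "\<dots> = (\<Sum>a\<in>exp_box V K. \<Sum>i\<in>I. c i * e i a * monomial V a x)" by (rule sum.swap)
    finally show ?thesis by (simp add: sum_distrib_right)
  qed
  then show ?thesis unfolding box_poly_def by (intro exI allI)
qed

lemma box_poly_mono: 
  assumes "finite V" "box_poly V K f" "K \<le> K'"
  shows "box_poly V K' f"
proof -
  obtain c where c: "\<And>x. f x = (\<Sum>a\<in>exp_box V K. c a * monomial V a x)"
    using assms(2) unfolding box_poly_def by blast
  have "f = (\<lambda>x. \<Sum>a\<in>exp_box V K. c a * monomial V a x)" using c by auto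
  moreover have "box_poly V K' (monomial V a)" if "a \<in> exp_box V K" for a
    using that assms by (intro box_poly_monomial) (force simp: exp_box_def PiE_def Pi_def)+
  ultimately show ?thesis by (auto intro: box_poly_sum)
qed

lemma box_poly_mult:
  assumes V: "finite V" and "box_poly V K f" "box_poly V K' g"
  shows "box_poly V (K + K') (\<lambda>x. f x * g x)"
proof -
  obtain c c' where c: "\<And>x. f x = (\<Sum>a\<in>exp_box V K. c a * monomial V a x)"
    and c': "\<And>x. g x = (\<Sum>a\<in>exp_box V K'. c' a * monomial V a x)"
    using assms(2,3) unfolding box_poly_def by metis
  have eq: "f x * g x = (\<Sum>p\<in>exp_box V K \<times> exp_box V K'.
      c (fst p) * c' (snd p) * monomial V (\<lambda>v. fst p v + snd p v) x)" for x
  proof -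
    have "f x * g x = (\<Sum>p\<in>exp_box V K \<times> exp_box V K'.
        (c (fst p) * monomial V (fst p) x) * (c' (snd p) * monomial V (snd p) x))"
      unfolding c c' sum_product by (simp add: sum.cartesian_product case_prod_unfold)
    then show ?thesis by (simp add: monomial_def power_add prod.distrib mult_ac)
  qed
  have "box_poly V (K + K') (monomial V (\<lambda>v. fst p v + snd p v))" if "p \<in> exp_box V K \<times> exp_box V K'" for p
  proof (rule box_poly_monomial[OF V])
    fix v assume "v \<in> V"
    then have "fst p v \<le> K" "snd p v \<le> K'" using that by (auto simp: exp_box_def PiE_iff)
    then show "fst p v + snd p v \<le> K + K'" by simp
  qed
  then show ?thesis unfolding eq by (rule box_poly_sum)
qed

lemma box_poly_add:
  assumes "box_poly V K f" "box_poly V K g"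
  shows "box_poly V K (\<lambda>x. f x + g x)"
  using box_poly_sum[of "UNIV :: bool set" V K "\<lambda>b. if b then f else g" "\<lambda>_. 1"] assms
  by (auto simp: UNIV_bool add.commute)

lemma box_poly_const: "finite V \<Longrightarrow> box_poly V K (\<lambda>x. c)"
  using box_poly_sum[of "{()}" V K "\<lambda>_. monomial V (\<lambda>_. 0)" "\<lambda>_. c"] box_poly_monomial[of V "\<lambda>_. 0" K]
  by (simp add: monomial_def)

lemma poly_fun_imp_box_poly:
  assumes "finite V" "poly_fun V f"
  shows "\<exists>K. box_poly V K f"
  using assms(2)
proof (induction rule: poly_fun.induct)
  case (const c)
  then show ?case using box_poly_const[OF assms(1)] by blast
next
  case (var v)
  have "monomial V (\<lambda>w. if w = v then 1 else 0) = (\<lambda>x. x v)"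
  proof
    fix x :: "'a \<Rightarrow> complex"
    have "monomial V (\<lambda>w. if w = v then 1 else 0) x = (\<Prod>w\<in>V. if w = v then x w else 1)"
      unfolding monomial_def by (rule prod.cong) auto
    then show "monomial V (\<lambda>w. if w = v then 1 else 0) x = x v"
      using var assms(1) by (simp add: prod.delta)
  qed
  then show ?case using box_poly_monomial[OF assms(1), of "\<lambda>w. if w = v then 1 else 0" 1] by force
next
  case (add f g)
  then obtain K K' where "box_poly V K f" "box_poly V K' g" by blast
  then have "box_poly V (max K K') (\<lambda>x. f x + g x)"
    by (intro box_poly_add) (auto intro: box_poly_mono[OF assms(1)])
  then show ?case by blast
next
  case (mult f g)
  then show ?case using box_poly_mult[OF assms(1)] by blast
qed

lemma poly_fun_monomial: "poly_fun V (monomial V a)"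
  unfolding monomial_def by (intro poly_fun_intros)

lemma sum_exp_box_insert:
  assumes "finite V" "v \<notin> V"
  shows "(\<Sum>a\<in>exp_box (insert v V) K. g a) = (\<Sum>r\<le>K. \<Sum>b\<in>exp_box V K. g (b(v := r)))"
proof -
  have "(\<Sum>a\<in>exp_box (insert v V) K. g a) =
      (\<Sum>a\<in>(\<lambda>(r, b). b(v := r)) ` ({..K} \<times> exp_box V K). g a)"
    by (simp add: exp_box_def PiE_insert_eq)
  also have "\<dots> = (\<Sum>(r, b)\<in>{..K} \<times> exp_box V K. g (b(v := r)))"
    using inj_combinator[OF assms(2), of "\<lambda>_. {..K}"]
    by (subst sum.reindex) (simp_all add: exp_box_def case_prod_unfold o_def)
  finally show ?thesis by (simp add: sum.cartesian_product)
qed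

text \<open>Fix all variables but one; the coefficients of the resulting polynomial in the remaining variable
  vanish, and each of them is a relation between monomials in fewer variables.\<close>

lemma monomials_independent:
  assumes "finite V" "\<And>x. (\<Sum>a\<in>exp_box V K. c a * monomial V a x) = 0" "a \<in> exp_box V K"
  shows "c a = 0"
  using assms
proof (induction V arbitrary: c a rule: finite_induct)
  case empty
  then show ?case by (auto simp: exp_box_def monomial_def)
next
  case (insert v V)
  have *: "(\<Sum>b\<in>exp_box V K. c (b(v := r)) * monomial V b x) = 0" if "r \<le> K" for r x
  proof -
    have "(\<Sum>r\<le>K. (\<Sum>b\<in>exp_box V K. c (b(v := r)) * monomial V b x) * y ^ r) = 0" for y
    proof -
      have m: "monomial (insert v V) (b(v := r)) (x(v := y)) = monomial V b x * y ^ r" for b r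
      proof -
        have "(\<Prod>w\<in>V. (x(v := y)) w ^ (b(v := r)) w) = (\<Prod>w\<in>V. x w ^ b w)"
          using insert.hyps by (intro prod.cong) auto
        then show ?thesis using insert.hyps by (simp add: monomial_def)
      qed
      show ?thesis
        using insert.prems(1)[of "x(v := y)"] insert.hyps
        by (simp add: sum_exp_box_insert m sum_distrib_right mult.assoc del: fun_upd_apply)
    qed
    then have "\<forall>r\<le>K. (\<Sum>b\<in>exp_box V K. c (b(v := r)) * monomial V b x) = 0"
      by (subst polyfun_eq_0[symmetric]) auto
    with that show ?thesis by blast
  qed
  obtain r b where rb: "r \<le> K" "b \<in> exp_box V K" "a = b(v := r)"
    using insert.prems(2) by (auto simp: exp_box_def PiE_insert_eq)
  show ?case using insert.IH[OF *[OF rb(1)] rb(2)] rb(3) by simp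
qed

subsection \<open>Formal polynomials\<close>

lemma mpoly_eval_superset:
  assumes "finite M" "keys p \<subseteq> M" "\<And>\<alpha>. \<alpha> \<in> M \<Longrightarrow> keys \<alpha> \<subseteq> V" "finite V"
  shows "mpoly_eval p x = (\<Sum>\<alpha>\<in>M. lookup p \<alpha> * (\<Prod>v\<in>V. x v ^ lookup \<alpha> v))"
proof -
  have "mpoly_eval p x = (\<Sum>\<alpha>\<in>keys p. lookup p \<alpha> *
      (\<Prod>v\<in>V. x v ^ lookup \<alpha> v))"
    unfolding mpoly_eval_def
  proof (intro sum.cong arg_cong2[where f = "(*)"] refl)
    fix \<alpha> assume "\<alpha> \<in> keys p"
    then show "(\<Prod>v\<in>keys \<alpha>. x v ^ lookup \<alpha> v) =
        (\<Prod>v\<in>V. x v ^ lookup \<alpha> v)"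
      using assms by (intro prod.mono_neutral_left) (auto simp: in_keys_iff subset_iff)
  qed
  also have "\<dots> = (\<Sum>\<alpha>\<in>M. lookup p \<alpha> * (\<Prod>v\<in>V. x v ^ lookup \<alpha> v))"
    using assms by (intro sum.mono_neutral_left) (auto simp: in_keys_iff)
  finally show ?thesis .
qed

lemma mpoly_eval_single:
  "mpoly_eval (single \<alpha> c) x = c * (\<Prod>v\<in>keys \<alpha>. x v ^ lookup \<alpha> v)"
  by (simp add: mpoly_eval_def)

lemma mpoly_eval_add: "mpoly_eval (p + q) x = mpoly_eval p x + mpoly_eval q x"
proof -
  define M where "M = keys p \<union> keys q"
  define V where "V = (\<Union>\<alpha>\<in>M. keys \<alpha>)"
  have *: "finite M" "\<And>\<alpha>. \<alpha> \<in> M \<Longrightarrow> keys \<alpha> \<subseteq> V" "finite V"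
    by (auto simp: M_def V_def)
  have "mpoly_eval r x = (\<Sum>\<alpha>\<in>M. lookup r \<alpha> * (\<Prod>v\<in>V. x v ^ lookup \<alpha> v))"
    if "r \<in> {p, q, p + q}" for r
    using that Poly_Mapping.keys_add[of p q] * by (intro mpoly_eval_superset) (auto simp: M_def)
  then show ?thesis by (simp add: lookup_add algebra_simps sum.distrib)
qed

lemma mpoly_eval_sum: "mpoly_eval (\<Sum>i\<in>I. p i) x = (\<Sum>i\<in>I. mpoly_eval (p i) x)"
  by (induction I rule: infinite_finite_induct) (simp_all add: mpoly_eval_add, simp_all add: mpoly_eval_def)

lemma poly_fun_imp_mpoly:
  assumes "finite V" "poly_fun V f"
  shows "\<exists>p. (\<forall>\<alpha>\<in>keys p. keys \<alpha> \<subseteq> V) \<and> (\<forall>x. mpoly_eval p x = f x)"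
proof -
  obtain K c where c: "\<And>x. f x = (\<Sum>a\<in>exp_box V K. c a * monomial V a x)"
    using poly_fun_imp_box_poly[OF assms] unfolding box_poly_def by blast
  define e where "e a = Poly_Mapping.Abs_poly_mapping (\<lambda>v. if v \<in> V then a v else 0)" for a :: "'a \<Rightarrow> nat"
  have e: "lookup (e a) v = (if v \<in> V then a v else 0)" for a v
    unfolding e_def by (subst lookup_Abs_poly_mapping) (auto intro: finite_subset[OF _ assms(1)])
  have ke: "keys (e a) \<subseteq> V" for a by (auto simp: in_keys_iff e split: if_splits)
  have ev: "(\<Prod>v\<in>keys (e a). x v ^ lookup (e a) v) = monomial V a x"
    for a and x :: "'a \<Rightarrow> complex"
  proof -
    have "(\<Prod>v\<in>keys (e a). x v ^ lookup (e a) v) =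
        (\<Prod>v\<in>V. x v ^ lookup (e a) v)"
      using ke assms(1) by (intro prod.mono_neutral_left) (auto simp: in_keys_iff)
    also have "\<dots> = monomial V a x"
      unfolding monomial_def by (rule prod.cong) (auto simp: e)
    finally show ?thesis .
  qed
  define p where "p = (\<Sum>a\<in>exp_box V K. single (e a) (c a))"
  have "mpoly_eval p x = f x" for x
    by (simp add: p_def mpoly_eval_sum mpoly_eval_single ev c)
  moreover have "keys \<alpha> \<subseteq> V" if "\<alpha> \<in> keys p" for \<alpha>
  proof -
    have "\<alpha> \<in> (\<Union>a\<in>exp_box V K. keys (single (e a) (c a)))"
      using that Poly_Mapping.keys_sum[of "\<lambda>a. single (e a) (c a)" "exp_box V K"]
      by (auto simp: p_def)
    then show ?thesis using ke by (auto split: if_splits)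
  qed
  ultimately show ?thesis by blast
qed

text \<open>The index set may be infinite.  Below it is the complex line of all \<open>s\<close>, so that a condition
  ``for some \<open>s\<close>'' needs no elimination of \<open>s\<close>.\<close>

lemma proper_subvariety_of_poly_funs:
  assumes V: "finite V" and f: "\<And>i. i \<in> I \<Longrightarrow> poly_fun V (f i)" and "i \<in> I" "f i x \<noteq> 0"
  shows "proper_subvariety V {z \<in> V \<rightarrow>\<^sub>E UNIV. \<forall>i\<in>I. f i z = 0}"
proof -
  have "\<forall>i\<in>I. \<exists>p. (\<forall>\<alpha>\<in>keys p. keys \<alpha> \<subseteq> V) \<and> (\<forall>x. mpoly_eval p x = f i x)"
    using poly_fun_imp_mpoly[OF V f] by blast
  then obtain p where p: "\<And>i \<alpha>. i \<in> I \<Longrightarrow> \<alpha>\<in>keys (p i) \<Longrightarrow> keys \<alpha> \<subseteq> V"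
    "\<And>i x. i \<in> I \<Longrightarrow> mpoly_eval (p i) x = f i x"
    by metis
  have "algebraic_subvariety V {z \<in> V \<rightarrow>\<^sub>E UNIV. \<forall>i\<in>I. f i z = 0}"
    unfolding algebraic_subvariety_def using p by (intro exI[of _ "p ` I"]) auto
  moreover have "f i (restrict x V) = f i x" by (rule poly_fun_cong_vars[OF f[OF \<open>i \<in> I\<close>]]) auto
  then have "f i (restrict x V) \<noteq> 0" using assms(4) by simp
  then have "restrict x V \<notin> {z \<in> V \<rightarrow>\<^sub>E UNIV. \<forall>i\<in>I. f i z = 0}"
    using assms(3) by blast
  moreover have "restrict x V \<in> V \<rightarrow>\<^sub>E UNIV" by auto
  ultimately show ?thesis unfolding proper_subvariety_def by blast
qed

section \<open>Images of hypersurfaces under polynomial maps\<close>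

lemma homogeneous_system_nontrivial_solution:
  fixes a :: "'j \<Rightarrow> 'i \<Rightarrow> complex"
  assumes "finite I" "finite J" "card I < card J"
  shows "\<exists>c. (\<exists>j\<in>J. c j \<noteq> 0) \<and> (\<forall>i\<in>I. (\<Sum>j\<in>J. c j * a j i) = 0)"
  using assms
proof (induction I arbitrary: J a rule: finite_induct)
  case empty
  then have "J \<noteq> {}" by auto
  then show ?case by (intro exI[of _ "\<lambda>_. 1"]) auto
next
  case (insert i I)
  show ?case
  proof (cases "\<forall>j\<in>J. a j i = 0")
    case True
    obtain c where "\<exists>j\<in>J. c j \<noteq> 0" "\<forall>i\<in>I. (\<Sum>j\<in>J. c j * a j i) = 0"
      using insert.IH[of J a] insert.prems insert.hyps by auto
    with True show ?thesis by (intro exI[of _ c]) auto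
  next
    case False
    then obtain j0 where j0: "j0 \<in> J" "a j0 i \<noteq> 0" by blast
    \<comment> \<open>Equation \<open>i\<close> is solved for the unknown \<open>j0\<close>, which is eliminated from the others.\<close>
    define J' where "J' = J - {j0}"
    have J': "finite J'" "card I < card J'"
      using insert.prems insert.hyps j0 by (auto simp: J'_def card_Diff_singleton)
    obtain c where c: "\<exists>j\<in>J'. c j \<noteq> 0"
      "\<And>k. k \<in> I \<Longrightarrow> (\<Sum>j\<in>J'. c j * (a j k - a j i / a j0 i * a j0 k)) = 0"
      using insert.IH[OF J', of "\<lambda>j k. a j k - a j i / a j0 i * a j0 k"] by auto
    define e where "e = c(j0 := - (\<Sum>j\<in>J'. c j * a j i) / a j0 i)"
    have sum: "(\<Sum>j\<in>J. e j * a j k) = (\<Sum>j\<in>J'. c j * a j k) - (\<Sum>j\<in>J'. c j * a j i) / a j0 i * a j0 k" for k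
    proof -
      have "(\<Sum>j\<in>J. e j * a j k) = e j0 * a j0 k + (\<Sum>j\<in>J'. e j * a j k)"
        unfolding J'_def using insert.prems j0 by (intro sum.remove) auto
      also have "(\<Sum>j\<in>J'. e j * a j k) = (\<Sum>j\<in>J'. c j * a j k)"
        by (rule sum.cong) (auto simp: e_def J'_def)
      finally show ?thesis by (simp add: e_def)
    qed
    have "(\<Sum>j\<in>J. e j * a j k) = 0" if "k \<in> insert i I" for k
    proof (cases "k = i")
      case True
      then show ?thesis using j0 by (simp add: sum)
    next
      case False
      with that have "k \<in> I" by auto
      from c(2)[OF this] show ?thesis
        by (simp add: sum algebra_simps sum_subtractf sum_distrib_left sum_divide_distrib)
    qed
    moreover have "\<exists>j\<in>J. e j \<noteq> 0" using c(1) by (auto simp: e_def J'_def)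
    ultimately show ?thesis by blast
  qed
qed

lemma power_add_le:
  fixes x r :: nat
  shows "(x + r) ^ m \<le> x ^ m + r * m * (x + r) ^ (m - 1)"
proof (induction m)
  case (Suc m)
  have "(x + r) ^ Suc m = (x + r) ^ m * x + r * (x + r) ^ m" by (simp add: algebra_simps)
  also have "(x + r) ^ m * x \<le> (x ^ m + r * m * (x + r) ^ (m - 1)) * x"
    using Suc by (intro mult_right_mono) auto
  also have "(x ^ m + r * m * (x + r) ^ (m - 1)) * x \<le> x ^ Suc m + r * m * (x + r) ^ m"
  proof (cases m)
    case (Suc k)
    have "(x + r) ^ k * x \<le> (x + r) ^ k * (x + r)" by (intro mult_left_mono) auto
    then have "r * m * ((x + r) ^ k * x) \<le> r * m * ((x + r) ^ k * (x + r))" by (rule mult_left_mono) simp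
    then show ?thesis using Suc by (simp add: algebra_simps)
  qed simp
  finally show ?case by (simp add: algebra_simps)
qed simp

text \<open>The right-hand side counts pairs of polynomials with exponents up to \<open>D\<close> and \<open>D * c\<close>, the left-hand
  side polynomials with exponents up to \<open>D * c + r\<close>.  The two terms with factor \<open>c\<close> differ by only
  \<open>O(D ^ (m - 1))\<close>.\<close>

lemma boxes_overflow:
  fixes m r c :: nat
  shows "\<exists>D. (D * c + r + 1) ^ m < (D + 1) ^ m + (D * c + 1) ^ m"
proof (cases m)
  case 0
  then show ?thesis by simp
next
  case (Suc k)
  define D where "D = r * m * (c + 1 + r) ^ k"
  have "(D * c + 1 + r) ^ m \<le> (D * c + 1) ^ m + r * m * (D * c + 1 + r) ^ k"
    using power_add_le[of "D * c + 1" r m] Suc by simp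
  also have "(D * c + 1 + r) ^ k \<le> ((D + 1) * (c + 1 + r)) ^ k"
    by (intro power_mono) (auto simp: algebra_simps)
  also have "r * m * ((D + 1) * (c + 1 + r)) ^ k = D * (D + 1) ^ k"
    unfolding power_mult_distrib by (simp only: D_def mult_ac)
  also have "D * (D + 1) ^ k < (D + 1) ^ m" by (simp add: Suc)
  finally have "(D * c + 1 + r) ^ m < (D * c + 1) ^ m + (D + 1) ^ m" by simp
  then show ?thesis by (intro exI[of _ D]) (simp add: algebra_simps)
qed

lemma box_poly_prod_power:
  assumes "finite V" "finite W" "\<And>w. w \<in> W \<Longrightarrow> box_poly V e (f w)" "\<And>w. w \<in> W \<Longrightarrow> a w \<le> D"
  shows "box_poly V (card W * D * e) (\<lambda>x. \<Prod>w\<in>W. f w x ^ a w)"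
proof -
  have pow: "box_poly V (k * e) (\<lambda>x. f w x ^ k)" if "w \<in> W" for w k
    using box_poly_mult[OF assms(1) assms(3)[OF that]] 
    by (induction k) (auto simp: box_poly_const assms(1))
  have "box_poly V (D * e) (\<lambda>x. f w x ^ a w)" if "w \<in> W" for w
    by (rule box_poly_mono[OF assms(1) pow[OF that]]) (simp add: assms(4) that)
  with assms(2) show ?thesis
  proof (induction W rule: finite_induct)
    case empty
    then show ?case by (simp add: box_poly_const assms(1))
  next
    case (insert w W)
    have "box_poly V (D * e + card W * D * e) (\<lambda>x. f w x ^ a w * (\<Prod>w\<in>W. f w x ^ a w))"
      using insert by (intro box_poly_mult[OF assms(1)]) auto
    then show ?case using insert by (simp add: algebra_simps)
  qed
qed

lemma poly_fun_finite_family_box_poly: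
  assumes "finite V" "finite W" "\<And>w. w \<in> W \<Longrightarrow> poly_fun V (f w)"
  shows "\<exists>e. \<forall>w\<in>W. box_poly V e (f w)"
proof -
  have "\<forall>w\<in>W. \<exists>e. box_poly V e (f w)" using poly_fun_imp_box_poly[OF assms(1)] assms(3) by blast
  then obtain e where e: "\<And>w. w \<in> W \<Longrightarrow> box_poly V (e w) (f w)" by metis
  have "box_poly V (sum e W) (f w)" if "w \<in> W" for w
    by (rule box_poly_mono[OF assms(1) e[OF that]]) (rule member_le_sum[OF that _ assms(2)], simp)
  then show ?thesis by blast
qed

lemma poly_fun_box_sum: "poly_fun V (\<lambda>x. \<Sum>a\<in>exp_box V K. c a * monomial V a x)"
  by (intro poly_fun_intros poly_fun_monomial)

text \<open>Consider the linear map \<open>(P, Q) \<mapsto> P \<circ> \<Phi> + J Q\<close> on pairs of polynomials of bounded exponents.  For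
  large bounds its source has larger dimension than its target, so some pair that is not \<open>(0, 0)\<close> is
  mapped to \<open>0\<close>.  There \<open>P \<noteq> 0\<close>, as otherwise \<open>J Q = 0\<close> would force \<open>Q = 0\<close>; and \<open>P \<circ> \<Phi>\<close> vanishes
  wherever \<open>J\<close> does.\<close>

theorem image_of_hypersurface:
  fixes J :: "('v \<Rightarrow> complex) \<Rightarrow> complex" and \<Phi> :: "'w \<Rightarrow> ('v \<Rightarrow> complex) \<Rightarrow> complex"
  assumes V: "finite V" and W: "finite W" and card: "card W = card V"
    and J: "poly_fun V J" "J x0 \<noteq> 0" and \<Phi>: "\<And>w. w \<in> W \<Longrightarrow> poly_fun V (\<Phi> w)"
  shows "\<exists>P. poly_fun W P \<and> (\<exists>y. P y \<noteq> 0) \<and> (\<forall>x. J x = 0 \<longrightarrow> P (\<lambda>w. \<Phi> w x) = 0)"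
proof -
  obtain r where r: "box_poly V r J" using poly_fun_imp_box_poly[OF V J(1)] by blast
  obtain e where e: "\<And>w. w \<in> W \<Longrightarrow> box_poly V e (\<Phi> w)"
    using poly_fun_finite_family_box_poly[OF V W, of \<Phi>] \<Phi> by blast
  define m where "m = card V"
  obtain D where D: "(D * (m * e) + r + 1) ^ m < (D + 1) ^ m + (D * (m * e) + 1) ^ m"
    using boxes_overflow by blast
  define K where "K = D * (m * e)"
  define I where "I = exp_box W D <+> exp_box V K"
  define g where "g j = (case j of Inl a \<Rightarrow> (\<lambda>x. monomial W a (\<lambda>w. \<Phi> w x))
     | Inr b \<Rightarrow> (\<lambda>x. J x * monomial V b x))" for j
  have "box_poly V (K + r) (g j)" if "j \<in> I" for j
  proof (cases j)
    case (Inl a)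
    have "box_poly V (card W * D * e) (\<lambda>x. \<Prod>w\<in>W. \<Phi> w x ^ a w)"
      using that Inl by (intro box_poly_prod_power V W e) (auto simp: I_def exp_box_def PiE_iff)
    then have "box_poly V (card W * D * e) (g j)" by (simp add: Inl g_def monomial_def)
    then show ?thesis by (rule box_poly_mono[OF V]) (simp add: K_def m_def card)
  next
    case (Inr b)
    have "box_poly V K (monomial V b)"
      using that Inr by (intro box_poly_monomial V) (auto simp: I_def exp_box_def PiE_iff)
    from box_poly_mult[OF V r this] show ?thesis by (simp add: Inr g_def add.commute)
  qed
  then have "\<forall>j\<in>I. \<exists>c. \<forall>x. g j x = (\<Sum>b\<in>exp_box V (K + r). c b * monomial V b x)"
    unfolding box_poly_def by blast
  then obtain a where a: "\<And>j x. j \<in> I \<Longrightarrow> g j x = (\<Sum>b\<in>exp_box V (K + r). a j b * monomial V b x)"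
    by metis
  have finI: "finite I" by (simp add: I_def finite_exp_box V W)
  have "card (exp_box V (K + r)) < card I"
    using D by (simp add: I_def card_Plus finite_exp_box V W card_exp_box card K_def m_def)
  from homogeneous_system_nontrivial_solution[OF finite_exp_box[OF V] finI this, of a]
  obtain c where c: "\<exists>j\<in>I. c j \<noteq> 0" "\<And>b. b \<in> exp_box V (K + r) \<Longrightarrow> (\<Sum>j\<in>I. c j * a j b) = 0"
    by blast
  define P where "P y = (\<Sum>a\<in>exp_box W D. c (Inl a) * monomial W a y)" for y
  define Q where "Q x = (\<Sum>b\<in>exp_box V K. c (Inr b) * monomial V b x)" for x
  have rel: "P (\<lambda>w. \<Phi> w x) + J x * Q x = 0" for x
  proof -
    have "P (\<lambda>w. \<Phi> w x) + J x * Q x = (\<Sum>j\<in>I. c j * g j x)"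
      unfolding I_def using V W
      by (subst sum.Plus) (auto simp: finite_exp_box g_def P_def Q_def sum_distrib_left mult_ac)
    also have "\<dots> = (\<Sum>j\<in>I. \<Sum>b\<in>exp_box V (K + r). c j * a j b * monomial V b x)"
      by (intro sum.cong refl) (simp add: a sum_distrib_left mult.assoc)
    also have "\<dots> = (\<Sum>b\<in>exp_box V (K + r). (\<Sum>j\<in>I. c j * a j b) * monomial V b x)"
      by (subst sum.swap) (simp add: sum_distrib_right)
    finally show ?thesis by (simp add: c(2))
  qed
  have "\<exists>y. P y \<noteq> 0"
  proof (rule ccontr)
    assume "\<nexists>y. P y \<noteq> 0"
    then have P0: "P y = 0" for y by blast
    have c1: "c (Inl a) = 0" if "a \<in> exp_box W D" for a
      using monomials_independent[OF W, where c = "\<lambda>a. c (Inl a)" and K = D] P0 that unfolding P_def by blast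
    have "Q x = 0" for x
    proof (rule ccontr)
      assume "Q x \<noteq> 0"
      moreover have "poly_fun V Q" unfolding Q_def by (rule poly_fun_box_sum)
      ultimately obtain z where "J z * Q z \<noteq> 0" using poly_fun_mult_nonzero J by blast
      then show False using rel[of z] P0 by simp
    qed
    then have c2: "c (Inr b) = 0" if "b \<in> exp_box V K" for b
      using monomials_independent[OF V, where c = "\<lambda>b. c (Inr b)" and K = K] that unfolding Q_def by blast
    show False using c(1) c1 c2 by (auto simp: I_def)
  qed
  moreover have "P (\<lambda>w. \<Phi> w x) = 0" if "J x = 0" for x using rel[of x] that by simp
  moreover have "poly_fun W P" unfolding P_def by (rule poly_fun_box_sum)
  ultimately show ?thesis by blast
qed

text \<open>With one more variable, on which \<open>\<Phi>\<close> does not depend, the source becomes the hypersurface where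
  that variable is \<open>0\<close>.\<close>

corollary algebraic_dependence:
  fixes \<Phi> :: "'w \<Rightarrow> ('v \<Rightarrow> complex) \<Rightarrow> complex"
  assumes V: "finite V" and W: "finite W" and card: "card W = card V + 1"
    and \<Phi>: "\<And>w. w \<in> W \<Longrightarrow> poly_fun V (\<Phi> w)"
  shows "\<exists>P. poly_fun W P \<and> (\<exists>y. P y \<noteq> 0) \<and> (\<forall>x. P (\<lambda>w. \<Phi> w x) = 0)"
proof -
  define V' where "V' = insert None (Some ` V)"
  have "poly_fun V' (\<lambda>x. x None)" by (intro poly_fun_intros) (simp add: V'_def)
  moreover have "poly_fun V' (\<lambda>x. \<Phi> w (\<lambda>v. x (Some v)))" if "w \<in> W" for w
    by (rule poly_fun_subst[OF \<Phi>[OF that]]) (auto intro: poly_fun_intros simp: V'_def)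
  moreover have "card W = card V'" using V by (simp add: V'_def card card_image)
  ultimately obtain P where P: "poly_fun W P" "\<exists>y. P y \<noteq> 0"
    "\<And>x. x None = 0 \<Longrightarrow> P (\<lambda>w. \<Phi> w (\<lambda>v. x (Some v))) = 0"
    using image_of_hypersurface[of V' W "\<lambda>x. x None" "\<lambda>_. 1" "\<lambda>w x. \<Phi> w (\<lambda>v. x (Some v))"] V W
    by (auto simp: V'_def)
  have "P (\<lambda>w. \<Phi> w x) = 0" for x using P(3)[of "case_option 0 x"] by simp
  with P show ?thesis by blast
qed

section \<open>Generic fibres of polynomial maps\<close>

text \<open>Among all relations for \<open>\<zeta>\<close> with coefficients in \<open>\<Phi>\<close> one of least degree \<open>R\<close> is chosen.  Then \<open>\<zeta>\<close> is a
  simple root of it at generic points: the derivative \<open>J\<close> of the relation with respect to \<open>\<zeta>\<close> has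
  smaller degree and a nonzero leading coefficient, so it cannot vanish identically.  In the case
  \<open>R = 0\<close> the values of \<open>\<Phi>\<close> lie in a hypersurface, and any nonzero \<open>J\<close> will do.\<close>

lemma minimal_relation:
  fixes \<Phi> :: "'v \<Rightarrow> ('x \<Rightarrow> complex) \<Rightarrow> complex"
  assumes V: "finite V" and X: "finite X" and card: "card V = card X"
    and \<Phi>: "\<And>v. v \<in> V \<Longrightarrow> poly_fun X (\<Phi> v)" and \<zeta>: "poly_fun X \<zeta>"
  shows "\<exists>R q J. (\<forall>r. poly_fun V (q r)) \<and> (\<exists>y. q R y \<noteq> 0) \<and>
    (\<forall>\<xi>. (\<Sum>r\<le>R. q r (\<lambda>v. \<Phi> v \<xi>) * \<zeta> \<xi> ^ r) = 0) \<and>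
    poly_fun X J \<and> (\<exists>\<xi>. J \<xi> \<noteq> 0) \<and>
    (R > 0 \<longrightarrow> (\<forall>\<xi>. J \<xi> = (\<Sum>r\<le>R. of_nat r * q r (\<lambda>v. \<Phi> v \<xi>) * \<zeta> \<xi> ^ (r - 1))))"
proof -
  define Rel where "Rel R \<longleftrightarrow> (\<exists>q. (\<forall>r. poly_fun V (q r)) \<and> (\<exists>y. q R y \<noteq> 0) \<and>
    (\<forall>\<xi>. (\<Sum>r\<le>R. q r (\<lambda>v. \<Phi> v \<xi>) * \<zeta> \<xi> ^ r) = 0))" for R :: nat
  have "\<exists>R. Rel R"
  proof -
    define W where "W = insert None (Some ` V)"
    define \<Psi> where "\<Psi> w = (case w of None \<Rightarrow> \<zeta> | Some v \<Rightarrow> \<Phi> v)" for w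
    have "poly_fun X (\<Psi> w)" if "w \<in> W" for w using that \<Phi> \<zeta> by (auto simp: W_def \<Psi>_def)
    moreover have "card W = card X + 1" "finite W" using V by (simp_all add: W_def card card_image)
    ultimately obtain P y where P: "poly_fun W P" "P y \<noteq> 0" "\<And>\<xi>. P (\<lambda>w. \<Psi> w \<xi>) = 0"
      using algebraic_dependence[OF X] by metis
    obtain R0 q where q: "\<And>r. poly_fun (Some ` V) (q r)"
      "\<And>x. P x = (\<Sum>r\<le>R0. q r x * x None ^ r)"
      using poly_fun_split_var[OF P(1)[unfolded W_def]] by blast
    define S where "S = {r. r \<le> R0 \<and> (\<exists>y. q r y \<noteq> 0)}"
    have "finite S" by (simp add: S_def)
    moreover have "S \<noteq> {}"
    proof
      assume "S = {}"
      then have "P y = 0" unfolding q(2) S_def by (intro sum.neutral) auto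
      with P(2) show False by simp
    qed
    ultimately have R: "Max S \<in> S" "\<And>r. r \<in> S \<Longrightarrow> r \<le> Max S" by auto
    define p where "p r \<theta> = q r (case_option 0 \<theta>)" for r \<theta>
    have pq: "p r (\<lambda>v. x (Some v)) = q r x" for r x
      unfolding p_def by (rule poly_fun_cong_vars[OF q(1)]) auto
    have "poly_fun V (p r)" for r
    proof -
      have "poly_fun V (\<lambda>\<theta>. q r (\<lambda>w. (case w of None \<Rightarrow> (\<lambda>\<theta>. 0) | Some v \<Rightarrow> (\<lambda>\<theta>. \<theta> v)) \<theta>))"
        by (rule poly_fun_subst[OF q(1)]) (auto intro: poly_fun_intros)
      moreover have "(\<lambda>w. (case w of None \<Rightarrow> (\<lambda>\<theta>. 0) | Some v \<Rightarrow> (\<lambda>\<theta>. \<theta> v)) \<theta>) = case_option 0 \<theta>"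
        for \<theta> :: "'v \<Rightarrow> complex" by (auto split: option.splits)
      ultimately show ?thesis unfolding p_def by simp
    qed
    moreover have "\<exists>y. p (Max S) y \<noteq> 0"
    proof -
      obtain x where "q (Max S) x \<noteq> 0" using R(1) unfolding S_def by blast
      then have "p (Max S) (\<lambda>v. x (Some v)) \<noteq> 0" by (simp add: pq)
      then show ?thesis by blast
    qed
    moreover have "(\<Sum>r\<le>Max S. p r (\<lambda>v. \<Phi> v \<xi>) * \<zeta> \<xi> ^ r) = 0" for \<xi>
    proof -
      have "0 = (\<Sum>r\<le>R0. q r (\<lambda>w. \<Psi> w \<xi>) * \<zeta> \<xi> ^ r)"
        using P(3)[of \<xi>] unfolding q(2) by (simp add: \<Psi>_def)
      also have "\<dots> = (\<Sum>r\<le>Max S. q r (\<lambda>w. \<Psi> w \<xi>) * \<zeta> \<xi> ^ r)"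
      proof (rule sum.mono_neutral_right)
        show "\<forall>r\<in>{..R0} - {..Max S}. q r (\<lambda>w. \<Psi> w \<xi>) * \<zeta> \<xi> ^ r = 0"
          using R(2) unfolding S_def by fastforce
      qed (use R(1) in \<open>auto simp: S_def\<close>)
      finally show ?thesis by (simp add: pq[symmetric] \<Psi>_def)
    qed
    ultimately have "Rel (Max S)" unfolding Rel_def by blast
    then show ?thesis ..
  qed
  then obtain R where "Rel R" and least: "\<And>R'. R' < R \<Longrightarrow> \<not> Rel R'"
    using exists_least_iff[of Rel] by blast
  then obtain q where q: "\<And>r. poly_fun V (q r)" "\<exists>y. q R y \<noteq> 0"
    "\<And>\<xi>. (\<Sum>r\<le>R. q r (\<lambda>v. \<Phi> v \<xi>) * \<zeta> \<xi> ^ r) = 0" unfolding Rel_def by blast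
  define J where "J = (if R = 0 then (\<lambda>\<xi>. 1)
    else (\<lambda>\<xi>. \<Sum>r\<le>R. of_nat r * q r (\<lambda>v. \<Phi> v \<xi>) * \<zeta> \<xi> ^ (r - 1)))"
  have "poly_fun X J"
    unfolding J_def by (auto intro!: poly_fun_intros poly_fun_subst[OF q(1)] \<Phi> \<zeta>)
  moreover have "\<exists>\<xi>. J \<xi> \<noteq> 0"
  proof (cases R)
    case (Suc R')
    have eq: "J \<xi> = (\<Sum>r\<le>R'. (of_nat (Suc r) * q (Suc r) (\<lambda>v. \<Phi> v \<xi>)) * \<zeta> \<xi> ^ r)" for \<xi>
      unfolding J_def Suc by (simp add: sum.atMost_Suc_shift del: of_nat_Suc sum.atMost_Suc)
    show ?thesis
    proof (rule ccontr)
      assume "\<nexists>\<xi>. J \<xi> \<noteq> 0"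
      then have "Rel R'"
        unfolding Rel_def using q(1,2)
        by (intro exI[of _ "\<lambda>r y. of_nat (Suc r) * q (Suc r) y"])
          (auto simp: eq Suc simp del: of_nat_Suc intro!: poly_fun_intros)
      with least Suc show False by simp
    qed
  qed (simp add: J_def)
  ultimately show ?thesis using q by (intro exI[of _ R] exI[of _ q] exI[of _ J]) (auto simp: J_def)
qed

text \<open>The equations are \<open>\<theta> w = \<Psi> w\<close> for \<open>w \<in> W\<close>, one for each unknown, and their right-hand sides do not
  involve the parameters in \<open>W\<close>.  Hence the unknowns and the other parameters are coordinates on the
  set of all pairs of parameters and zeros, and \<open>\<Phi>\<close> returns the parameters.

  The polynomial \<open>D\<close> excludes the parameters where a leading coefficient vanishes and the image of
  the hypersurface where some unknown is a multiple root of its relation.  If a direction \<open>v\<close> is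
  annihilated by the derivative of the system, then differentiating the relation of \<open>z k\<close> along it
  leaves the derivative with respect to \<open>z k\<close> times \<open>v k\<close>, so \<open>v k = 0\<close>.\<close>

theorem generic_fibres:
  fixes \<Psi> :: "'v \<Rightarrow> ('v + 'k \<Rightarrow> complex) \<Rightarrow> complex"
  assumes V: "finite V" and W: "W \<subseteq> V" and K: "finite K" and card: "card W = card K"
    and \<Psi>: "\<forall>w\<in>W. poly_fun (Inl ` (V - W) \<union> Inr ` K) (\<Psi> w)"
  shows "\<exists>D R q. poly_fun V D \<and> (\<exists>\<theta>. D \<theta> \<noteq> 0) \<and>
    (\<forall>k\<in>K. (\<forall>r. poly_fun V (q k r)) \<and> (\<forall>\<theta>. D \<theta> \<noteq> 0 \<longrightarrow> q k (R k) \<theta> \<noteq> 0)) \<and>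
    (\<forall>\<theta> z. (\<forall>w\<in>W. \<theta> w = \<Psi> w (case_sum \<theta> z)) \<longrightarrow>
       (\<forall>k\<in>K. (\<Sum>r\<le>R k. q k r \<theta> * z k ^ r) = 0) \<and>
       (\<forall>v. D \<theta> \<noteq> 0 \<longrightarrow> (\<forall>w\<in>W. ((\<lambda>t::real. \<Psi> w (case_sum \<theta> (\<lambda>k. z k + of_real t * v k)))
            has_vector_derivative 0) (at 0)) \<longrightarrow> (\<forall>k\<in>K. v k = 0)))"
proof -
  define X :: "('v + 'k) set" where "X = Inl ` (V - W) \<union> Inr ` K"
  define \<Phi> where "\<Phi> v \<xi> = (if v \<in> W then \<Psi> v \<xi> else \<xi> (Inl v))" for v \<xi>
  have X: "finite X" using V K by (simp add: X_def)
  have cardX: "card V = card X"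
  proof -
    have "card X = card (V - W) + card W"
      unfolding X_def card using V K by (subst card_Un_disjoint) (auto simp: card_image)
    also have "card (V - W) + card W = card V"
      using V W card_mono[OF V W] by (simp add: card_Diff_subset finite_subset)
    finally show ?thesis ..
  qed
  have \<Phi>: "poly_fun X (\<Phi> v)" if "v \<in> V" for v
  proof (cases "v \<in> W")
    case True
    then show ?thesis using \<Psi> by (simp add: \<Phi>_def[abs_def] X_def)
  next
    case False
    then show ?thesis using that by (auto simp: \<Phi>_def[abs_def] X_def intro!: poly_fun_intros)
  qed
  define A where "A k R q J \<longleftrightarrow> (\<forall>r. poly_fun V (q r)) \<and> (\<exists>y. q R y \<noteq> 0) \<and>
    (\<forall>\<xi>. (\<Sum>r\<le>R. q r (\<lambda>v. \<Phi> v \<xi>) * \<xi> (Inr k) ^ r) = 0) \<and> poly_fun X J \<and> (\<exists>\<xi>. J \<xi> \<noteq> 0) \<and>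
    (R > 0 \<longrightarrow> (\<forall>\<xi>. J \<xi> = (\<Sum>r\<le>R. of_nat r * q r (\<lambda>v. \<Phi> v \<xi>) * \<xi> (Inr k) ^ (r - 1))))"
    for k and R :: nat and q J
  have "\<forall>k\<in>K. \<exists>R q J. A k R q J"
  proof
    fix k assume "k \<in> K"
    then have "poly_fun X (\<lambda>\<xi>. \<xi> (Inr k))" by (intro poly_fun_intros) (simp add: X_def)
    from minimal_relation[OF V X cardX \<Phi> this] show "\<exists>R q J. A k R q J" unfolding A_def .
  qed
  then obtain R q J where A: "\<And>k. k \<in> K \<Longrightarrow> A k (R k) (q k) (J k)" by metis
  have q: "\<And>k r. k \<in> K \<Longrightarrow> poly_fun V (q k r)" "\<And>k. k \<in> K \<Longrightarrow> \<exists>y. q k (R k) y \<noteq> 0"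
    and rel: "\<And>k \<xi>. k \<in> K \<Longrightarrow> (\<Sum>r\<le>R k. q k r (\<lambda>v. \<Phi> v \<xi>) * \<xi> (Inr k) ^ r) = 0"
    and J: "\<And>k. k \<in> K \<Longrightarrow> poly_fun X (J k)" "\<And>k. k \<in> K \<Longrightarrow> \<exists>\<xi>. J k \<xi> \<noteq> 0"
    "\<And>k \<xi>. k \<in> K \<Longrightarrow> R k > 0 \<Longrightarrow>
        J k \<xi> = (\<Sum>r\<le>R k. of_nat r * q k r (\<lambda>v. \<Phi> v \<xi>) * \<xi> (Inr k) ^ (r - 1))"
    using A unfolding A_def by blast+
  obtain x0 where "(\<Prod>k\<in>K. J k x0) \<noteq> 0" using poly_fun_prod_nonzero[OF K, of X J] J(1,2) by blast
  moreover have "poly_fun X (\<lambda>\<xi>. \<Prod>k\<in>K. J k \<xi>)" by (intro poly_fun_intros J(1))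
  ultimately obtain P where P: "poly_fun V P" "\<exists>y. P y \<noteq> 0"
    "\<And>\<xi>. (\<Prod>k\<in>K. J k \<xi>) = 0 \<Longrightarrow> P (\<lambda>v. \<Phi> v \<xi>) = 0"
    using image_of_hypersurface[OF X V cardX, of "\<lambda>\<xi>. \<Prod>k\<in>K. J k \<xi>" x0 \<Phi>] \<Phi> by blast
  define D where "D \<theta> = P \<theta> * (\<Prod>k\<in>K. q k (R k) \<theta>)" for \<theta>
  have polyD: "poly_fun V D" unfolding D_def by (intro poly_fun_intros P(1) q(1))
  have D_nonzero: "\<exists>\<theta>. D \<theta> \<noteq> 0"
  proof -
    obtain y1 where "P y1 \<noteq> 0" using P(2) by blast
    moreover obtain y2 where "(\<Prod>k\<in>K. q k (R k) y2) \<noteq> 0"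
      using poly_fun_prod_nonzero[OF K, of V "\<lambda>k. q k (R k)"] q by blast
    ultimately show ?thesis
      unfolding D_def using P(1) q(1) by (intro poly_fun_mult_nonzero[of V]) (auto intro!: poly_fun_prod)
  qed
  have lead: "q k (R k) \<theta> \<noteq> 0" if "k \<in> K" "D \<theta> \<noteq> 0" for k \<theta>
    using that K by (auto simp: D_def)
  have fib: "f (\<lambda>v. \<Phi> v (case_sum \<theta> z)) = f \<theta>"
    if "poly_fun V f" "\<forall>w\<in>W. \<theta> w = \<Psi> w (case_sum \<theta> z)" for f \<theta> z
    by (rule poly_fun_cong_vars[OF that(1)]) (use that(2) in \<open>auto simp: \<Phi>_def\<close>)
  have root: "(\<Sum>r\<le>R k. q k r \<theta> * z k ^ r) = 0"
    if "k \<in> K" "\<forall>w\<in>W. \<theta> w = \<Psi> w (case_sum \<theta> z)" for k \<theta> z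
    using rel[OF that(1), of "case_sum \<theta> z"] by (simp add: fib[OF q(1)[OF that(1)] that(2)])
  have nondeg: "v k = 0"
    if sol: "\<forall>w\<in>W. \<theta> w = \<Psi> w (case_sum \<theta> z)" and D: "D \<theta> \<noteq> 0" and k: "k \<in> K"
      and v: "\<forall>w\<in>W. ((\<lambda>t::real. \<Psi> w (case_sum \<theta> (\<lambda>k. z k + of_real t * v k)))
            has_vector_derivative 0) (at 0)" for \<theta> z v k
  proof -
    define \<xi> where "\<xi> t = case_sum \<theta> (\<lambda>k. z k + of_real t * v k)" for t :: real
    have \<xi>0: "\<xi> 0 = case_sum \<theta> z" by (simp add: \<xi>_def)
    have R: "R k > 0"
      using root[OF k sol] lead[OF k D] by (cases "R k") auto
    have "J k (\<xi> 0) \<noteq> 0"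
    proof
      assume "J k (\<xi> 0) = 0"
      then have "(\<Prod>k\<in>K. J k (\<xi> 0)) = 0" using k K by auto
      from P(3)[OF this] have "P \<theta> = 0" unfolding \<xi>0 by (simp add: fib[OF P(1) sol])
      with D show False by (simp add: D_def)
    qed
    moreover have "J k (\<xi> 0) * v k = 0"
    proof -
      have "((\<lambda>t. \<Phi> w (\<xi> t)) has_vector_derivative 0) (at 0)" for w
        using v by (cases "w \<in> W") (auto simp: \<Phi>_def \<xi>_def)
      then have 1: "((\<lambda>t. q k r (\<lambda>w. \<Phi> w (\<xi> t))) has_vector_derivative 0) (at 0)" for r
        by (intro poly_fun_stationary[OF q(1)[OF k]])
      have "((\<lambda>s. (z k + s * v k) ^ r) has_field_derivative of_nat r * z k ^ (r - 1) * v k) (at (of_real 0))" for r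
        by (auto intro!: derivative_eq_intros)
      then have 2: "((\<lambda>t. \<xi> t (Inr k) ^ r) has_vector_derivative of_nat r * z k ^ (r - 1) * v k) (at 0)" for r
        unfolding \<xi>_def sum.case by (rule has_vector_derivative_real_field)
      have "((\<lambda>t. \<Sum>r\<le>R k. q k r (\<lambda>w. \<Phi> w (\<xi> t)) * \<xi> t (Inr k) ^ r) has_vector_derivative
          (\<Sum>r\<le>R k. q k r (\<lambda>w. \<Phi> w (\<xi> 0)) * (of_nat r * z k ^ (r - 1) * v k) + 0 * \<xi> 0 (Inr k) ^ r)) (at 0)"
        by (intro has_vector_derivative_sum has_vector_derivative_mult 1 2)
      then have "((\<lambda>t::real. 0) has_vector_derivative
          (\<Sum>r\<le>R k. q k r (\<lambda>w. \<Phi> w (\<xi> 0)) * (of_nat r * z k ^ (r - 1) * v k))) (at 0)"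
        by (simp add: rel[OF k])
      then have "(\<Sum>r\<le>R k. q k r (\<lambda>w. \<Phi> w (\<xi> 0)) * (of_nat r * z k ^ (r - 1) * v k)) = 0"
        using vector_derivative_unique_at has_vector_derivative_const by blast
      then show ?thesis
        unfolding J(3)[OF k R] by (simp add: sum_distrib_left sum_distrib_right mult_ac \<xi>0)
    qed
    ultimately show ?thesis by simp
  qed
  show ?thesis
    using polyD D_nonzero lead root nondeg q(1)
    by (intro exI[of _ D] exI[of _ R] exI[of _ q]) blast
qed

lemma root_bound:
  fixes a :: "nat \<Rightarrow> complex"
  assumes "(\<Sum>r\<le>R. a r * \<zeta> ^ r) = 0" "a R \<noteq> 0"
  shows "norm \<zeta> \<le> 1 + (\<Sum>r<R. norm (a r)) / norm (a R)"
proof (cases "norm \<zeta> \<le> 1")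
  case True
  then show ?thesis by (smt (verit) divide_nonneg_nonneg norm_ge_zero sum_nonneg)
next
  case False
  have "R > 0" using assms by (cases R) auto
  then obtain R' where R': "R = Suc R'" by (cases R) auto
  have "a R * \<zeta> ^ R = - (\<Sum>r<R. a r * \<zeta> ^ r)"
    using assms(1) by (simp add: lessThan_Suc_atMost[symmetric] add_eq_0_iff2)
  then have "norm (a R) * norm \<zeta> ^ R = norm (\<Sum>r<R. a r * \<zeta> ^ r)"
    by (metis norm_minus_cancel norm_mult norm_power)
  also have "\<dots> \<le> (\<Sum>r<R. norm (a r) * norm \<zeta> ^ R')"
  proof (rule sum_norm_le)
    fix r assume "r \<in> {..<R}"
    then have "norm \<zeta> ^ r \<le> norm \<zeta> ^ R'" using False R' by (intro power_increasing) auto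
    then show "norm (a r * \<zeta> ^ r) \<le> norm (a r) * norm \<zeta> ^ R'"
      by (simp add: norm_mult norm_power mult_left_mono)
  qed
  also have "\<dots> = (\<Sum>r<R. norm (a r)) * norm \<zeta> ^ R'" by (simp add: sum_distrib_right)
  finally have "norm (a R) * norm \<zeta> * norm \<zeta> ^ R' \<le> (\<Sum>r<R. norm (a r)) * norm \<zeta> ^ R'"
    by (simp add: R' mult_ac)
  moreover have "norm \<zeta> ^ R' > 0" using False by (intro zero_less_power) auto
  ultimately have "norm (a R) * norm \<zeta> \<le> (\<Sum>r<R. norm (a r))" by simp
  then have "norm \<zeta> \<le> (\<Sum>r<R. norm (a r)) / norm (a R)" using assms(2) by (simp add: field_simps)
  then show ?thesis by simp
qed

section \<open>Continuation of zeros\<close>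

subsection \<open>Continuously differentiable maps\<close>

text \<open>Continuity of the derivative refers to the operator norm, as the inverse function theorem asks
  for.\<close>

definition C1 :: "('a::real_normed_vector \<Rightarrow> 'b::real_normed_vector) \<Rightarrow> bool" where
  "C1 f \<longleftrightarrow> (\<exists>f'. (\<forall>x. (f has_derivative blinfun_apply (f' x)) (at x)) \<and> continuous_on UNIV f')"

lemma C1I:
  assumes "\<And>x. (f has_derivative F x) (at x)" "\<And>x h. blinfun_apply (f' x) h = F x h"
    "continuous_on UNIV f'"
  shows "C1 f"
proof -
  have "F x = blinfun_apply (f' x)" for x using assms(2) by auto
  then show ?thesis using assms(1,3) unfolding C1_def by auto
qed

lemma C1_imp_continuous_on: "C1 f \<Longrightarrow> continuous_on S f"
  unfolding C1_def by (meson continuous_at_imp_continuous_on has_derivative_continuous)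

lemma C1_const: "C1 (\<lambda>x. c)"
  by (rule C1I[where F = "\<lambda>x h. 0" and f' = "\<lambda>_. 0"]) auto

lemma C1_add:
  assumes "C1 f" "C1 g" shows "C1 (\<lambda>x. f x + g x)"
proof -
  obtain f' g' where 
    f: "\<And>x. (f has_derivative blinfun_apply (f' x)) (at x)" "continuous_on UNIV f'" and
    g: "\<And>x. (g has_derivative blinfun_apply (g' x)) (at x)" "continuous_on UNIV g'"
    using assms unfolding C1_def by blast
  show ?thesis
  proof (rule C1I)
    show "((\<lambda>x. f x + g x) has_derivative (\<lambda>h. f' x h + g' x h)) (at x)" for x
      by (rule has_derivative_add[OF f(1) g(1)])
    show "blinfun_apply (f' x + g' x) h = f' x h + g' x h" for x h by (simp add: blinfun.add_left)
  qed (intro continuous_intros f g)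
qed

lemma C1_bounded_linear_compose:
  assumes h: "bounded_linear h" and "C1 f" shows "C1 (\<lambda>x. h (f x))"
proof -
  obtain f' where f: "\<And>x. (f has_derivative blinfun_apply (f' x)) (at x)" "continuous_on UNIV f'"
    using assms unfolding C1_def by blast
  show ?thesis
  proof (rule C1I)
    show "((\<lambda>x. h (f x)) has_derivative (\<lambda>v. h (f' x v))) (at x)" for x
      by (rule bounded_linear.has_derivative[OF h f(1)])
    show "blinfun_apply (Blinfun h o\<^sub>L f' x) v = h (f' x v)" for x v
      by (simp add: bounded_linear_Blinfun_apply[OF h])
  qed (intro continuous_intros f bounded_bilinear.continuous_on[OF bounded_bilinear_blinfun_compose])
qed

lemma C1_bounded_linear: "bounded_linear h \<Longrightarrow> C1 h"
  by (rule C1_bounded_linear_compose, assumption,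
      rule C1I[where F = "\<lambda>x h. h" and f' = "\<lambda>_. id_blinfun"]) auto

lemma C1_mult:
  fixes f g :: "'a::real_normed_vector \<Rightarrow> 'b::real_normed_algebra"
  assumes "C1 f" "C1 g" shows "C1 (\<lambda>x. f x * g x)"
proof -
  obtain f' g' where 
    f: "\<And>x. (f has_derivative blinfun_apply (f' x)) (at x)" "continuous_on UNIV f'" and
    g: "\<And>x. (g has_derivative blinfun_apply (g' x)) (at x)" "continuous_on UNIV g'"
    using assms unfolding C1_def by blast
  show ?thesis
  proof (rule C1I)
    show "((\<lambda>x. f x * g x) has_derivative (\<lambda>h. f x * g' x h + f' x h * g x)) (at x)" for x
      by (rule has_derivative_mult[OF f(1) g(1)])
    show "blinfun_apply ((blinfun_mult_right (f x) o\<^sub>L g' x) + (blinfun_mult_left (g x) o\<^sub>L f' x)) h =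
        f x * g' x h + f' x h * g x" for x h
      by (simp add: blinfun.add_left)
  qed (intro continuous_intros f g bounded_bilinear.continuous_on[OF bounded_bilinear_blinfun_compose]
      bounded_linear.continuous_on[OF bounded_linear_blinfun_mult_right]
      bounded_linear.continuous_on[OF bounded_linear_blinfun_mult_left]
      C1_imp_continuous_on assms)
qed

lemma C1_sum: "(\<And>i. i \<in> I \<Longrightarrow> C1 (f i)) \<Longrightarrow> C1 (\<lambda>x. \<Sum>i\<in>I. f i x)"
  by (induction I rule: infinite_finite_induct) (auto intro: C1_const C1_add)

lemma C1_prod:
  fixes f :: "'i \<Rightarrow> 'a::real_normed_vector \<Rightarrow> complex"
  shows "(\<And>i. i \<in> I \<Longrightarrow> C1 (f i)) \<Longrightarrow> C1 (\<lambda>x. \<Prod>i\<in>I. f i x)"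
  by (induction I rule: infinite_finite_induct) (auto intro: C1_const C1_mult)

lemma C1_power:
  fixes f :: "'a::real_normed_vector \<Rightarrow> complex"
  shows "C1 f \<Longrightarrow> C1 (\<lambda>x. f x ^ k)"
  by (induction k) (auto intro: C1_const C1_mult)

lemma C1_diff: "C1 f \<Longrightarrow> C1 g \<Longrightarrow> C1 (\<lambda>x. f x - g x)"
  using C1_add[OF _ C1_bounded_linear_compose[OF bounded_linear_minus[OF bounded_linear_ident]], of f g]
  by simp

lemma C1_vec_lambda:
  fixes f :: "'i::finite \<Rightarrow> 'a::real_normed_vector \<Rightarrow> 'b::euclidean_space"
  assumes "\<And>i. C1 (f i)" shows "C1 (\<lambda>x. \<chi> i. f i x)"
proof -
  have "bounded_linear (\<lambda>y::'b. axis i y)" for i :: 'i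
    by (intro linear_conv_bounded_linear[THEN iffD1] linearI) (auto simp: axis_def vec_eq_iff)
  then have "C1 (\<lambda>x. axis i (f i x))" for i
    by (rule C1_bounded_linear_compose[where h = "axis i" and f = "f i"]) (rule assms)
  then have "C1 (\<lambda>x. \<Sum>i\<in>UNIV. axis i (f i x))" by (rule C1_sum)
  moreover have "(\<Sum>i\<in>UNIV. axis i (f i x)) = (\<chi> i. f i x)" for x
    by (simp add: vec_eq_iff axis_def if_distrib sum.delta cong: if_cong)
  ultimately show ?thesis by simp
qed

lemma C1_Pair: "C1 f \<Longrightarrow> C1 g \<Longrightarrow> C1 (\<lambda>x. (f x, g x))"
  using C1_add[OF C1_bounded_linear_compose[OF bounded_linear_Pair[OF bounded_linear_ident bounded_linear_zero]]
      C1_bounded_linear_compose[OF bounded_linear_Pair[OF bounded_linear_zero bounded_linear_ident]], of f g]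
  by simp

subsection \<open>Nondegenerate zeros\<close>

text \<open>The derivative of \<open>F\<close> at \<open>z\<close> is injective.  Directional derivatives express this without naming the
  derivative and are all that \<open>generic_fibres\<close> provides.\<close>

definition nondegenerate :: "('e::real_normed_vector \<Rightarrow> 'f::real_normed_vector) \<Rightarrow> 'e \<Rightarrow> bool" where
  "nondegenerate F z \<longleftrightarrow>
     (\<forall>v. ((\<lambda>r::real. F (z + r *\<^sub>R v)) has_vector_derivative 0) (at 0) \<longrightarrow> v = 0)"

text \<open>The inverse function theorem for \<open>(t, z) \<mapsto> (t, H t z)\<close>, whose derivative is injective because \<open>z0\<close>
  is a nondegenerate zero of \<open>H t0\<close>.\<close>

lemma implicit_function:
  fixes H :: "'a::euclidean_space \<Rightarrow> 'e::euclidean_space \<Rightarrow> 'e"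
  assumes C1: "C1 (\<lambda>(t, z). H t z)" and zero: "H t0 z0 = 0" and nd: "nondegenerate (H t0) z0"
  obtains \<delta> \<rho> q where "\<delta> > 0" "\<rho> > 0" "continuous_on (ball t0 \<delta>) q" "q t0 = z0"
    "\<And>t. t \<in> ball t0 \<delta> \<Longrightarrow> q t \<in> ball z0 \<rho> \<and> H t (q t) = 0"
    "\<And>t z. t \<in> ball t0 \<delta> \<Longrightarrow> z \<in> ball z0 \<rho> \<Longrightarrow> H t z = 0 \<Longrightarrow> z = q t"
proof -
  define \<Psi> where "\<Psi> = (\<lambda>p. (fst p, H (fst p) (snd p)))"
  have H: "C1 (\<lambda>p. H (fst p) (snd p))" using C1 by (simp add: case_prod_unfold)
  then obtain H' where H': "\<And>p. ((\<lambda>p. H (fst p) (snd p)) has_derivative blinfun_apply (H' p)) (at p)"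
    unfolding C1_def by blast
  have "C1 \<Psi>"
    unfolding \<Psi>_def
    by (intro C1_Pair H C1_bounded_linear bounded_linear_fst)
  then obtain \<Psi>' where \<Psi>': "\<And>x. (\<Psi> has_derivative blinfun_apply (\<Psi>' x)) (at x)" "continuous_on UNIV \<Psi>'"
    unfolding C1_def by blast
  define L where "L = blinfun_apply (\<Psi>' (t0, z0))"
  have L: "L p = (fst p, blinfun_apply (H' (t0, z0)) p)" for p
  proof -
    have "(\<Psi> has_derivative (\<lambda>p. (fst p, blinfun_apply (H' (t0, z0)) p))) (at (t0, z0))"
      unfolding \<Psi>_def by (intro has_derivative_Pair H' has_derivative_fst has_derivative_ident)
    from has_derivative_unique[OF \<Psi>'(1) this] show ?thesis by (simp add: L_def)
  qed
  have linL: "linear L" unfolding L_def by (intro bounded_linear.linear blinfun.bounded_linear_right)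
  have "inj L"
  proof (subst linear_injective_0[OF linL], intro allI impI)
    fix p assume p: "L p = 0"
    then have "fst p = 0" "blinfun_apply (H' (t0, z0)) p = 0" by (auto simp: L prod_eq_iff)
    then obtain v where v: "p = (0, v)" "blinfun_apply (H' (t0, z0)) (0, v) = 0" by (cases p) auto
    have "((\<lambda>r::real. (t0, z0) + r *\<^sub>R (0, v)) has_derivative (\<lambda>r. r *\<^sub>R (0, v))) (at 0)"
      by (auto intro!: derivative_eq_intros)
    from has_derivative_compose[OF this, of "\<lambda>p. H (fst p) (snd p)" "blinfun_apply (H' (t0, z0))"] H'
    have "((\<lambda>r. H t0 (z0 + r *\<^sub>R v)) has_derivative (\<lambda>r. blinfun_apply (H' (t0, z0)) (r *\<^sub>R (0, v)))) (at 0)"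
      by simp
    then have "((\<lambda>r. H t0 (z0 + r *\<^sub>R v)) has_vector_derivative 0) (at 0)"
      unfolding has_vector_derivative_def by (simp add: blinfun.scaleR_right v(2) del: scaleR_Pair)
    then have "v = 0" using nd unfolding nondegenerate_def by blast
    then show "p = 0" by (simp add: v zero_prod_def)
  qed
  from linear_injective_left_inverse[OF linL this]
  obtain G where G: "linear G" "G \<circ> L = id" by blast
  have "bounded_linear G" using G(1) by (simp add: linear_conv_bounded_linear)
  moreover have "G (L p) = p" for p using G(2) by (metis comp_apply id_apply)
  ultimately have "Blinfun G o\<^sub>L \<Psi>' (t0, z0) = id_blinfun"
    by (intro blinfun_eqI) (simp only: blinfun_apply_blinfun_compose bounded_linear_Blinfun_apply
        blinfun_apply_id_blinfun L_def)
  then obtain U V g g' where U: "open U" "(t0, z0) \<in> U" "open V" "\<Psi> (t0, z0) \<in> V" "homeomorphism U V \<Psi> g"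
    using inverse_function_theorem[OF open_UNIV \<Psi>'(1) \<Psi>'(2), of "(t0, z0)" "Blinfun G"] by (metis UNIV_I)
  have \<Psi>0: "\<Psi> (t0, z0) = (t0, 0)" by (simp add: \<Psi>_def zero)
  have g0: "g (t0, 0) = (t0, z0)" using homeomorphism_apply1[OF U(5) U(2)] by (simp add: \<Psi>0)
  obtain A B where AB: "open A" "open B" "t0 \<in> A" "z0 \<in> B" "A \<times> B \<subseteq> U"
    using open_prod_elim[OF U(1,2)] by (metis SigmaD1 SigmaD2)
  obtain \<rho> where \<rho>: "\<rho> > 0" "ball z0 \<rho> \<subseteq> B" using AB openE by blast
  define V0 where "V0 = (\<lambda>t. (t, 0::'e)) -` V"
  have "open V0" unfolding V0_def using U(3) by (intro open_vimage continuous_intros)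
  have contg: "continuous_on V0 (\<lambda>t. g (t, 0))"
    by (rule continuous_on_compose2[OF homeomorphism_cont2[OF U(5)]]) (auto intro!: continuous_intros simp: V0_def)
  have "open (V0 \<inter> (\<lambda>t. g (t, 0)) -` (A \<times> ball z0 \<rho>))"
    using continuous_on_open_vimage[OF \<open>open V0\<close>, THEN iffD1, OF contg] AB(1) 
    by (metis Int_commute open_Times open_ball)
  moreover have "t0 \<in> V0 \<inter> (\<lambda>t. g (t, 0)) -` (A \<times> ball z0 \<rho>)"
    using U(4) \<rho> AB by (simp add: V0_def \<Psi>0 g0)
  ultimately have "open (A \<inter> (V0 \<inter> (\<lambda>t. g (t, 0)) -` (A \<times> ball z0 \<rho>)))"
    "t0 \<in> A \<inter> (V0 \<inter> (\<lambda>t. g (t, 0)) -` (A \<times> ball z0 \<rho>))" using AB by auto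
  then obtain \<delta> where \<delta>: "\<delta> > 0" "ball t0 \<delta> \<subseteq> A \<inter> (V0 \<inter> (\<lambda>t. g (t, 0)) -` (A \<times> ball z0 \<rho>))"
    by (meson openE)
  define q where "q t = snd (g (t, 0))" for t
  show ?thesis
  proof
    show "continuous_on (ball t0 \<delta>) q"
      unfolding q_def by (intro continuous_intros continuous_on_subset[OF contg]) (use \<delta> in auto)
    show "q t0 = z0" by (simp add: q_def g0)
    show "q t \<in> ball z0 \<rho> \<and> H t (q t) = 0" if t: "t \<in> ball t0 \<delta>" for t
    proof -
      have "(t, 0) \<in> V" "g (t, 0) \<in> A \<times> ball z0 \<rho>" using t \<delta> by (auto simp: V0_def)
      moreover have "\<Psi> (g (t, 0)) = (t, 0)" using homeomorphism_apply2[OF U(5)] calculation by blast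
      ultimately show ?thesis by (auto simp: q_def \<Psi>_def)
    qed
    show "z = q t" if t: "t \<in> ball t0 \<delta>" and z: "z \<in> ball z0 \<rho>" "H t z = 0" for t z
    proof -
      have "(t, z) \<in> U" using t z \<delta> \<rho> AB by blast
      then have "g (\<Psi> (t, z)) = (t, z)" using homeomorphism_apply1[OF U(5)] by blast
      then show ?thesis using z by (simp add: q_def \<Psi>_def)
    qed
  qed (use \<delta> \<rho> in auto)
qed

text \<open>The zeros at \<open>t0\<close> are isolated and bounded, hence finite in number, and each moves along a continuous
  branch.  For \<open>t\<close> near \<open>t0\<close> there are no further zeros: they would lie in a compact set that avoids all
  branches and contains no zero at \<open>t0\<close>.\<close>

lemma local_sheets:
  fixes H :: "'a::euclidean_space \<Rightarrow> 'e::euclidean_space \<Rightarrow> 'e"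
  assumes C1: "C1 (\<lambda>(t, z). H t z)" and nd: "\<forall>z. H t0 z = 0 \<longrightarrow> nondegenerate (H t0) z"
    and "e > 0" and bdd: "\<forall>t\<in>S \<inter> ball t0 e. \<forall>z. H t z = 0 \<longrightarrow> norm z \<le> R" and "t0 \<in> S"
  defines "Z \<equiv> {z. H t0 z = 0}"
  shows "finite Z \<and> (\<exists>\<delta> q. \<delta> > 0 \<and>
    (\<forall>z\<in>Z. continuous_on (ball t0 \<delta>) (q z) \<and> (\<forall>t\<in>ball t0 \<delta>. H t (q z t) = 0)) \<and>
    (\<forall>t\<in>S \<inter> ball t0 \<delta>. {z. H t z = 0} = (\<lambda>z. q z t) ` Z \<and> inj_on (\<lambda>z. q z t) Z))"
proof -
  have contH: "continuous_on UNIV (\<lambda>p. H (fst p) (snd p))"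
    using C1_imp_continuous_on[OF C1] by (simp add: case_prod_unfold)
  define A where "A z \<delta> \<rho> q \<longleftrightarrow> \<delta> > 0 \<and> \<rho> > 0 \<and> continuous_on (ball t0 \<delta>) q \<and> q t0 = z \<and>
     (\<forall>t\<in>ball t0 \<delta>. q t \<in> ball z \<rho> \<and> H t (q t) = 0 \<and> (\<forall>y\<in>ball z \<rho>. H t y = 0 \<longrightarrow> y = q t))"
    for z \<delta> \<rho> q
  have "\<forall>z\<in>Z. \<exists>\<delta> \<rho> q. A z \<delta> \<rho> q"
  proof
    fix z assume "z \<in> Z"
    then have z: "H t0 z = 0" by (simp add: Z_def)
    show "\<exists>\<delta> \<rho> q. A z \<delta> \<rho> q"
      unfolding A_def by (rule implicit_function[OF C1 z nd[rule_format, OF z]]) blast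
  qed
  then obtain \<delta>s \<rho>s q where A: "\<And>z. z \<in> Z \<Longrightarrow> A z (\<delta>s z) (\<rho>s z) (q z)" by metis
  have q: "\<And>z. z \<in> Z \<Longrightarrow> \<delta>s z > 0" "\<And>z. z \<in> Z \<Longrightarrow> \<rho>s z > 0"
    "\<And>z. z \<in> Z \<Longrightarrow> continuous_on (ball t0 (\<delta>s z)) (q z)" "\<And>z. z \<in> Z \<Longrightarrow> q z t0 = z"
    "\<And>z t. z \<in> Z \<Longrightarrow> t \<in> ball t0 (\<delta>s z) \<Longrightarrow> q z t \<in> ball z (\<rho>s z)"
    "\<And>z t. z \<in> Z \<Longrightarrow> t \<in> ball t0 (\<delta>s z) \<Longrightarrow> H t (q z t) = 0"
    "\<And>z t y. z \<in> Z \<Longrightarrow> t \<in> ball t0 (\<delta>s z) \<Longrightarrow> y \<in> ball z (\<rho>s z) \<Longrightarrow> H t y = 0 \<Longrightarrow> y = q z t"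
    using A unfolding A_def by blast+
  have cont0: "continuous_on UNIV (H t0)"
    using continuous_on_compose2[OF contH, of UNIV "\<lambda>z. (t0, z)"] by (simp add: continuous_intros)
  have "Z = H t0 -` {0}" by (auto simp: Z_def)
  then have "closed Z" using cont0 by (simp add: continuous_on_closed_vimage closed_vimage)
  moreover have Zb: "Z \<subseteq> cball 0 R"
    using bdd[rule_format, of t0] \<open>e > 0\<close> \<open>t0 \<in> S\<close> by (auto simp: Z_def)
  ultimately have "compact Z" by (meson bounded_cball bounded_subset compact_eq_bounded_closed)
  moreover have "Z \<subseteq> (\<Union>z\<in>Z. ball z (\<rho>s z))" using q(2) by force
  ultimately obtain Z' where Z': "Z' \<subseteq> Z" "finite Z'" "Z \<subseteq> (\<Union>z\<in>Z'. ball z (\<rho>s z))"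
    using compactE_image[of Z Z "\<lambda>z. ball z (\<rho>s z)"] by (metis open_ball)
  have "Z \<subseteq> Z'"
  proof
    fix y assume "y \<in> Z"
    with Z' obtain z where z: "z \<in> Z'" "y \<in> ball z (\<rho>s z)" by blast
    with q(7)[of z t0 y] q(1,4)[of z] Z'(1) \<open>y \<in> Z\<close> have "y = z" by (auto simp: Z_def)
    with z show "y \<in> Z'" by simp
  qed
  then have fin: "finite Z" using Z'(2) finite_subset by blast
  have e1: "\<forall>\<^sub>F t in nhds t0. \<forall>z\<in>Z. t \<in> ball t0 (\<delta>s z)"
    using q(1) fin by (intro eventually_ball_finite ballI eventually_nhds_in_open) auto
  have e2: "\<forall>\<^sub>F t in nhds t0. \<forall>z\<in>Z. \<forall>y\<in>Z. z \<noteq> y \<longrightarrow> q z t \<noteq> q y t"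
  proof (intro eventually_ball_finite ballI fin)
    fix z y assume zy: "z \<in> Z" "y \<in> Z"
    show "\<forall>\<^sub>F t in nhds t0. z \<noteq> y \<longrightarrow> q z t \<noteq> q y t"
    proof (cases "z = y")
      case False
      have "((\<lambda>t. q z t - q y t) \<longlongrightarrow> q z t0 - q y t0) (nhds t0)" 
        using q(1,3)[OF zy(1)] q(1,3)[OF zy(2)]
        by (intro tendsto_diff) (simp_all add: continuous_on_eq_continuous_at isCont_def tendsto_at_iff_tendsto_nhds)
      then have "\<forall>\<^sub>F t in nhds t0. q z t - q y t \<noteq> 0"
        using False zy q(4) by (intro tendsto_imp_eventually_ne) auto
      then show ?thesis by (rule eventually_mono) auto
    qed simp
  qed
  have e3: "\<forall>\<^sub>F t in nhds t0. \<forall>z\<in>cball 0 R - (\<Union>z\<in>Z. ball z (\<rho>s z)). H t z \<noteq> 0"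
  proof -
    define C where "C = cball 0 R - (\<Union>z\<in>Z. ball z (\<rho>s z))"
    have "compact C" unfolding C_def by (intro compact_diff compact_cball) auto
    moreover have "open ((\<lambda>p. H (fst p) (snd p)) -` (- {0}))"
      using contH by (intro open_vimage) auto
    moreover have "{t0} \<times> C \<subseteq> (\<lambda>p. H (fst p) (snd p)) -` (- {0})"
    proof -
      have "H t0 z \<noteq> 0" if "z \<in> C" for z
        using that q(2)[of z] by (auto simp: C_def Z_def)
      then show ?thesis by auto
    qed
    ultimately obtain X where "t0 \<in> X" "open X" "X \<times> C \<subseteq> (\<lambda>p. H (fst p) (snd p)) -` (- {0})"
      using Elementary_Topology.tube_lemma[of C "(\<lambda>p. H (fst p) (snd p)) -` (- {0})" t0] by blast
    then show ?thesis
      unfolding eventually_nhds C_def[symmetric] by (intro exI[of _ X]) auto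
  qed
  have e4: "\<forall>\<^sub>F t in nhds t0. t \<in> ball t0 e" using \<open>e > 0\<close> by (intro eventually_nhds_in_open) auto
  from eventually_conj[OF e1 eventually_conj[OF e2 eventually_conj[OF e3 e4]]]
  obtain \<delta> where \<delta>0: "\<delta> > 0" "\<forall>t. dist t t0 < \<delta> \<longrightarrow> (\<forall>z\<in>Z. t \<in> ball t0 (\<delta>s z)) \<and>
      (\<forall>z\<in>Z. \<forall>y\<in>Z. z \<noteq> y \<longrightarrow> q z t \<noteq> q y t) \<and>
      (\<forall>z\<in>cball 0 R - (\<Union>z\<in>Z. ball z (\<rho>s z)). H t z \<noteq> 0) \<and> t \<in> ball t0 e"
    unfolding eventually_nhds_metric by blast
  then have \<delta>: "\<delta> > 0" "\<And>t. t \<in> ball t0 \<delta> \<Longrightarrow> (\<forall>z\<in>Z. t \<in> ball t0 (\<delta>s z)) \<and>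
      (\<forall>z\<in>Z. \<forall>y\<in>Z. z \<noteq> y \<longrightarrow> q z t \<noteq> q y t) \<and>
      (\<forall>z\<in>cball 0 R - (\<Union>z\<in>Z. ball z (\<rho>s z)). H t z \<noteq> 0) \<and> t \<in> ball t0 e"
    by (simp_all add: dist_commute[of t0])
  have "{z. H t z = 0} = (\<lambda>z. q z t) ` Z \<and> inj_on (\<lambda>z. q z t) Z" if t: "t \<in> S \<inter> ball t0 \<delta>" for t
  proof
    show "inj_on (\<lambda>z. q z t) Z" using \<delta>(2) t by (intro inj_onI) blast
    have "y \<in> (\<lambda>z. q z t) ` Z" if y: "H t y = 0" for y
    proof -
      have "y \<in> cball 0 R" using bdd[rule_format, of t y] t \<delta>(2) y by auto
      then have "y \<in> (\<Union>z\<in>Z. ball z (\<rho>s z))" using \<delta>(2)[of t] t y by blast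
      then obtain z where "z \<in> Z" "y \<in> ball z (\<rho>s z)" by blast
      with q(7)[of z t y] \<delta>(2)[of t] t y show ?thesis by blast
    qed
    then show "{z. H t z = 0} = (\<lambda>z. q z t) ` Z" using q(6) \<delta>(2) t by blast
  qed
  moreover have "continuous_on (ball t0 \<delta>) (q z)" if "z \<in> Z" for z
    using \<delta>(2) that by (intro continuous_on_subset[OF q(3)[OF that]]) blast
  moreover have "H t (q z t) = 0" if "z \<in> Z" "t \<in> ball t0 \<delta>" for t z
    using q(6) \<delta>(2) that by blast
  ultimately show ?thesis using fin \<delta>(1) by (intro conjI exI[of _ \<delta>] exI[of _ q]) auto
qed

theorem card_zeros_constant:
  fixes H :: "'a::euclidean_space \<Rightarrow> 'e::euclidean_space \<Rightarrow> 'e"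
  assumes C1: "C1 (\<lambda>(t, z). H t z)" and nd: "\<And>t z. t \<in> S \<Longrightarrow> H t z = 0 \<Longrightarrow> nondegenerate (H t) z"
    and bdd: "\<And>t. t \<in> S \<Longrightarrow> \<exists>e>0. \<exists>R. \<forall>s\<in>S \<inter> ball t e. \<forall>z. H s z = 0 \<longrightarrow> norm z \<le> R"
    and S: "connected S" "a \<in> S" "b \<in> S"
  shows "finite {z. H a z = 0}" "card {z. H a z = 0} = card {z. H b z = 0}"
proof -
  have loc: "finite {z. H t z = 0} \<and> (\<forall>\<^sub>F s in at t within S. card {z. H t z = 0} = card {z. H s z = 0})"
    if t: "t \<in> S" for t
  proof -
    obtain e R where e: "e > 0" "\<forall>s\<in>S \<inter> ball t e. \<forall>z. H s z = 0 \<longrightarrow> norm z \<le> R"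
      using bdd[OF t] by blast
    have fin: "finite {z. H t z = 0}" using local_sheets[OF C1 _ e t] nd[OF t] by blast
    obtain \<delta> q where q: "\<delta> > 0"
      "\<forall>s\<in>S \<inter> ball t \<delta>. {z. H s z = 0} = (\<lambda>z. q z s) ` {z. H t z = 0} \<and> inj_on (\<lambda>z. q z s) {z. H t z = 0}"
      using local_sheets[OF C1 _ e t] nd[OF t] by blast
    have "\<forall>\<^sub>F s in at t within S. s \<in> S \<inter> ball t \<delta>"
      using q(1) by (auto simp: eventually_at dist_commute)
    then have "\<forall>\<^sub>F s in at t within S. card {z. H t z = 0} = card {z. H s z = 0}"
      by (rule eventually_mono) (use q(2) in \<open>simp add: card_image\<close>)
    with fin show ?thesis by blast
  qed
  show "finite {z. H a z = 0}" using loc S by blast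
  show "card {z. H a z = 0} = card {z. H b z = 0}"
    by (rule connected_local_const[OF S]) (use loc in blast)
qed

text \<open>Near \<open>t = 1\<close> the path comes from the implicit function theorem.  From there it is
  continued to the left, where by \<open>local_sheets\<close> every zero lies on a local branch; Bolzano's principle
  joins the local branches.\<close>

theorem zero_path_lifting:
  fixes H :: "real \<Rightarrow> 'e::euclidean_space \<Rightarrow> 'e"
  assumes C1: "C1 (\<lambda>(t, z). H t z)"
    and nd: "\<And>t z. t \<in> {0..<1} \<Longrightarrow> H t z = 0 \<Longrightarrow> nondegenerate (H t) z"
    and bdd: "\<And>t. t \<in> {0..<1} \<Longrightarrow> \<exists>e>0. \<exists>R. \<forall>s\<in>{0..<1} \<inter> ball t e. \<forall>z. H s z = 0 \<longrightarrow> norm z \<le> R"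
    and z: "H 1 z = 0" "nondegenerate (H 1) z"
  shows "\<exists>p. continuous_on {0..<1} p \<and> (\<forall>t\<in>{0..<1}. H t (p t) = 0) \<and> (p \<longlongrightarrow> z) (at_left 1)"
proof -
  obtain \<delta> q where q: "\<delta> > 0" "continuous_on (ball 1 \<delta>) q" "q 1 = z" "\<And>t. t \<in> ball 1 \<delta> \<Longrightarrow> H t (q t) = 0"
    by (rule implicit_function[OF C1 z]) blast
  define b where "b = 1 - min \<delta> 1 / 2"
  have b: "0 \<le> b" "b < 1" "{b..1} \<subseteq> ball 1 \<delta>" using q(1) by (auto simp: b_def dist_real_def min_def split: if_splits)
  define P where "P a b \<longleftrightarrow> (0 \<le> a \<longrightarrow> b < 1 \<longrightarrow> (\<forall>w. H b w = 0 \<longrightarrow>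
     (\<exists>r. continuous_on {a..b} r \<and> (\<forall>t\<in>{a..b}. H t (r t) = 0) \<and> r b = w)))" for a b
  have "P 0 b"
    using b(1)
  proof (induction rule: Bolzano)
    case (trans a b c)
    show ?case
      unfolding P_def
    proof (intro impI allI)
      fix w assume *: "0 \<le> a" "c < 1" "H c w = 0"
      obtain r2 where r2: "continuous_on {b..c} r2" "\<forall>t\<in>{b..c}. H t (r2 t) = 0" "r2 c = w"
        using trans * unfolding P_def by (meson order_trans)
      then have "H b (r2 b) = 0" using trans by auto
      then obtain r1 where r1: "continuous_on {a..b} r1" "\<forall>t\<in>{a..b}. H t (r1 t) = 0" "r1 b = r2 b"
        using trans * unfolding P_def by (meson order_le_less_trans)
      have "continuous_on ({a..b} \<union> {b..c}) (\<lambda>t. if t \<le> b then r1 t else r2 t)"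
        using r1 r2 by (intro continuous_on_If) auto
      moreover have "{a..b} \<union> {b..c} = {a..c}" using trans by auto
      ultimately show "\<exists>r. continuous_on {a..c} r \<and> (\<forall>t\<in>{a..c}. H t (r t) = 0) \<and> r c = w"
        using r1 r2 trans by (intro exI[of _ "\<lambda>t. if t \<le> b then r1 t else r2 t"]) (auto intro: antisym)
    qed
  next
    case (local x)
    then have x: "x \<in> {0..<1}" using b by auto
    obtain e R where e: "e > 0" "\<forall>s\<in>{0..<1} \<inter> ball x e. \<forall>z. H s z = 0 \<longrightarrow> norm z \<le> R"
      using bdd[OF x] by blast
    obtain d q where q: "d > 0"
      "\<forall>z\<in>{z. H x z = 0}. continuous_on (ball x d) (q z) \<and> (\<forall>s\<in>ball x d. H s (q z s) = 0)"
      "\<forall>s\<in>{0..<1} \<inter> ball x d. {z. H s z = 0} = (\<lambda>z. q z s) ` {z. H x z = 0} \<and> inj_on (\<lambda>z. q z s) {z. H x z = 0}"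
      using local_sheets[OF C1 _ e x] nd[OF x] by blast
    have "P a b" if ab: "a \<le> x" "x \<le> b" "b - a < d" for a b
      unfolding P_def
    proof (intro impI allI)
      fix w assume *: "0 \<le> a" "b < 1" "H b w = 0"
      have sub: "{a..b} \<subseteq> {0..<1} \<inter> ball x d" using ab * by (auto simp: dist_real_def)
      moreover have "b \<in> {a..b}" using ab by auto
      ultimately have "b \<in> {0..<1} \<inter> ball x d" by blast
      with q(3) * obtain y where "H x y = 0" "w = q y b" by blast
      then show "\<exists>r. continuous_on {a..b} r \<and> (\<forall>t\<in>{a..b}. H t (r t) = 0) \<and> r b = w"
        using sub q(2) by (intro exI[of _ "q y"]) (auto intro: continuous_on_subset)
    qed
    then show ?case using q(1) by blast
  qed
  moreover have Hq: "H t (q t) = 0" if "b \<le> t" "t \<le> 1" for t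
    by (rule q(4)) (rule subsetD[OF b(3)], use that in simp)
  then have "H b (q b) = 0" using b by simp
  ultimately obtain r where r: "continuous_on {0..b} r" "\<forall>t\<in>{0..b}. H t (r t) = 0" "r b = q b"
    using b unfolding P_def by blast
  define p where "p t = (if t \<le> b then r t else q t)" for t
  have "continuous_on ({0..b} \<union> {b..1}) p"
    unfolding p_def using r b q by (intro continuous_on_If) (auto intro: continuous_on_subset)
  moreover have "{0..b} \<union> {b..1} = {0..1}" using b by auto
  ultimately have cont: "continuous_on {0..1} p" by simp
  moreover have "H t (p t) = 0" if "t \<in> {0..<1}" for t
    using that r(2) Hq[of t] by (auto simp: p_def)
  moreover have "(p \<longlongrightarrow> z) (at_left 1)"
  proof -
    have "(p \<longlongrightarrow> p 1) (at 1 within {0..1})" using cont by (auto simp: continuous_on_def)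
    moreover have "at_left 1 = at 1 within {0..(1::real)}"
      using at_within_Icc_at_left[of 0 "1::real"] by simp
    moreover have "p 1 = z" using b q by (simp add: p_def)
    ultimately show ?thesis by simp
  qed
  ultimately show ?thesis by (intro exI[of _ p]) (auto intro: continuous_on_subset)
qed

section \<open>Systems supported in a simplex\<close>

definition mon :: "complex ^ 'n::finite \<Rightarrow> ('n \<Rightarrow>\<^sub>0 nat) \<Rightarrow> complex" where
  "mon x \<alpha> = (\<Prod>j\<in>UNIV. (x $ j) ^ lookup \<alpha> j)"

abbreviation gradient_form :: "('n::finite \<Rightarrow>\<^sub>0 nat) set \<Rightarrow> ('n \<Rightarrow> ('n \<Rightarrow>\<^sub>0 nat) \<Rightarrow> complex) \<Rightarrow> 'n \<Rightarrow>
    complex ^ 'n \<Rightarrow> complex" where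
  "gradient_form A p i x \<equiv>
     \<Sum>\<alpha>\<in>A. of_nat (lookup \<alpha> i) * p i \<alpha> * mon x (\<alpha> - single i 1)"

text \<open>The gradient coefficients \<open>p\<close>, the coefficients \<open>h\<close> of the constraint and the costs \<open>U\<close> are
  independent of each other.  So the Lagrange system, the start system, the homotopy between them and
  the deformation used for the degree are all of this form.\<close>

definition critical_system :: "('n::finite \<Rightarrow>\<^sub>0 nat) set \<Rightarrow> ('n \<Rightarrow> complex) \<Rightarrow> ('n \<Rightarrow> ('n \<Rightarrow>\<^sub>0 nat) \<Rightarrow> complex) \<Rightarrow>
    (('n \<Rightarrow>\<^sub>0 nat) \<Rightarrow> complex) \<Rightarrow> 'n system" where
  "critical_system A U p h = (\<lambda>(x, l).
     (\<chi> i. U i - l * gradient_form A p i x,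
      \<Sum>\<alpha>\<in>A. h \<alpha> * mon x \<alpha>))"

definition start_gradient :: "('n \<Rightarrow> nat) \<Rightarrow> complex ^ 'n \<Rightarrow> 'n::finite \<Rightarrow> ('n \<Rightarrow>\<^sub>0 nat) \<Rightarrow> complex" where
  "start_gradient d c i \<alpha> = (if \<alpha> = single i (d i) then c $ i else 0)"

definition start_constraint :: "('n::{finite,linorder} \<Rightarrow> nat) \<Rightarrow> complex \<Rightarrow> (complex, 'n) vec \<Rightarrow> ('n \<Rightarrow>\<^sub>0 nat) \<Rightarrow> complex" where
  "start_constraint d c0 c \<alpha> = (if \<alpha> = 0 then c0
     else if \<alpha> = single (Min UNIV) (d (Min UNIV)) then c $ Min UNIV else 0)"

lemma critical_system_eq_0_iff:
  "critical_system A U p h (x, l) = 0 \<longleftrightarrow>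
    (\<forall>i. U i = l * gradient_form A p i x) \<and>
    (\<Sum>\<alpha>\<in>A. h \<alpha> * mon x \<alpha>) = 0"
  by (simp add: critical_system_def zero_prod_def vec_eq_iff)

lemma mon_single: "mon x (single i k) = (x $ i) ^ k"
proof -
  have "mon x (single i k) = (\<Prod>j\<in>UNIV. if j = i then (x $ j) ^ k else 1)"
    unfolding mon_def by (rule prod.cong) (auto simp: lookup_single when_def)
  then show ?thesis by (simp add: prod.delta)
qed

lemma mon_zero: "mon x 0 = 1"
  by (simp add: mon_def)

lemma single_diff_single:
  "single i k - single i 1 = single i (k - (1::nat))"
  by (rule poly_mapping_eqI) (simp add: lookup_minus lookup_single when_def)

lemma lagrange_system_eq_critical_system:
  "lagrange_system u f = critical_system (keys f) (\<lambda>i. of_real (u $ i))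
     (\<lambda>_ \<alpha>. of_real (lookup f \<alpha>)) (\<lambda>\<alpha>. of_real (lookup f \<alpha>))"
proof -
  have lk: "lookup (complexify f) \<alpha> = of_real (lookup f \<alpha>)" for \<alpha>
    by (simp add: complexify_def Poly_Mapping.map.rep_eq when_def)
  have keys: "keys (complexify f) = keys f"
    by (auto simp: in_keys_iff lk)
  have mon: "(\<Prod>v\<in>keys \<alpha>. (x $ v) ^ lookup \<alpha> v) = mon x \<alpha>"
    for \<alpha> and x :: "complex ^ 'a"
    unfolding mon_def by (intro prod.mono_neutral_left) (auto simp: in_keys_iff)
  have 1: "mpoly_eval (complexify f) (($) x) = (\<Sum>\<alpha>\<in>keys f. of_real (lookup f \<alpha>) * mon x \<alpha>)"
    for x by (simp add: mpoly_eval_def keys lk mon)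
  have 2: "mpoly_eval (mpoly_pderiv i (complexify f)) (($) x) = (\<Sum>\<alpha>\<in>keys f.
      of_nat (lookup \<alpha> i) * of_real (lookup f \<alpha>) * mon x (\<alpha> - single i 1))"
    for x i by (simp add: mpoly_pderiv_def mpoly_eval_sum mpoly_eval_single keys lk mon)
  show ?thesis by (simp add: lagrange_system_def critical_system_def 1 2)
qed

lemma C1_coordinate: "C1 (\<lambda>q. fst (snd q) $ j)" "C1 (\<lambda>q. snd (snd q))"
  by (intro C1_bounded_linear bounded_linear_intros bounded_linear_compose[OF bounded_linear_vec_nth]
      bounded_linear_compose[OF bounded_linear_fst bounded_linear_snd]
      bounded_linear_compose[OF bounded_linear_snd bounded_linear_snd])+

text \<open>The coefficients may depend on a base point \<open>t\<close>; the system is then continuously differentiable in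
  \<open>t\<close> and the unknowns together.\<close>

lemma C1_critical_system:
  fixes U :: "'a::real_normed_vector \<Rightarrow> 'n::finite \<Rightarrow> complex"
  assumes "\<And>i. C1 (\<lambda>t. U t i)" "\<And>i \<alpha>. \<alpha> \<in> A \<Longrightarrow> C1 (\<lambda>t. p t i \<alpha>)" "\<And>\<alpha>. \<alpha> \<in> A \<Longrightarrow> C1 (\<lambda>t. h t \<alpha>)"
  shows "C1 (\<lambda>(t, z). critical_system A (U t) (p t) (h t) z)"
proof -
  have fst: "C1 (\<lambda>q::'a \<times> _. g (fst q))" if g: "C1 g" for g :: "'a \<Rightarrow> complex"
  proof -
    obtain g' where g': "\<And>x. (g has_derivative blinfun_apply (g' x)) (at x)" "continuous_on UNIV g'"
      using g unfolding C1_def by blast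
    show ?thesis
    proof (rule C1I)
      show "((\<lambda>q::'a \<times> _. g (fst q)) has_derivative (\<lambda>v. g' (fst q) (fst v))) (at q)" for q
        using has_derivative_compose[OF has_derivative_fst[OF has_derivative_ident] g'(1)] by blast
      show "blinfun_apply (g' (fst q) o\<^sub>L Blinfun fst) v = g' (fst q) (fst v)" for q v :: "'a \<times> _"
        by (simp add: bounded_linear_Blinfun_apply[OF bounded_linear_fst])
      show "continuous_on UNIV (\<lambda>q::'a \<times> _. g' (fst q) o\<^sub>L Blinfun fst)"
        by (intro bounded_bilinear.continuous_on[OF bounded_bilinear_blinfun_compose] continuous_intros
            continuous_on_compose2[OF g'(2)]) auto
    qed
  qed
  have mon: "C1 (\<lambda>q::'a \<times> _. mon (fst (snd q)) \<alpha>)" for \<alpha>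
    unfolding mon_def by (intro C1_prod C1_power C1_coordinate)
  have 1: "C1 (\<lambda>q::'a \<times> _. of_nat (lookup \<alpha> i) * p (fst q) i \<alpha> *
      mon (fst (snd q)) (\<alpha> - single i 1))" if "\<alpha> \<in> A" for i \<alpha>
    by (rule C1_mult[OF C1_mult[OF C1_const fst[OF assms(2)[OF that]]] mon])
  have 2: "C1 (\<lambda>q::'a \<times> _. h (fst q) \<alpha> * mon (fst (snd q)) \<alpha>)" if "\<alpha> \<in> A" for \<alpha>
    by (rule C1_mult[OF fst[OF assms(3)[OF that]] mon])
  have "C1 (\<lambda>q. (\<chi> i. U (fst q) i - snd (snd q) * (\<Sum>\<alpha>\<in>A. of_nat (lookup \<alpha> i) * p (fst q) i \<alpha> *
      mon (fst (snd q)) (\<alpha> - single i 1)), \<Sum>\<alpha>\<in>A. h (fst q) \<alpha> * mon (fst (snd q)) \<alpha>))"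
    by (rule C1_Pair[OF C1_vec_lambda[OF C1_diff[OF fst[OF assms(1)] C1_mult[OF C1_coordinate(2) C1_sum[OF 1]]]] C1_sum[OF 2]])
  then show ?thesis by (simp add: critical_system_def case_prod_unfold)
qed

text \<open>The support has Newton polytope \<open>Conv {0, d i * e i}\<close>, and no variable but the first is
  restricted to linear terms.\<close>

locale simplex_support =
  fixes d :: "'n::{finite,linorder} \<Rightarrow> nat" and A :: "('n \<Rightarrow>\<^sub>0 nat) set"
  assumes finA: "finite A" and d_pos: "1 \<le> d i" and d_mono: "mono d"
    and zero_in: "0 \<in> A" and vertex_in: "single i (d i) \<in> A"
    and below: "\<alpha> \<in> A \<Longrightarrow> (\<Sum>i\<in>UNIV. real (lookup \<alpha> i) / real (d i)) \<le> 1"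
    and d2: "i \<noteq> Min UNIV \<Longrightarrow> 2 \<le> d i"
begin

abbreviation i1 :: 'n where "i1 \<equiv> Min UNIV"

lemma i1_le: "i1 \<le> i" by (rule Min_le) auto

lemma d_i1_le: "d i1 \<le> d i" using d_mono i1_le by (rule monoD)

lemma vertex_neq_0: "single i (d i) \<noteq> 0"
  using d_pos[of i] by (metis lookup_single_eq lookup_zero not_one_le_zero)

lemma gradient_start:
  "gradient_form A (start_gradient d c) i x =
    of_nat (d i) * c $ i * (x $ i) ^ (d i - 1)"
proof -
  have "gradient_form A (start_gradient d c) i x =
      (\<Sum>\<alpha>\<in>A. if \<alpha> = single i (d i) then of_nat (d i) * c $ i * (x $ i) ^ (d i - 1) else 0)"
    by (intro sum.cong refl) (simp add: start_gradient_def single_diff_single mon_single del: One_nat_def)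
  then show ?thesis using finA vertex_in by (simp add: sum.delta)
qed

lemma constraint_start:
  "(\<Sum>\<alpha>\<in>A. start_constraint d c0 c \<alpha> * mon x \<alpha>) = c0 + c $ i1 * (x $ i1) ^ d i1"
proof -
  have "(\<Sum>\<alpha>\<in>A. start_constraint d c0 c \<alpha> * mon x \<alpha>) = (\<Sum>\<alpha>\<in>{0, single i1 (d i1)}. start_constraint d c0 c \<alpha> * mon x \<alpha>)"
    using finA zero_in vertex_in by (intro sum.mono_neutral_right) (auto simp: start_constraint_def)
  then show ?thesis using vertex_neq_0[of i1]
    by (auto simp: start_constraint_def mon_zero mon_single)
qed

lemma start_system_eq_critical_system:
  "start_system u d c0 c = critical_system A (\<lambda>i. of_real (u $ i)) (start_gradient d c) (start_constraint d c0 c)"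
  unfolding start_system_def critical_system_def gradient_start constraint_start by (simp add: mult_ac)

text \<open>The system is triangular: the last equation determines \<open>x $ i1\<close>, which is nonzero as \<open>c0 \<noteq> 0\<close>; then
  the equation of \<open>i1\<close> determines \<open>l\<close>, and the equation of \<open>i\<close> determines \<open>x $ i\<close>.  A vector
  annihilated by the derivative vanishes for the same reasons, in the same order.\<close>

lemma start_nondegenerate:
  assumes u: "\<And>i. u $ i \<noteq> 0" and c: "\<And>i. c $ i \<noteq> 0" and c0: "c0 \<noteq> 0"
    and z: "start_system u d c0 c z = 0"
  shows "nondegenerate (start_system u d c0 c) z"
  unfolding nondegenerate_def
proof (intro allI impI)
  obtain x l where xl: "z = (x, l)" by (cases z)
  fix v :: "(complex, 'n) vec \<times> complex"
  obtain y m where ym: "v = (y, m)" by (cases v)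
  assume v: "((\<lambda>r::real. start_system u d c0 c (z + r *\<^sub>R v)) has_vector_derivative 0) (at 0)"
  have eq: "of_real (u $ i) = of_nat (d i) * l * c $ i * (x $ i) ^ (d i - 1)" for i
    using z by (simp add: start_system_def xl zero_prod_def vec_eq_iff)
  have eq0: "c0 + c $ i1 * (x $ i1) ^ d i1 = 0"
    using z by (simp add: start_system_def xl zero_prod_def)
  have l: "l \<noteq> 0" using eq[of i1] u[of i1] by auto
  have x1: "x $ i1 \<noteq> 0" using eq0 c0 d_pos[of i1] by (cases "x $ i1 = 0") (auto simp: power_0_left)
  have "((\<lambda>r::real. snd (start_system u d c0 c (z + r *\<^sub>R v))) has_vector_derivative snd (0 :: (complex, 'n) vec \<times> complex)) (at 0)"
    by (rule bounded_linear.has_vector_derivative[OF bounded_linear_snd v])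
  then have d0: "((\<lambda>r::real. c0 + c $ i1 * (x $ i1 + of_real r * y $ i1) ^ d i1) has_vector_derivative 0) (at 0)"
    by (simp add: start_system_def xl ym scaleR_conv_of_real[where 'a = complex])
  have "((\<lambda>s. c0 + c $ i1 * (x $ i1 + s * y $ i1) ^ d i1) has_field_derivative
      c $ i1 * (of_nat (d i1) * (x $ i1) ^ (d i1 - 1) * y $ i1)) (at (of_real 0))"
    by (auto intro!: derivative_eq_intros)
  from vector_derivative_unique_at[OF d0 has_vector_derivative_real_field[OF this]]
  have y1: "y $ i1 = 0" using c[of i1] x1 d_pos[of i1] by auto
  have di: "l * (of_nat (d i - 1) * (x $ i) ^ (d i - 1 - 1) * y $ i) + m * (x $ i) ^ (d i - 1) = 0" for i
  proof -
    have "((\<lambda>r::real. fst (start_system u d c0 c (z + r *\<^sub>R v)) $ i) has_vector_derivative fst (0 :: (complex, 'n) vec \<times> complex) $ i) (at 0)"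
      by (rule bounded_linear.has_vector_derivative[OF bounded_linear_compose[OF bounded_linear_vec_nth bounded_linear_fst] v])
    then have d0: "((\<lambda>r::real. of_real (u $ i) - of_nat (d i) * (l + of_real r * m) * c $ i * (x $ i + of_real r * y $ i) ^ (d i - 1))
        has_vector_derivative 0) (at 0)"
      by (simp add: start_system_def xl ym scaleR_conv_of_real[where 'a = complex])
    have "((\<lambda>s. of_real (u $ i) - of_nat (d i) * (l + s * m) * c $ i * (x $ i + s * y $ i) ^ (d i - 1)) has_field_derivative
        - (of_nat (d i) * c $ i * (l * (of_nat (d i - 1) * (x $ i) ^ (d i - 1 - 1) * y $ i) + m * (x $ i) ^ (d i - 1)))) (at (of_real 0))"
      by (auto intro!: derivative_eq_intros simp: algebra_simps)
    from vector_derivative_unique_at[OF d0 has_vector_derivative_real_field[OF this]]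
    show ?thesis using c[of i] d_pos[of i] by auto
  qed
  have m: "m = 0" using di[of i1] y1 x1 by simp
  have "y $ i = 0" for i
  proof (cases "i = i1")
    case False
    then have "x $ i \<noteq> 0" using eq[of i] u[of i] d2[of i] by (auto simp: power_0_left split: if_splits)
    then show ?thesis using di[of i] m l d2[OF False] by auto
  qed (use y1 in simp)
  then show "v = 0" by (simp add: ym m zero_prod_def vec_eq_iff)
qed

text \<open>A zero is a \<open>d i1\<close>-th root for \<open>x $ i1\<close>, the multiplier \<open>L\<close> that it determines, and a \<open>(d i - 1)\<close>-th
  root for each of the other coordinates.\<close>

lemma card_zeros_start:
  assumes u: "\<And>i. u $ i \<noteq> 0" and c: "\<And>i. c $ i \<noteq> 0" and c0: "c0 \<noteq> 0"
  shows "card {z. start_system u d c0 c z = 0} = d i1 * (\<Prod>i\<in>UNIV - {i1}. d i - 1)"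
proof -
  define X1 where "X1 = {a::complex. a ^ d i1 = - c0 / c $ i1}"
  define L where "L a = of_real (u $ i1) / (of_nat (d i1) * c $ i1 * a ^ (d i1 - 1))" for a
  define B where "B a = PiE (UNIV - {i1}) (\<lambda>i. {b. b ^ (d i - 1) = of_real (u $ i) / (of_nat (d i) * L a * c $ i)})" for a
  define F where "F = (\<lambda>(a, g). ((\<chi> i. if i = i1 then a else g i), L a))"
  have a0: "a \<noteq> 0" if "a \<in> X1" for a
    using that c0 c[of i1] d_pos[of i1] by (auto simp: X1_def power_0_left)
  have L0: "L a \<noteq> 0" if "a \<in> X1" for a
    using a0[OF that] c[of i1] d_pos[of i1] u[of i1] by (auto simp: L_def)
  have "finite X1" "card X1 = d i1"
    unfolding X1_def using c0 c d_pos[of i1] by (auto intro!: card_nth_roots finite_nth_roots)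
  have cB: "card (B a) = (\<Prod>i\<in>UNIV - {i1}. d i - 1)" if "a \<in> X1" for a
    unfolding B_def
  proof (subst card_PiE)
    show "(\<Prod>i\<in>UNIV - {i1}. card {b. b ^ (d i - 1) = of_real (u $ i) / (of_nat (d i) * L a * c $ i)}) = (\<Prod>i\<in>UNIV - {i1}. d i - 1)"
    proof (rule prod.cong[OF refl])
      fix i assume "i \<in> UNIV - {i1}"
      then have "d i \<ge> 2" using d2 by auto
      then show "card {b. b ^ (d i - 1) = of_real (u $ i) / (of_nat (d i) * L a * c $ i)} = d i - 1"
        using u[of i] c[of i] L0[OF that] by (intro card_nth_roots) auto
    qed
  qed auto
  have finB: "finite (B a)" for a
  proof -
    have "finite {b. b ^ (d i - 1) = of_real (u $ i) / (of_nat (d i) * L a * c $ i)}" if "i \<in> UNIV - {i1}" for i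
      using d2[of i] that by (intro finite_nth_roots) auto
    then show ?thesis unfolding B_def by (intro finite_PiE) auto
  qed
  have "bij_betw F (SIGMA a:X1. B a) {z. start_system u d c0 c z = 0}"
  proof (rule bij_betwI')
    show "F s = F t \<longleftrightarrow> s = t" if "s \<in> (SIGMA a:X1. B a)" "t \<in> (SIGMA a:X1. B a)" for s t
    proof
      assume eq: "F s = F t"
      obtain a g where s: "s = (a, g)" by (cases s)
      obtain b h where t: "t = (b, h)" by (cases t)
      have v: "(if i = i1 then a else g i) = (if i = i1 then b else h i)" for i
        using eq by (simp add: F_def s t vec_eq_iff)
      from v[of i1] have "a = b" by simp
      moreover have "g = h"
      proof
        fix i show "g i = h i"
          using v[of i] that by (cases "i = i1") (auto simp: s t B_def PiE_def extensional_def)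
      qed
      ultimately show "s = t" by (simp add: s t)
    qed simp
    show "F s \<in> {z. start_system u d c0 c z = 0}" if sS: "s \<in> (SIGMA a:X1. B a)" for s
    proof -
      obtain a g where s: "s = (a, g)" and a: "a \<in> X1" and g: "g \<in> B a" using sS by auto
      have "of_real (u $ i) = of_nat (d i) * L a * c $ i * (if i = i1 then a else g i) ^ (d i - 1)" for i
      proof (cases "i = i1")
        case True
        then show ?thesis using a0[OF a] c[of i1] d_pos[of i1] by (simp add: L_def)
      next
        case False
        then have "g i ^ (d i - 1) = of_real (u $ i) / (of_nat (d i) * L a * c $ i)"
          using g by (auto simp: B_def PiE_def Pi_def)
        then show ?thesis using False L0[OF a] c[of i] d_pos[of i] by (simp add: field_simps)
      qed
      moreover have "c0 + c $ i1 * a ^ d i1 = 0" using a c[of i1] by (simp add: X1_def)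
      ultimately show ?thesis
        by (simp add: s F_def start_system_def zero_prod_def vec_eq_iff)
    qed
    show "\<exists>s\<in>(SIGMA a:X1. B a). z = F s" if z: "z \<in> {z. start_system u d c0 c z = 0}" for z
    proof -
      obtain x l where xl: "z = (x, l)" by (cases z)
      have eq: "of_real (u $ i) = of_nat (d i) * l * c $ i * (x $ i) ^ (d i - 1)" for i
        using z by (simp add: start_system_def xl zero_prod_def vec_eq_iff)
      have eq0: "c0 + c $ i1 * (x $ i1) ^ d i1 = 0"
        using z by (simp add: start_system_def xl zero_prod_def)
      have a: "x $ i1 \<in> X1" using eq0 c[of i1] by (simp add: X1_def field_simps eq_neg_iff_add_eq_0)
      have l: "l = L (x $ i1)" using eq[of i1] a0[OF a] c[of i1] d_pos[of i1] by (simp add: L_def field_simps)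
      have "restrict (\<lambda>i. x $ i) (UNIV - {i1}) \<in> B (x $ i1)"
      proof -
        have "(x $ i) ^ (d i - 1) = of_real (u $ i) / (of_nat (d i) * L (x $ i1) * c $ i)" for i
          using eq[of i] l L0[OF a] c[of i] d_pos[of i] by (simp add: field_simps)
        then show ?thesis by (auto simp: B_def)
      qed
      then show ?thesis using a l
        by (intro bexI[of _ "(x $ i1, restrict (\<lambda>i. x $ i) (UNIV - {i1}))"]) (auto simp: F_def xl vec_eq_iff)
    qed
  qed
  then have "card {z. start_system u d c0 c z = 0} = card (SIGMA a:X1. B a)"
    by (metis bij_betw_same_card)
  also have "\<dots> = (\<Sum>a\<in>X1. card (B a))" using \<open>finite X1\<close> finB by (intro card_SigmaI) auto
  also have "\<dots> = d i1 * (\<Prod>i\<in>UNIV - {i1}. d i - 1)" using cB \<open>card X1 = d i1\<close> by simp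
  finally show ?thesis .
qed

end

section \<open>Behaviour at infinity near the start system\<close>

context simplex_support
begin

text \<open>With \<open>\<rho> = weight x\<close>, the coordinate \<open>x $ i\<close> is at most \<open>scale \<rho> i\<close>, that is $\rho^{1/d_i}$, so
  that a monomial of the support is at most \<open>\<rho>\<close> once \<open>\<rho> \<ge> 1\<close>.\<close>

definition weight :: "(complex, 'n) vec \<Rightarrow> real" where
  "weight x = (\<Sum>i\<in>UNIV. norm (x $ i) ^ d i)"

definition scale :: "real \<Rightarrow> 'n \<Rightarrow> real" where
  "scale \<rho> i = \<rho> powr (1 / real (d i))"

lemma scale_pos: "\<rho> > 0 \<Longrightarrow> scale \<rho> i > 0"
  by (simp add: scale_def)

lemma scale_power: "\<rho> > 0 \<Longrightarrow> scale \<rho> i ^ d i = \<rho>"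
  using d_pos[of i] by (simp add: scale_def powr_realpow[symmetric] powr_powr)

lemma coordinate_le_scale:
  assumes "weight x > 0" shows "norm (x $ i) \<le> scale (weight x) i"
proof -
  have "norm (x $ i) ^ d i \<le> weight x"
    unfolding weight_def by (rule member_le_sum) auto
  then have "norm (x $ i) ^ d i \<le> scale (weight x) i ^ d i" by (simp add: scale_power assms)
  then show ?thesis
    using d_pos[of i] scale_pos[OF assms, of i] by (subst (asm) power_mono_iff) auto
qed

lemma norm_mon_le_prod:
  assumes "weight x > 0"
  shows "norm (mon x \<beta>) \<le> (\<Prod>j\<in>UNIV. scale (weight x) j ^ lookup \<beta> j)"
  unfolding mon_def prod_norm[symmetric]
  by (intro prod_mono) (auto simp: norm_power intro!: power_mono coordinate_le_scale assms)

lemma prod_scale_le: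
  assumes "\<rho> \<ge> 1" "\<alpha> \<in> A"
  shows "(\<Prod>j\<in>UNIV. scale \<rho> j ^ lookup \<alpha> j) \<le> \<rho>"
proof -
  have "(\<Prod>j\<in>UNIV. scale \<rho> j ^ lookup \<alpha> j) =
      (\<Prod>j\<in>UNIV. \<rho> powr (real (lookup \<alpha> j) / real (d j)))"
    using assms by (intro prod.cong refl) (simp add: scale_def powr_realpow[symmetric] powr_powr)
  also have "\<dots> = \<rho> powr (\<Sum>j\<in>UNIV. real (lookup \<alpha> j) / real (d j))"
    using assms by (simp add: powr_sum)
  also have "\<dots> \<le> \<rho> powr 1" using assms below by (intro powr_mono) auto
  finally show ?thesis using assms by simp
qed

lemma norm_mon_le:
  assumes "weight x \<ge> 1" "\<alpha> \<in> A" shows "norm (mon x \<alpha>) \<le> weight x"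
  using norm_mon_le_prod[of x \<alpha>] prod_scale_le[of "weight x" \<alpha>] assms by linarith

text \<open>A monomial of the \<open>i\<close>-th partial derivative is at most $\rho^{1 - 1/d_i}$, the size of
  $x_i^{d_i - 1}$.\<close>

lemma norm_mon_deriv_le:
  assumes w: "weight x \<ge> 1" and "\<alpha> \<in> A" and i: "lookup \<alpha> i > 0"
  shows "norm (mon x (\<alpha> - single i 1)) * scale (weight x) i / weight x \<le> 1"
proof -
  let ?s = "scale (weight x)"
  have "(\<Prod>j\<in>UNIV. ?s j ^ lookup (\<alpha> - single i 1) j) * ?s i
      = (\<Prod>j\<in>UNIV. ?s j ^ lookup \<alpha> j)"
  proof -
    have *: "(\<Prod>j\<in>UNIV. ?s j ^ lookup \<beta> j) =
        ?s i ^ lookup \<beta> i * (\<Prod>j\<in>UNIV - {i}. ?s j ^ lookup \<beta> j)" for \<beta>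
      by (subst prod.remove[of _ i]) auto
    have "(\<Prod>j\<in>UNIV - {i}. ?s j ^ lookup (\<alpha> - single i 1) j) =
        (\<Prod>j\<in>UNIV - {i}. ?s j ^ lookup \<alpha> j)"
      by (rule prod.cong) (auto simp: lookup_minus lookup_single)
    moreover have "?s i ^ lookup (\<alpha> - single i 1) i * ?s i = ?s i ^ lookup \<alpha> i"
      using i by (simp add: lookup_minus lookup_single power_minus_mult del: One_nat_def)
    ultimately show ?thesis
      unfolding *[of "\<alpha> - single i 1"] *[of \<alpha>] by (simp add: mult_ac del: One_nat_def)
  qed
  moreover have "norm (mon x (\<alpha> - single i 1)) * ?s i \<le>
      (\<Prod>j\<in>UNIV. ?s j ^ lookup (\<alpha> - single i 1) j) * ?s i"
    using w scale_pos[of "weight x" i] by (intro mult_right_mono norm_mon_le_prod) auto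
  ultimately show ?thesis using prod_scale_le[OF w assms(2)] w by simp
qed

lemma tendsto_0_mult_bounded:
  fixes a b :: "nat \<Rightarrow> 'a::real_normed_field"
  assumes "a \<longlonglongrightarrow> 0" "\<forall>\<^sub>F k in sequentially. norm (b k) \<le> C" shows "(\<lambda>k. a k * b k) \<longlonglongrightarrow> 0"
  using assms(1)
proof (rule tendsto_0_le)
  show "\<forall>\<^sub>F k in sequentially. norm (a k * b k) \<le> norm (a k) * C"
    using assms(2) by (rule eventually_mono) (simp add: norm_mult mult_left_mono)
qed

lemma tendsto_cancel_factor:
  fixes a b :: "nat \<Rightarrow> 'a::real_normed_field"
  assumes "(\<lambda>k. a k * b k) \<longlonglongrightarrow> 0" "a \<longlonglongrightarrow> e" "e \<noteq> 0" shows "b \<longlonglongrightarrow> 0"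
proof (rule Lim_transform_eventually)
  show "(\<lambda>k. a k * b k / a k) \<longlonglongrightarrow> 0" using tendsto_divide[OF assms] by simp
  show "\<forall>\<^sub>F k in sequentially. a k * b k / a k = b k"
    using tendsto_imp_eventually_ne[OF assms(2,3)] by (rule eventually_mono) simp
qed

lemma critical_equations_elimination:
  assumes "critical_system A U p h (x, l) = 0"
  shows "U i * gradient_form A p j x = U j * gradient_form A p i x"
proof -
  have "U i = l * gradient_form A p i x" "U j = l * gradient_form A p j x"
    using assms unfolding critical_system_eq_0_iff by blast+
  then show ?thesis by (simp only: mult_ac)
qed

text \<open>Suppose that \<open>\<rho> = weight x\<close> tends to infinity.  The rescaled coordinates \<open>y k i\<close> lie in $[0,1]$, and
  their \<open>d i\<close>-th powers sum to $1$.  Divide the constraint by \<open>\<rho>\<close>: the only coefficient of a monomial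
  other than \<open>1\<close> that does not tend to $0$ belongs to $x_1^{d_1}$, so \<open>y k i1\<close> tends to $0$.  The same
  division, by \<open>\<rho>\<close> over \<open>scale \<rho> i\<close>, reduces the \<open>i\<close>-th partial derivative to a multiple of
  \<open>y k i ^ (d i - 1)\<close>.  Eliminating the multiplier, the \<open>i\<close>-th partial derivative is a bounded multiple
  of the first one, which is of lower order because \<open>d i1 \<le> d i\<close>.  So all \<open>y k i\<close> tend to $0$, a
  contradiction.\<close>

lemma no_escape_of_points:
  assumes U: "\<And>i. (\<lambda>k. U k i) \<longlonglongrightarrow> u i" and u: "\<And>i. u i \<noteq> 0"
    and p: "\<And>i \<alpha>. \<alpha> \<in> A \<Longrightarrow> lookup \<alpha> i > 0 \<Longrightarrow> (\<lambda>k. p k i \<alpha>) \<longlonglongrightarrow> start_gradient d c i \<alpha>"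
    and h: "\<And>\<alpha>. \<alpha> \<in> A \<Longrightarrow> (\<lambda>k. h k \<alpha>) \<longlonglongrightarrow> start_constraint d c0 c \<alpha>" and c: "\<And>i. c $ i \<noteq> 0"
    and zero: "\<And>k. critical_system A (U k) (p k) (h k) (x k, l k) = 0"
  shows "\<not> filterlim (\<lambda>k::nat. weight (x k)) at_top sequentially"
proof
  assume inf: "filterlim (\<lambda>k::nat. weight (x k)) at_top sequentially"
  define \<rho> where "\<rho> k = weight (x k)" for k
  define s where "s k i = scale (\<rho> k) i" for k i
  define y where "y k i = norm (x k $ i) / s k i" for k i
  define v1 where "v1 = single i1 (d i1)"
  have ev: "\<forall>\<^sub>F k in sequentially. \<rho> k \<ge> 1"
    using inf unfolding \<rho>_def filterlim_at_top by blast
  have inv: "(\<lambda>k. 1 / \<rho> k) \<longlonglongrightarrow> 0"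
    using inf unfolding \<rho>_def by (intro real_tendsto_divide_at_top[OF tendsto_const])
  have v1: "v1 \<in> A" "v1 \<noteq> 0" using vertex_in vertex_neq_0 by (auto simp: v1_def)
  have y_pow: "y k i ^ d i = norm (x k $ i) ^ d i / \<rho> k" if "\<rho> k \<ge> 1" for k i
    using that by (simp add: y_def power_divide s_def scale_power)
  have y_pow': "y k i ^ (d i - 1) = norm (x k $ i) ^ (d i - 1) * (s k i / \<rho> k)" if "\<rho> k \<ge> 1" for k i
  proof -
    have "\<rho> k = s k i ^ (d i - 1) * s k i"
      using that d_pos[of i] scale_power[of "\<rho> k" i] by (simp add: s_def power_minus_mult del: One_nat_def)
    moreover have "s k i > 0" using that scale_pos[of "\<rho> k" i] by (simp add: s_def)
    ultimately have "s k i / \<rho> k = 1 / s k i ^ (d i - 1)" by (metis less_irrefl nonzero_divide_mult_cancel_right)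
    then show ?thesis by (simp add: y_def power_divide)
  qed
  have y_le: "y k i \<le> 1" "y k i \<ge> 0" if "\<rho> k \<ge> 1" for k i
    using that coordinate_le_scale[of "x k" i] scale_pos[of "\<rho> k" i] by (auto simp: y_def s_def \<rho>_def)
  \<comment> \<open>The constraint divided by \<open>\<rho>\<close>: all its monomials but one become negligible.\<close>
  have F1: "(\<lambda>k. y k i1 ^ d i1) \<longlonglongrightarrow> 0"
  proof -
    have terms: "(\<lambda>k. h k \<alpha> * (mon (x k) \<alpha> / of_real (\<rho> k))) \<longlonglongrightarrow> 0" if \<alpha>: "\<alpha> \<in> A" "\<alpha> \<noteq> v1" for \<alpha>
    proof (cases "\<alpha> = 0")
      case True
      have "(\<lambda>k. of_real (1 / \<rho> k) :: complex) \<longlonglongrightarrow> of_real 0" by (intro tendsto_of_real inv)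
      from tendsto_mult[OF h[OF \<alpha>(1)] this] show ?thesis by (simp add: True mon_zero)
    next
      case False
      then have "(\<lambda>k. h k \<alpha>) \<longlonglongrightarrow> 0" using h[OF \<alpha>(1)] \<alpha>(2) by (simp add: start_constraint_def v1_def)
      then show ?thesis
      proof (rule tendsto_0_mult_bounded)
        show "\<forall>\<^sub>F k in sequentially. norm (mon (x k) \<alpha> / of_real (\<rho> k)) \<le> 1"
          using ev by (rule eventually_mono)
            (use norm_mon_le[OF _ \<alpha>(1)] in \<open>auto simp: norm_divide \<rho>_def\<close>)
      qed
    qed
    have "(\<lambda>k. h k v1 * (mon (x k) v1 / of_real (\<rho> k))) \<longlonglongrightarrow> 0"
    proof -
      have "(\<lambda>k. - (\<Sum>\<alpha>\<in>A - {v1}. h k \<alpha> * (mon (x k) \<alpha> / of_real (\<rho> k)))) \<longlonglongrightarrow> - (\<Sum>\<alpha>\<in>A - {v1}. 0)"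
        by (intro tendsto_minus tendsto_sum terms) auto
      moreover have "h k v1 * (mon (x k) v1 / of_real (\<rho> k)) = - (\<Sum>\<alpha>\<in>A - {v1}. h k \<alpha> * (mon (x k) \<alpha> / of_real (\<rho> k)))" for k
      proof -
        have "(\<Sum>\<alpha>\<in>A. h k \<alpha> * mon (x k) \<alpha>) / of_real (\<rho> k) = 0" using zero[of k] unfolding critical_system_eq_0_iff by simp
        then have "(\<Sum>\<alpha>\<in>A. h k \<alpha> * (mon (x k) \<alpha> / of_real (\<rho> k))) = 0" by (simp add: sum_divide_distrib)
        then show ?thesis using finA v1(1) by (simp add: sum.remove eq_neg_iff_add_eq_0)
      qed
      ultimately show ?thesis by simp
    qed
    moreover have "(\<lambda>k. h k v1) \<longlonglongrightarrow> c $ i1" using h[OF v1(1)] v1(2) by (simp add: start_constraint_def v1_def)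
    ultimately have "(\<lambda>k. mon (x k) v1 / of_real (\<rho> k)) \<longlonglongrightarrow> 0" using c by (rule tendsto_cancel_factor)
    then have "(\<lambda>k. norm (mon (x k) v1 / of_real (\<rho> k))) \<longlonglongrightarrow> 0" by (rule tendsto_norm_zero)
    then show ?thesis
      by (rule Lim_transform_eventually)
        (use ev in \<open>rule eventually_mono, simp add: y_pow v1_def mon_single norm_divide norm_power\<close>)
  qed
  define S where "S k i = complex_of_real (s k i / \<rho> k)" for k i
  have F2: "(\<lambda>k. (gradient_form A (p k) i (x k) - of_nat (d i) * c $ i * (x k $ i) ^ (d i - 1)) * S k i) \<longlonglongrightarrow> 0" for i
  proof -
    have "(\<lambda>k. \<Sum>\<alpha>\<in>A. (of_nat (lookup \<alpha> i) * (p k i \<alpha> - start_gradient d c i \<alpha>)) *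
        (mon (x k) (\<alpha> - single i 1) * S k i)) \<longlonglongrightarrow> (\<Sum>\<alpha>\<in>A. 0)"
    proof (rule tendsto_sum)
      fix \<alpha> assume \<alpha>: "\<alpha> \<in> A"
      show "(\<lambda>k. (of_nat (lookup \<alpha> i) * (p k i \<alpha> - start_gradient d c i \<alpha>)) *
        (mon (x k) (\<alpha> - single i 1) * S k i)) \<longlonglongrightarrow> 0"
      proof (cases "lookup \<alpha> i > 0")
        case True
        have "(\<lambda>k. p k i \<alpha> - start_gradient d c i \<alpha>) \<longlonglongrightarrow> 0" using p[OF \<alpha> True] by (simp add: LIM_zero)
        then have "(\<lambda>k. of_nat (lookup \<alpha> i) * (p k i \<alpha> - start_gradient d c i \<alpha>)) \<longlonglongrightarrow> 0"
          by (rule tendsto_mult_right_zero)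
        then show ?thesis
        proof (rule tendsto_0_mult_bounded)
          show "\<forall>\<^sub>F k in sequentially. norm (mon (x k) (\<alpha> - single i 1) * S k i) \<le> 1"
            using ev
          proof (rule eventually_mono)
            fix k assume k: "1 \<le> \<rho> k"
            then show "norm (mon (x k) (\<alpha> - single i 1) * S k i) \<le> 1"
              using norm_mon_deriv_le[of "x k" \<alpha> i] \<alpha> True scale_pos[of "\<rho> k" i]
              by (simp add: S_def norm_mult norm_divide s_def \<rho>_def)
          qed
        qed
      qed simp
    qed
    moreover have "(\<Sum>\<alpha>\<in>A. (of_nat (lookup \<alpha> i) * (p k i \<alpha> - start_gradient d c i \<alpha>)) *
        (mon (x k) (\<alpha> - single i 1) * S k i)) =
      (gradient_form A (p k) i (x k) - of_nat (d i) * c $ i * (x k $ i) ^ (d i - 1)) * S k i" for k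
      unfolding gradient_start[symmetric] sum_subtractf[symmetric] sum_distrib_right
      by (intro sum.cong refl) (simp add: algebra_simps)
    ultimately show ?thesis by simp
  qed
  have norm_S: "norm ((x k $ i) ^ (d i - 1) * S k i) = y k i ^ (d i - 1)" if "\<rho> k \<ge> 1" for k i
    using that scale_pos[of "\<rho> k" i] by (simp add: y_pow' norm_mult norm_power S_def norm_divide s_def del: One_nat_def)
  have ratio: "norm (complex_of_real (s k i / s k i1)) \<le> 1" if "\<rho> k \<ge> 1" for k i
  proof -
    have "s k i \<le> s k i1"
      unfolding s_def scale_def using that d_i1_le[of i] d_pos by (intro powr_mono) (auto simp: field_simps Suc_le_eq)
    then show ?thesis using that scale_pos[of "\<rho> k"] by (simp add: s_def norm_divide less_imp_le)
  qed
  have F3: "(\<lambda>k. gradient_form A (p k) i1 (x k) * S k i) \<longlonglongrightarrow> 0" if i: "i \<noteq> i1" for i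
  proof -
    define r where "r k = complex_of_real (s k i / s k i1)" for k
    have r: "\<forall>\<^sub>F k in sequentially. norm (r k) \<le> 1" using ev by (rule eventually_mono) (simp only: r_def ratio)
    \<comment> \<open>If \<open>d i1 = 1\<close>, the first factor does not tend to \<open>0\<close>, but then \<open>r\<close> does, because \<open>d i \<ge> 2\<close>.\<close>
    have "(\<lambda>k. ((x k $ i1) ^ (d i1 - 1) * S k i1) * r k) \<longlonglongrightarrow> 0"
    proof (cases "d i1 = 1")
      case True
      have "(\<lambda>k. \<rho> k powr (1 / real (d i) - 1)) \<longlonglongrightarrow> 0"
        using inf d2[OF i] unfolding \<rho>_def[symmetric] by (intro tendsto_neg_powr) (auto simp: field_simps)
      then have "(\<lambda>k. complex_of_real (\<rho> k powr (1 / real (d i) - 1))) \<longlonglongrightarrow> of_real 0" by (rule tendsto_of_real)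
      then show ?thesis
      proof (rule Lim_transform_eventually[THEN tendsto_eq_rhs])
        show "\<forall>\<^sub>F k in sequentially. complex_of_real (\<rho> k powr (1 / real (d i) - 1)) = ((x k $ i1) ^ (d i1 - 1) * S k i1) * r k"
          using ev by (rule eventually_mono) (simp add: True S_def r_def s_def scale_def powr_diff)
      qed simp
    next
      case False
      have "(\<lambda>k. y k i1) \<longlonglongrightarrow> 0"
      proof -
        have "(\<lambda>k. root (d i1) (y k i1 ^ d i1)) \<longlonglongrightarrow> root (d i1) 0" by (intro tendsto_real_root F1)
        then show ?thesis
        proof (rule Lim_transform_eventually[THEN tendsto_eq_rhs])
          show "\<forall>\<^sub>F k in sequentially. root (d i1) (y k i1 ^ d i1) = y k i1"
            using ev by (rule eventually_mono) (use d_pos[of i1] y_le in \<open>auto simp: real_root_power_cancel\<close>)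
        qed simp
      qed
      then have "(\<lambda>k. y k i1 ^ (d i1 - 1)) \<longlonglongrightarrow> 0 ^ (d i1 - 1)" by (rule tendsto_power)
      moreover have "(0::real) ^ (d i1 - 1) = 0" using False d_pos[of i1] by simp
      ultimately have "(\<lambda>k. y k i1 ^ (d i1 - 1)) \<longlonglongrightarrow> 0" by (simp only:)
      then have "(\<lambda>k. norm ((x k $ i1) ^ (d i1 - 1) * S k i1)) \<longlonglongrightarrow> 0"
        by (rule Lim_transform_eventually) (use ev in \<open>rule eventually_mono, simp only: norm_S\<close>)
      then have "(\<lambda>k. (x k $ i1) ^ (d i1 - 1) * S k i1) \<longlonglongrightarrow> 0" by (rule tendsto_norm_zero_cancel)
      then show ?thesis using r by (rule tendsto_0_mult_bounded)
    qed
    then have 1: "(\<lambda>k. (of_nat (d i1) * c $ i1) * (((x k $ i1) ^ (d i1 - 1) * S k i1) * r k)) \<longlonglongrightarrow> 0"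
      by (rule tendsto_mult_right_zero)
    have 2: "(\<lambda>k. (gradient_form A (p k) i1 (x k) - of_nat (d i1) * c $ i1 * (x k $ i1) ^ (d i1 - 1)) * S k i1 * r k) \<longlonglongrightarrow> 0"
      by (rule tendsto_0_mult_bounded[OF F2 r])
    from tendsto_add[OF 1 2]
    have 3: "(\<lambda>k. gradient_form A (p k) i1 (x k) * (S k i1 * r k)) \<longlonglongrightarrow> 0" by (simp add: algebra_simps)
    show ?thesis
    proof (rule Lim_transform_eventually[OF 3])
      show "\<forall>\<^sub>F k in sequentially. gradient_form A (p k) i1 (x k) * (S k i1 * r k) = gradient_form A (p k) i1 (x k) * S k i"
        using ev
      proof (rule eventually_mono)
        fix k assume "1 \<le> \<rho> k"
        then have "S k i1 * r k = S k i" using scale_pos[of "\<rho> k" i1] by (simp add: S_def r_def s_def)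
        then show "gradient_form A (p k) i1 (x k) * (S k i1 * r k) = gradient_form A (p k) i1 (x k) * S k i" by simp
      qed
    qed
  qed
  have F5: "(\<lambda>k. y k i ^ d i) \<longlonglongrightarrow> 0" if i: "i \<noteq> i1" for i
  proof -
    have "(\<lambda>k. U k i * (gradient_form A (p k) i1 (x k) * S k i)) \<longlonglongrightarrow> u i * 0" by (intro tendsto_mult U F3 i)
    then have "(\<lambda>k. U k i1 * (gradient_form A (p k) i (x k) * S k i)) \<longlonglongrightarrow> 0"
      using critical_equations_elimination[OF zero] by (simp add: mult.assoc[symmetric])
    then have "(\<lambda>k. gradient_form A (p k) i (x k) * S k i) \<longlonglongrightarrow> 0" using U u by (rule tendsto_cancel_factor)
    from tendsto_diff[OF this F2[of i]]
    have "(\<lambda>k. (of_nat (d i) * c $ i) * ((x k $ i) ^ (d i - 1) * S k i)) \<longlonglongrightarrow> 0" by (simp add: algebra_simps)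
    then have "(\<lambda>k. (x k $ i) ^ (d i - 1) * S k i) \<longlonglongrightarrow> 0"
      by (rule tendsto_cancel_factor[OF _ tendsto_const]) (use c d_pos[of i] in auto)
    then have "(\<lambda>k. norm ((x k $ i) ^ (d i - 1) * S k i)) \<longlonglongrightarrow> 0" by (rule tendsto_norm_zero)
    then show ?thesis
    proof (rule tendsto_0_le[where K = 1])
      show "\<forall>\<^sub>F k in sequentially. norm (y k i ^ d i) \<le> norm (norm ((x k $ i) ^ (d i - 1) * S k i)) * 1"
        using ev
      proof (rule eventually_mono)
        fix k assume k: "1 \<le> \<rho> k"
        have "y k i ^ d i \<le> y k i ^ (d i - 1)" using y_le[OF k] by (intro power_decreasing) auto
        then show "norm (y k i ^ d i) \<le> norm (norm ((x k $ i) ^ (d i - 1) * S k i)) * 1"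
          using y_le[OF k] by (simp only: norm_S[OF k]) (simp add: norm_power)
      qed
    qed
  qed
  have "(\<lambda>k. \<Sum>i\<in>UNIV. y k i ^ d i) \<longlonglongrightarrow> (\<Sum>i\<in>(UNIV::'n set). 0)"
    using F1 F5 by (intro tendsto_sum) metis
  moreover have "(\<lambda>k. \<Sum>i\<in>UNIV. y k i ^ d i) \<longlonglongrightarrow> 1"
  proof (rule Lim_transform_eventually[OF tendsto_const])
    show "\<forall>\<^sub>F k in sequentially. 1 = (\<Sum>i\<in>UNIV. y k i ^ d i)"
      using ev
    proof (rule eventually_mono)
      fix k assume k: "1 \<le> \<rho> k"
      then have "(\<Sum>i\<in>UNIV. y k i ^ d i) = (\<Sum>i\<in>UNIV. norm (x k $ i) ^ d i) / \<rho> k"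
        by (simp add: y_pow sum_divide_distrib)
      then show "1 = (\<Sum>i\<in>UNIV. y k i ^ d i)" using k by (simp add: \<rho>_def weight_def)
    qed
  qed
  ultimately show False using LIMSEQ_unique by fastforce
qed

lemma coordinate_bound:
  assumes "weight x \<le> R" shows "norm (x $ i) \<le> 1 + R"
proof (cases "norm (x $ i) \<le> 1")
  case True
  have "0 \<le> weight x" unfolding weight_def by (intro sum_nonneg) auto
  with True assms show ?thesis by linarith
next
  case False
  then have "norm (x $ i) ^ 1 \<le> norm (x $ i) ^ d i" using d_pos[of i] by (intro power_increasing) auto
  also have "\<dots> \<le> weight x" unfolding weight_def by (rule member_le_sum) auto
  finally show ?thesis using assms by simp
qed

text \<open>Suppose that the points are bounded and the multipliers are not.  Then the first partial derivative,
  which is the cost over the multiplier, tends to $0$, so \<open>(x k $ i1) ^ (d i1 - 1)\<close> does, and so does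
  its product with the bounded \<open>x k $ i1\<close>.  But then the constraint tends to \<open>c0 \<noteq> 0\<close>.\<close>

lemma no_escape_of_multipliers:
  assumes U: "\<And>i. (\<lambda>k. U k i) \<longlonglongrightarrow> u i"
    and p: "\<And>i \<alpha>. \<alpha> \<in> A \<Longrightarrow> lookup \<alpha> i > 0 \<Longrightarrow> (\<lambda>k. p k i \<alpha>) \<longlonglongrightarrow> start_gradient d c i \<alpha>"
    and h: "\<And>\<alpha>. \<alpha> \<in> A \<Longrightarrow> (\<lambda>k. h k \<alpha>) \<longlonglongrightarrow> start_constraint d c0 c \<alpha>"
    and c: "\<And>i. c $ i \<noteq> 0" and c0: "c0 \<noteq> 0"
    and zero: "\<And>k. critical_system A (U k) (p k) (h k) (x k, l k) = 0" and bdd: "\<And>k. weight (x k) \<le> R"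
  shows "\<not> filterlim (\<lambda>k::nat. norm (l k)) at_top sequentially"
proof
  assume inf: "filterlim (\<lambda>k::nat. norm (l k)) at_top sequentially"
  have mon_bdd: "norm (mon (x k) \<beta>) \<le> (\<Prod>j\<in>UNIV. (1 + R) ^ lookup \<beta> j)" for k \<beta>
    unfolding mon_def prod_norm[symmetric]
    by (intro prod_mono) (auto simp: norm_power intro!: power_mono coordinate_bound bdd)
  have small: "(\<lambda>k. a k * mon (x k) \<beta>) \<longlonglongrightarrow> 0" if "a \<longlonglongrightarrow> 0" for a \<beta>
    using that by (rule tendsto_0_mult_bounded) (rule always_eventually, blast intro: mon_bdd)
  have "(\<lambda>k. \<Sum>\<alpha>\<in>A. (of_nat (lookup \<alpha> i1) * (p k i1 \<alpha> - start_gradient d c i1 \<alpha>)) *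
      mon (x k) (\<alpha> - single i1 1)) \<longlonglongrightarrow> (\<Sum>\<alpha>\<in>A. 0)"
  proof (intro tendsto_sum small)
    fix \<alpha> assume \<alpha>: "\<alpha> \<in> A"
    show "(\<lambda>k. of_nat (lookup \<alpha> i1) * (p k i1 \<alpha> - start_gradient d c i1 \<alpha>)) \<longlonglongrightarrow> 0"
    proof (cases "lookup \<alpha> i1 > 0")
      case True
      then show ?thesis using p[OF \<alpha> True] by (intro tendsto_mult_right_zero) (simp add: LIM_zero)
    qed simp
  qed
  moreover have "(\<Sum>\<alpha>\<in>A. (of_nat (lookup \<alpha> i1) * (p k i1 \<alpha> - start_gradient d c i1 \<alpha>)) *
      mon (x k) (\<alpha> - single i1 1)) =
    gradient_form A (p k) i1 (x k) - of_nat (d i1) * c $ i1 * (x k $ i1) ^ (d i1 - 1)" for k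
    unfolding gradient_start[symmetric] sum_subtractf[symmetric]
    by (intro sum.cong refl) (simp add: algebra_simps)
  ultimately have 1: "(\<lambda>k. gradient_form A (p k) i1 (x k) - of_nat (d i1) * c $ i1 * (x k $ i1) ^ (d i1 - 1)) \<longlonglongrightarrow> 0"
    by simp
  have "filterlim l at_infinity sequentially" using inf by (simp add: filterlim_at_infinity_conv_norm_at_top)
  then have "(\<lambda>k. U k i1 / l k) \<longlonglongrightarrow> 0" by (rule tendsto_divide_0[OF U])
  then have "(\<lambda>k. gradient_form A (p k) i1 (x k)) \<longlonglongrightarrow> 0"
  proof (rule Lim_transform_eventually)
    have "\<forall>\<^sub>F k in sequentially. norm (l k) \<ge> 1" using inf unfolding filterlim_at_top by blast
    then show "\<forall>\<^sub>F k in sequentially. U k i1 / l k = gradient_form A (p k) i1 (x k)"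
    proof (rule eventually_mono)
      fix k assume "1 \<le> norm (l k)"
      then have "l k \<noteq> 0" by auto
      moreover have "U k i1 = l k * gradient_form A (p k) i1 (x k)" using zero[of k] unfolding critical_system_eq_0_iff by blast
      ultimately show "U k i1 / l k = gradient_form A (p k) i1 (x k)" by simp
    qed
  qed
  from tendsto_diff[OF this 1]
  have "(\<lambda>k. (of_nat (d i1) * c $ i1) * (x k $ i1) ^ (d i1 - 1)) \<longlonglongrightarrow> 0" by simp
  then have "(\<lambda>k. (x k $ i1) ^ (d i1 - 1)) \<longlonglongrightarrow> 0"
    by (rule tendsto_cancel_factor[OF _ tendsto_const]) (use c d_pos[of i1] in auto)
  then have "(\<lambda>k. (x k $ i1) ^ (d i1 - 1) * x k $ i1) \<longlonglongrightarrow> 0"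
    by (rule tendsto_0_mult_bounded) (rule always_eventually, blast intro: coordinate_bound bdd)
  then have x_lim: "(\<lambda>k. (x k $ i1) ^ d i1) \<longlonglongrightarrow> 0"
    using d_pos[of i1] by (simp add: power_minus_mult del: One_nat_def)
  have "(\<lambda>k. \<Sum>\<alpha>\<in>A. (h k \<alpha> - start_constraint d c0 c \<alpha>) * mon (x k) \<alpha>) \<longlonglongrightarrow> (\<Sum>\<alpha>\<in>A. 0)"
    by (intro tendsto_sum small) (simp add: LIM_zero h)
  moreover have "(\<Sum>\<alpha>\<in>A. (h k \<alpha> - start_constraint d c0 c \<alpha>) * mon (x k) \<alpha>) = - (c0 + c $ i1 * (x k $ i1) ^ d i1)" for k
    using zero[of k] unfolding critical_system_eq_0_iff
    by (simp add: constraint_start[symmetric] left_diff_distrib sum_subtractf)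
  moreover have "(\<lambda>k. - (c0 + c $ i1 * (x k $ i1) ^ d i1)) \<longlonglongrightarrow> - (c0 + c $ i1 * 0)"
    by (intro tendsto_intros x_lim)
  ultimately show False using c0 LIMSEQ_unique by fastforce
qed

lemma sequence_escape:
  assumes "\<nexists>e R. e > 0 \<and> (\<forall>t\<in>ball t0 e. \<forall>z. Q t z \<longrightarrow> (g z :: real) \<le> R)"
  shows "\<exists>t z. t \<longlonglongrightarrow> (t0 :: 'a::metric_space) \<and> (\<forall>k. Q (t k) (z k)) \<and> filterlim (\<lambda>k::nat. g (z k)) at_top sequentially"
proof -
  have "\<exists>tz. dist (fst tz) t0 < inverse (real (Suc k)) \<and> Q (fst tz) (snd tz) \<and> real k < g (snd tz)" for k
  proof -
    have "\<not> (\<forall>t\<in>ball t0 (inverse (real (Suc k))). \<forall>z. Q t z \<longrightarrow> g z \<le> real k)"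
    proof
      assume *: "\<forall>t\<in>ball t0 (inverse (real (Suc k))). \<forall>z. Q t z \<longrightarrow> g z \<le> real k"
      have "inverse (real (Suc k)) > 0" by simp
      with * assms show False by blast
    qed
    then obtain t z where "t \<in> ball t0 (inverse (real (Suc k)))" "Q t z" "\<not> g z \<le> real k" by blast
    then show ?thesis by (intro exI[of _ "(t, z)"]) (auto simp: dist_commute not_le)
  qed
  then obtain tz where tz: "\<And>k. dist (fst (tz k)) t0 < inverse (real (Suc k))"
    "\<And>k. Q (fst (tz k)) (snd (tz k))" "\<And>k. real k < g (snd (tz k))"
    using choice[of "\<lambda>k tz. dist (fst tz) t0 < inverse (real (Suc k)) \<and> Q (fst tz) (snd tz) \<and> real k < g (snd tz)"]
    by blast
  define t z where "t k = fst (tz k)" and "z k = snd (tz k)" for k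
  have tz: "\<And>k. dist (t k) t0 < inverse (real (Suc k))" "\<And>k. Q (t k) (z k)" "\<And>k. real k < g (z k)"
    using tz by (simp_all add: t_def z_def)
  have "(\<lambda>k. dist (t k) t0) \<longlonglongrightarrow> 0"
    by (rule tendsto_sandwich[OF _ _ tendsto_const LIMSEQ_inverse_real_of_nat])
      (simp_all add: less_imp_le[OF tz(1)] del: of_nat_Suc)
  then have "t \<longlonglongrightarrow> t0" by (rule tendsto_dist_iff[THEN iffD2])
  moreover have "filterlim (\<lambda>k. g (z k)) at_top sequentially"
    by (rule filterlim_at_top_mono[OF filterlim_real_sequentially])
      (auto intro!: always_eventually less_imp_le tz(3))
  ultimately show ?thesis using tz(2) by blast
qed

text \<open>The gradient coefficients at \<open>t0\<close> are prescribed only where \<open>\<alpha>\<close> involves \<open>i\<close>, since the others are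
  multiplied by \<open>0\<close>.\<close>

theorem zeros_bounded_near_start:
  fixes U :: "'a::metric_space \<Rightarrow> 'n \<Rightarrow> complex"
  assumes U: "\<And>i. isCont (\<lambda>t. U t i) t0" and u: "\<And>i. U t0 i \<noteq> 0"
    and p: "\<And>i \<alpha>. \<alpha> \<in> A \<Longrightarrow> isCont (\<lambda>t. p t i \<alpha>) t0"
      "\<And>i \<alpha>. \<alpha> \<in> A \<Longrightarrow> lookup \<alpha> i > 0 \<Longrightarrow> p t0 i \<alpha> = start_gradient d c i \<alpha>"
    and h: "\<And>\<alpha>. \<alpha> \<in> A \<Longrightarrow> isCont (\<lambda>t. h t \<alpha>) t0" "\<And>\<alpha>. \<alpha> \<in> A \<Longrightarrow> h t0 \<alpha> = start_constraint d c0 c \<alpha>"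
    and c: "\<And>i. c $ i \<noteq> 0" and c0: "c0 \<noteq> 0"
  shows "\<exists>e>0. \<exists>R. \<forall>t\<in>ball t0 e. \<forall>z. critical_system A (U t) (p t) (h t) z = 0 \<longrightarrow> norm z \<le> R"
proof -
  define Q where "Q t z \<longleftrightarrow> critical_system A (U t) (p t) (h t) z = 0" for t z
  have lims: "(\<lambda>k. U (t k) i) \<longlonglongrightarrow> U t0 i"
    "\<alpha> \<in> A \<Longrightarrow> lookup \<alpha> i > 0 \<Longrightarrow> (\<lambda>k. p (t k) i \<alpha>) \<longlonglongrightarrow> start_gradient d c i \<alpha>"
    "\<alpha> \<in> A \<Longrightarrow> (\<lambda>k. h (t k) \<alpha>) \<longlonglongrightarrow> start_constraint d c0 c \<alpha>" if "t \<longlonglongrightarrow> t0" for t :: "nat \<Rightarrow> 'a" and i \<alpha>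
    using isCont_tendsto_compose[OF U[of i] that] isCont_tendsto_compose[OF p(1)[of \<alpha> i] that]
      isCont_tendsto_compose[OF h(1)[of \<alpha>] that] by (simp_all add: p(2) h(2))
  have "\<exists>e R. e > 0 \<and> (\<forall>t\<in>ball t0 e. \<forall>z. Q t z \<longrightarrow> weight (fst z) \<le> R)"
  proof (rule ccontr)
    assume "\<nexists>e R. e > 0 \<and> (\<forall>t\<in>ball t0 e. \<forall>z. Q t z \<longrightarrow> weight (fst z) \<le> R)"
    from sequence_escape[OF this] obtain t z where tz: "t \<longlonglongrightarrow> t0" "\<forall>k. Q (t k) (z k)"
      "filterlim (\<lambda>k. weight (fst (z k))) at_top sequentially" by blast
    moreover have "critical_system A (U (t k)) (p (t k)) (h (t k)) (fst (z k), snd (z k)) = 0" for k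
      using tz(2) by (simp add: Q_def)
    ultimately show False
      using no_escape_of_points[of "\<lambda>k. U (t k)" "U t0" "\<lambda>k. p (t k)" c "\<lambda>k. h (t k)" c0 "\<lambda>k. fst (z k)" "\<lambda>k. snd (z k)"]
        lims[OF tz(1)] u c by blast
  qed
  then obtain e1 R1 where e1: "e1 > 0" "\<And>t z. t \<in> ball t0 e1 \<Longrightarrow> Q t z \<Longrightarrow> weight (fst z) \<le> R1" by blast
  define Q' where "Q' t z \<longleftrightarrow> Q t z \<and> weight (fst z) \<le> R1" for t z
  have "\<exists>e R. e > 0 \<and> (\<forall>t\<in>ball t0 e. \<forall>z. Q' t z \<longrightarrow> norm (snd z) \<le> R)"
  proof (rule ccontr)
    assume "\<nexists>e R. e > 0 \<and> (\<forall>t\<in>ball t0 e. \<forall>z. Q' t z \<longrightarrow> norm (snd z) \<le> R)"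
    from sequence_escape[OF this] obtain t z where tz: "t \<longlonglongrightarrow> t0" "\<forall>k. Q' (t k) (z k)"
      "filterlim (\<lambda>k. norm (snd (z k))) at_top sequentially" by blast
    moreover have "critical_system A (U (t k)) (p (t k)) (h (t k)) (fst (z k), snd (z k)) = 0" "weight (fst (z k)) \<le> R1" for k
      using tz(2) by (simp_all add: Q'_def Q_def)
    ultimately show False
      using no_escape_of_multipliers[of "\<lambda>k. U (t k)" "U t0" "\<lambda>k. p (t k)" c "\<lambda>k. h (t k)" c0 "\<lambda>k. fst (z k)" "\<lambda>k. snd (z k)" R1]
        lims[OF tz(1)] c0 c by blast
  qed
  then obtain e2 R2 where e2: "e2 > 0" "\<And>t z. t \<in> ball t0 e2 \<Longrightarrow> Q' t z \<Longrightarrow> norm (snd z) \<le> R2" by blast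
  have "norm z \<le> real CARD('n) * (1 + R1) + R2" if t: "t \<in> ball t0 (min e1 e2)" and z: "Q t z" for t z
  proof -
    have w: "weight (fst z) \<le> R1" using e1(2)[of t z] t z by auto
    have "norm (fst z) \<le> (\<Sum>i\<in>UNIV. norm (fst z $ i))" 
      unfolding norm_vec_def by (rule L2_set_le_sum) auto
    also have "\<dots> \<le> (\<Sum>i\<in>(UNIV::'n set). 1 + R1)" by (intro sum_mono coordinate_bound w)
    finally have "norm (fst z) \<le> real CARD('n) * (1 + R1)" by simp
    moreover have "norm (snd z) \<le> R2" using e2(2)[of t z] t z w by (auto simp: Q'_def)
    moreover have "norm z \<le> norm (fst z) + norm (snd z)" 
      unfolding norm_prod_def by (rule sqrt_sum_squares_le_sum) auto
    ultimately show ?thesis by linarith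
  qed
  then show ?thesis
    using e1(1) e2(1) unfolding Q_def[symmetric]
    by (intro exI[of _ "min e1 e2"] conjI exI[of _ "real CARD('n) * (1 + R1) + R2"]) auto
qed

end

section \<open>Generic parameters\<close>

text \<open>The unknowns of a system, indexed by \<open>None\<close> for the multiplier and \<open>Some j\<close> for \<open>x $ j\<close>.\<close>

definition coords :: "(complex, 'n::finite) vec \<times> complex \<Rightarrow> 'n option \<Rightarrow> complex" where
  "coords z k = (case k of None \<Rightarrow> snd z | Some j \<Rightarrow> fst z $ j)"

lemma coords_line: "coords (z + r *\<^sub>R v) k = coords z k + of_real r * coords v k"
  by (simp add: coords_def scaleR_conv_of_real[where 'a = complex] split: option.splits)

lemma coords_eq_0_imp: "(\<And>k. coords v k = 0) \<Longrightarrow> v = 0"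
proof -
  assume *: "\<And>k. coords v k = 0"
  have "fst v $ j = 0" for j using *[of "Some j"] by (simp add: coords_def)
  moreover have "snd v = 0" using *[of None] by (simp add: coords_def)
  ultimately show "v = 0" by (simp add: prod_eq_iff vec_eq_iff)
qed

lemma norm_le_sum_coords:
  fixes z :: "(complex, 'n::finite) vec \<times> complex"
  shows "norm z \<le> (\<Sum>k\<in>UNIV. norm (coords z k))"
proof -
  have "norm z \<le> norm (fst z) + norm (snd z)"
    unfolding norm_prod_def by (rule sqrt_sum_squares_le_sum) auto
  also have "norm (fst z) \<le> (\<Sum>j\<in>UNIV. norm (fst z $ j))"
    unfolding norm_vec_def by (rule L2_set_le_sum) auto
  also have "(\<Sum>j\<in>UNIV. norm (fst z $ j)) + norm (snd z) = (\<Sum>k\<in>insert None (range Some). norm (coords z k))"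
    by (subst sum.insert) (auto simp: coords_def sum.reindex)
  finally show ?thesis by (simp add: UNIV_option_conv)
qed

lemma eventually_roots_bounded:
  fixes a :: "'t::topological_space \<Rightarrow> nat \<Rightarrow> complex"
  assumes "\<And>r. r \<le> R \<Longrightarrow> ((\<lambda>t. a t r) \<longlongrightarrow> a t0 r) (nhds t0)" "a t0 R \<noteq> 0"
  shows "\<exists>M. \<forall>\<^sub>F t in nhds t0. \<forall>\<zeta>. (\<Sum>r\<le>R. a t r * \<zeta> ^ r) = 0 \<longrightarrow> norm \<zeta> \<le> M"
proof -
  define b where "b t = 1 + (\<Sum>r<R. norm (a t r)) / norm (a t R)" for t
  have "(b \<longlongrightarrow> b t0) (nhds t0)"
    unfolding b_def using assms by (intro tendsto_intros) auto
  then have "\<forall>\<^sub>F t in nhds t0. b t < b t0 + 1" by (rule order_tendstoD) simp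
  moreover have "\<forall>\<^sub>F t in nhds t0. a t R \<noteq> 0"
    using assms by (intro tendsto_imp_eventually_ne[where c = "a t0 R"]) auto
  ultimately have "\<forall>\<^sub>F t in nhds t0. \<forall>\<zeta>. (\<Sum>r\<le>R. a t r * \<zeta> ^ r) = 0 \<longrightarrow> norm \<zeta> \<le> b t0 + 1"
  proof eventually_elim
    case (elim t)
    show ?case
    proof (intro allI impI)
      fix \<zeta> assume "(\<Sum>r\<le>R. a t r * \<zeta> ^ r) = 0"
      from root_bound[OF this elim(2)] elim(1) show "norm \<zeta> \<le> b t0 + 1" by (simp add: b_def)
    qed
  qed
  then show ?thesis by blast
qed

text \<open>Where \<open>D\<close> does not vanish, the zeros of \<open>F\<close> have the two properties that \<open>local_sheets\<close> asks for.
  The bounds are stated along curves of parameters, which are what the zeros are followed along.\<close>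

definition discriminant ::
    "'v set \<Rightarrow> (('v \<Rightarrow> complex) \<Rightarrow> 'n::finite system) \<Rightarrow> (('v \<Rightarrow> complex) \<Rightarrow> complex) \<Rightarrow> bool" where
  "discriminant V F D \<longleftrightarrow> poly_fun V D \<and> (\<exists>\<theta>. D \<theta> \<noteq> 0) \<and>
    (\<forall>\<theta> z. D \<theta> \<noteq> 0 \<longrightarrow> F \<theta> z = 0 \<longrightarrow> nondegenerate (F \<theta>) z) \<and>
    (\<forall>(\<theta> :: complex \<Rightarrow> 'v \<Rightarrow> complex) t0. D (\<theta> t0) \<noteq> 0 \<longrightarrow> (\<forall>v\<in>V. isCont (\<lambda>t. \<theta> t v) t0) \<longrightarrow>
       (\<exists>e>0. \<exists>M. \<forall>t\<in>ball t0 e. \<forall>z. F (\<theta> t) z = 0 \<longrightarrow> norm z \<le> M))"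

lemma discriminantD:
  assumes "discriminant V F D"
  shows "poly_fun V D" "\<exists>\<theta>. D \<theta> \<noteq> 0"
    "\<And>\<theta> z. D \<theta> \<noteq> 0 \<Longrightarrow> F \<theta> z = 0 \<Longrightarrow> nondegenerate (F \<theta>) z"
    "\<And>(\<theta> :: complex \<Rightarrow> _) t0. D (\<theta> t0) \<noteq> 0 \<Longrightarrow> \<forall>v\<in>V. isCont (\<lambda>t. \<theta> t v) t0 \<Longrightarrow>
       \<exists>e>0. \<exists>M. \<forall>t\<in>ball t0 e. \<forall>z. F (\<theta> t) z = 0 \<longrightarrow> norm z \<le> M"
  using assms unfolding discriminant_def by blast+

text \<open>The functional \<open>\<phi> w\<close> selects the equation of the system that is solved for \<open>\<theta> w\<close>.\<close>

theorem generic_system: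
  fixes F :: "('v \<Rightarrow> complex) \<Rightarrow> 'n::finite system" and \<Psi> :: "'v \<Rightarrow> ('v + 'n option \<Rightarrow> complex) \<Rightarrow> complex"
  assumes V: "finite V" and W: "W \<subseteq> V" and card: "card W = CARD('n option)"
    and poly: "\<And>w. w \<in> W \<Longrightarrow> poly_fun (Inl ` (V - W) \<union> range Inr) (\<Psi> w)"
    and \<phi>: "\<And>w. w \<in> W \<Longrightarrow> bounded_linear (\<phi> w)"
    and \<Psi>: "\<And>w \<theta> z. w \<in> W \<Longrightarrow> \<Psi> w (case_sum \<theta> (coords z)) = \<theta> w - \<phi> w (F \<theta> z)"
  shows "\<exists>D. discriminant V F D"
proof -
  have poly': "\<forall>w\<in>W. poly_fun (Inl ` (V - W) \<union> range Inr) (\<Psi> w)" using poly by blast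
  obtain D R q where all: "poly_fun V D \<and> (\<exists>\<theta>. D \<theta> \<noteq> 0) \<and>
    (\<forall>k\<in>UNIV. (\<forall>r. poly_fun V (q k r)) \<and> (\<forall>\<theta>. D \<theta> \<noteq> 0 \<longrightarrow> q k (R k) \<theta> \<noteq> 0)) \<and>
    (\<forall>\<theta> z. (\<forall>w\<in>W. \<theta> w = \<Psi> w (case_sum \<theta> z)) \<longrightarrow>
       (\<forall>k\<in>UNIV. (\<Sum>r\<le>R k. q k r \<theta> * z k ^ r) = 0) \<and>
       (\<forall>v. D \<theta> \<noteq> 0 \<longrightarrow> (\<forall>w\<in>W. ((\<lambda>t::real. \<Psi> w (case_sum \<theta> (\<lambda>k. z k + of_real t * v k)))
            has_vector_derivative 0) (at 0)) \<longrightarrow> (\<forall>k\<in>UNIV. v k = 0)))"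
    using generic_fibres[OF V W finite card poly'] by (elim exE) (rule that)
  note D = all[THEN conjunct1] all[THEN conjunct2, THEN conjunct1]
  note q' = all[THEN conjunct2, THEN conjunct2, THEN conjunct1]
  note fib' = all[THEN conjunct2, THEN conjunct2, THEN conjunct2]
  have q: "\<And>k r. poly_fun V (q k r)" "\<And>k \<theta>. D \<theta> \<noteq> 0 \<Longrightarrow> q k (R k) \<theta> \<noteq> 0"
    using q' by auto
  note fib = fib'[THEN spec, THEN spec, THEN mp]
  have sol: "\<forall>w\<in>W. \<theta> w = \<Psi> w (case_sum \<theta> (coords z))" if "F \<theta> z = 0" for \<theta> z
    using that \<Psi> \<phi> by (simp add: bounded_linear.linear linear_0)
  have nondeg: "nondegenerate (F \<theta>) z" if D\<theta>: "D \<theta> \<noteq> 0" and z: "F \<theta> z = 0" for \<theta> z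
    unfolding nondegenerate_def
  proof (intro allI impI)
    fix v assume v: "((\<lambda>r::real. F \<theta> (z + r *\<^sub>R v)) has_vector_derivative 0) (at 0)"
    have "((\<lambda>t::real. \<Psi> w (case_sum \<theta> (\<lambda>k. coords z k + of_real t * coords v k))) has_vector_derivative 0) (at 0)"
      if w: "w \<in> W" for w
    proof -
      have "((\<lambda>r::real. \<theta> w - \<phi> w (F \<theta> (z + r *\<^sub>R v))) has_vector_derivative (0 - \<phi> w 0)) (at 0)"
        by (intro has_vector_derivative_diff has_vector_derivative_const
            bounded_linear.has_vector_derivative[OF \<phi>[OF w]] v)
      moreover have "\<theta> w - \<phi> w (F \<theta> (z + r *\<^sub>R v)) =
          \<Psi> w (case_sum \<theta> (\<lambda>k. coords z k + of_real r * coords v k))" for r :: real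
        using \<Psi>[OF w, of \<theta> "z + r *\<^sub>R v"] by (simp add: coords_line[abs_def])
      moreover have "\<phi> w 0 = 0" using \<phi>[OF w] by (simp add: bounded_linear.linear linear_0)
      ultimately show ?thesis by simp
    qed
    then have "\<forall>k\<in>UNIV. coords v k = 0" using fib[OF sol[OF z]] D\<theta> by blast
    then show "v = 0" by (intro coords_eq_0_imp) auto
  qed
  have bdd: "\<exists>e>0. \<exists>M. \<forall>t\<in>ball t0 e. \<forall>z. F (\<theta> t) z = 0 \<longrightarrow> norm z \<le> M"
    if D\<theta>: "D (\<theta> t0) \<noteq> 0" and cont: "\<forall>v\<in>V. isCont (\<lambda>t. \<theta> t v) t0" for \<theta> :: "complex \<Rightarrow> 'v \<Rightarrow> complex" and t0
  proof -
    have "\<exists>M. \<forall>\<^sub>F t in nhds t0. \<forall>\<zeta>. (\<Sum>r\<le>R k. q k r (\<theta> t) * \<zeta> ^ r) = 0 \<longrightarrow> norm \<zeta> \<le> M" for k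
    proof (rule eventually_roots_bounded)
      show "q k (R k) (\<theta> t0) \<noteq> 0" by (rule q(2)[OF D\<theta>])
      show "((\<lambda>t. q k r (\<theta> t)) \<longlongrightarrow> q k r (\<theta> t0)) (nhds t0)" for r
      proof (rule poly_fun_tendsto[OF q(1)])
        fix v assume "v \<in> V"
        then have "isCont (\<lambda>t. \<theta> t v) t0" using cont by blast
        then show "((\<lambda>t. \<theta> t v) \<longlongrightarrow> \<theta> t0 v) (nhds t0)"
          using tendsto_at_iff_tendsto_nhds[of "\<lambda>t. \<theta> t v" t0] by (simp add: isCont_def)
      qed
    qed
    then have "\<exists>M. \<forall>k. \<forall>\<^sub>F t in nhds t0. \<forall>\<zeta>. (\<Sum>r\<le>R k. q k r (\<theta> t) * \<zeta> ^ r) = 0 \<longrightarrow> norm \<zeta> \<le> M k"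
      by (intro choice) blast
    then obtain M where M: "\<And>k. \<forall>\<^sub>F t in nhds t0. \<forall>\<zeta>. (\<Sum>r\<le>R k. q k r (\<theta> t) * \<zeta> ^ r) = 0 \<longrightarrow> norm \<zeta> \<le> M k"
      by blast
    have "\<forall>\<^sub>F t in nhds t0. \<forall>k\<in>UNIV. \<forall>\<zeta>. (\<Sum>r\<le>R k. q k r (\<theta> t) * \<zeta> ^ r) = 0 \<longrightarrow> norm \<zeta> \<le> M k"
      by (rule eventually_ball_finite) (use M in auto)
    then obtain e where e: "e > 0" "\<And>t k \<zeta>. dist t t0 < e \<Longrightarrow> (\<Sum>r\<le>R k. q k r (\<theta> t) * \<zeta> ^ r) = 0 \<Longrightarrow> norm \<zeta> \<le> M k"
      unfolding eventually_nhds_metric by blast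
    have "norm z \<le> (\<Sum>k\<in>UNIV. M k)" if t: "t \<in> ball t0 e" and z: "F (\<theta> t) z = 0" for t z
    proof -
      have "norm (coords z k) \<le> M k" for k
        using fib[OF sol[OF z]] e(2)[of t k] t by (simp add: dist_commute)
      then have "(\<Sum>k\<in>UNIV. norm (coords z k)) \<le> (\<Sum>k\<in>UNIV. M k)" by (intro sum_mono)
      with norm_le_sum_coords[of z] show ?thesis by linarith
    qed
    then show ?thesis using e(1) by blast
  qed
  show ?thesis using D nondeg bdd unfolding discriminant_def by blast
qed

lemma nondegenerate_linear_image:
  assumes "nondegenerate F z" "bounded_linear T" "\<And>y. F y = T (G y)"
  shows "nondegenerate G z"
  unfolding nondegenerate_def
proof (intro allI impI)
  fix v assume "((\<lambda>r::real. G (z + r *\<^sub>R v)) has_vector_derivative 0) (at 0)"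
  then have "((\<lambda>r::real. F (z + r *\<^sub>R v)) has_vector_derivative T 0) (at 0)"
    unfolding assms(3) by (rule bounded_linear.has_vector_derivative[OF assms(2)])
  then show "v = 0"
    using assms(1,2) unfolding nondegenerate_def by (simp add: bounded_linear.linear linear_0)
qed

lemma critical_system_cong:
  assumes "\<And>i. U i = U' i" "\<And>i \<alpha>. \<alpha> \<in> A \<Longrightarrow> lookup \<alpha> i > 0 \<Longrightarrow> p i \<alpha> = p' i \<alpha>"
    "\<And>\<alpha>. \<alpha> \<in> A \<Longrightarrow> h \<alpha> = h' \<alpha>"
  shows "critical_system A U p h = critical_system A U' p' h'"
proof -
  have 1: "of_nat (lookup \<alpha> i) * p i \<alpha> = of_nat (lookup \<alpha> i) * p' i \<alpha>"
    if "\<alpha> \<in> A" for i \<alpha>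
    using assms(2)[OF that] by (cases "lookup \<alpha> i > 0") auto
  have 2: "gradient_form A p i x =
      gradient_form A p' i x" for i x
    by (intro sum.cong refl arg_cong2[where f = "(*)"] 1)
  have 3: "(\<Sum>\<alpha>\<in>A. h \<alpha> * mon x \<alpha>) = (\<Sum>\<alpha>\<in>A. h' \<alpha> * mon x \<alpha>)" for x
    by (intro sum.cong refl arg_cong2[where f = "(*)"] assms(3))
  show ?thesis unfolding critical_system_def 2 3 assms(1) ..
qed

definition param_system :: "('n::finite \<Rightarrow>\<^sub>0 nat) set \<Rightarrow> ('n param \<Rightarrow> complex) \<Rightarrow> 'n system" where
  "param_system A \<theta> = critical_system A (\<lambda>i. \<theta> (Cost i)) (\<lambda>_ \<alpha>. \<theta> (Coeff \<alpha>)) (\<lambda>\<alpha>. \<theta> (Coeff \<alpha>))"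

lemma lagrange_system_eq_param_system:
  "lagrange_system u f = param_system (keys f) (problem_point u f)"
  unfolding lagrange_system_eq_critical_system param_system_def
  by (rule critical_system_cong) (auto simp: problem_point_def problem_params_def)

lemma finite_params:
  fixes A :: "('n::finite \<Rightarrow>\<^sub>0 nat) set"
  assumes "finite A" shows "finite (problem_params A)" "finite (homotopy_params A)"
  using assms by (auto simp: problem_params_def homotopy_params_def)

lemma card_range_Cost: "card (insert w (range f)) = CARD('n option)"
  if "inj (f :: 'n::finite \<Rightarrow> 'b)" "w \<notin> range f"
  using that by (simp add: card_image)

text \<open>The parameters solved for are the costs and the constant coefficient of \<open>f\<close>.\<close>

lemma generic_lagrange:
  fixes A :: "('n::finite \<Rightarrow>\<^sub>0 nat) set"
  assumes A: "finite A" "0 \<in> A"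
  shows "\<exists>D. discriminant (problem_params A) (param_system A) D"
proof -
  define W :: "'n param set" where "W = insert (Coeff 0) (range Cost)"
  define m :: "('n \<Rightarrow>\<^sub>0 nat) \<Rightarrow> ('n param + 'n option \<Rightarrow> complex) \<Rightarrow> complex"
    where "m \<beta> \<xi> = (\<Prod>j\<in>UNIV. \<xi> (Inr (Some j)) ^ lookup \<beta> j)" for \<beta> \<xi>
  define \<Psi> where "\<Psi> w \<xi> = (case w of Cost i \<Rightarrow> \<xi> (Inr None) * (\<Sum>\<alpha>\<in>A - {0}. of_nat (lookup \<alpha> i) *
        \<xi> (Inl (Coeff \<alpha>)) * m (\<alpha> - single i 1) \<xi>)
     | _ \<Rightarrow> - (\<Sum>\<alpha>\<in>A - {0}. \<xi> (Inl (Coeff \<alpha>)) * m \<alpha> \<xi>))" for w and \<xi> :: "'n param + 'n option \<Rightarrow> complex"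
  define \<phi> :: "'n param \<Rightarrow> (complex, 'n) vec \<times> complex \<Rightarrow> complex"
    where "\<phi> w = (case w of Cost i \<Rightarrow> (\<lambda>q. fst q $ i) | _ \<Rightarrow> snd)" for w
  have m: "m \<beta> (case_sum \<theta> (coords z)) = mon (fst z) \<beta>" for \<beta> \<theta> z
    by (simp add: m_def mon_def coords_def)
  show ?thesis
  proof (rule generic_system[where W = W and \<Psi> = \<Psi> and \<phi> = \<phi>])
    show "finite (problem_params A)" using A by (simp add: finite_params)
    show "W \<subseteq> problem_params A" using A by (auto simp: W_def problem_params_def)
    show "card W = CARD('n option)" unfolding W_def by (rule card_range_Cost) (auto intro: injI)
    fix w assume w: "w \<in> W"
    define X where "X = (Inl ` (problem_params A - W) \<union> range Inr :: ('n param + 'n option) set)"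
    have pm: "poly_fun X (m \<beta>)" for \<beta>
      unfolding m_def by (intro poly_fun_intros) (auto simp: X_def)
    have pc: "poly_fun X (\<lambda>\<xi>. \<xi> (Inl (Coeff \<alpha>)))" if "\<alpha> \<in> A - {0}" for \<alpha>
      using that by (intro poly_fun.var) (auto simp: X_def W_def problem_params_def)
    have pl: "poly_fun X (\<lambda>\<xi>. \<xi> (Inr None))" by (intro poly_fun.var) (auto simp: X_def)
    have "poly_fun X (\<Psi> w)"
      unfolding \<Psi>_def using w
      by (auto simp: W_def intro!: poly_fun.mult[OF pl] poly_fun_sum poly_fun.mult poly_fun.const pm pc poly_fun_uminus)
    then show "poly_fun (Inl ` (problem_params A - W) \<union> range Inr) (\<Psi> w)" by (simp only: X_def)
    show "bounded_linear (\<phi> w)"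
      using w by (auto simp: W_def \<phi>_def intro: bounded_linear_snd bounded_linear_compose[OF bounded_linear_vec_nth bounded_linear_fst])
    show "\<Psi> w (case_sum \<theta> (coords z)) = \<theta> w - \<phi> w (param_system A \<theta> z)" for \<theta> z
    proof -
      have 1: "(\<Sum>\<alpha>\<in>A. g \<alpha>) = g 0 + (\<Sum>\<alpha>\<in>A - {0}. g \<alpha>)" for g :: "('n \<Rightarrow>\<^sub>0 nat) \<Rightarrow> complex"
        using A by (rule sum.remove)
      consider "w = Coeff 0" | i where "w = Cost i" using w by (auto simp: W_def)
      then show ?thesis
      proof cases
        case 1
        then show ?thesis by (simp add: \<Psi>_def \<phi>_def param_system_def critical_system_def case_prod_unfold m \<open>\<And>g. sum g A = _\<close> mon_zero)
      next
        case (2 i)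
        then show ?thesis by (simp add: \<Psi>_def \<phi>_def param_system_def critical_system_def case_prod_unfold m 1 coords_def del: One_nat_def)
      qed
    qed
  qed
qed

lemma interior_Union_lines: "finite R \<Longrightarrow> interior (\<Union>r\<in>R. span {r :: complex}) = {}"
proof (induction R rule: finite_induct)
  case (insert r R)
  have "dim (span {r}) \<le> card {r}" by (simp add: dim_le_card')
  then have "interior (span {r}) = {}" by (intro empty_interior_lowdim) simp
  with insert show ?case by (simp add: interior_closed_Un_empty_interior closed_span)
qed simp

context simplex_support
begin

text \<open>The system $B + s \mathcal{L}$, with \<open>s\<close> as the additional parameter \<open>None\<close>.  The costs are
  parameters of their own, although in the pencil they are $(1 + s) u_i$: otherwise they could not be
  solved for at $s = -1$.\<close>

definition pencil :: "('n param option \<Rightarrow> complex) \<Rightarrow> 'n system" where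
  "pencil \<theta> = critical_system A (\<lambda>i. \<theta> (Some (Cost i)))
     (\<lambda>i \<alpha>. start_gradient d (\<chi> j. \<theta> (Some (Start j))) i \<alpha> + \<theta> None * \<theta> (Some (Coeff \<alpha>)))
     (\<lambda>\<alpha>. start_constraint d (\<theta> (Some Start0)) (\<chi> j. \<theta> (Some (Start j))) \<alpha> + \<theta> None * \<theta> (Some (Coeff \<alpha>)))"

text \<open>Here the constant \<open>c0\<close> of the start system takes the role of the constant coefficient of \<open>f\<close>.\<close>

lemma generic_pencil:
  defines "V \<equiv> insert None (Some ` homotopy_params A)"
  shows "\<exists>D. discriminant V pencil D"
proof -
  define W :: "'n param option set" where "W = insert (Some Start0) (range (\<lambda>i. Some (Cost i)))"
  define m :: "('n \<Rightarrow>\<^sub>0 nat) \<Rightarrow> ('n param option + 'n option \<Rightarrow> complex) \<Rightarrow> complex"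
    where "m \<beta> \<xi> = (\<Prod>j\<in>UNIV. \<xi> (Inr (Some j)) ^ lookup \<beta> j)" for \<beta> \<xi>
  define e where "e b i \<alpha> \<xi> = (if b then \<xi> (Inl (Some (Start i))) else 0) + \<xi> (Inl None) * \<xi> (Inl (Some (Coeff \<alpha>)))"
    for b i \<alpha> and \<xi> :: "'n param option + 'n option \<Rightarrow> complex"
  define \<Psi> where "\<Psi> w \<xi> = (case w of Some (Cost i) \<Rightarrow>
        \<xi> (Inr None) * (\<Sum>\<alpha>\<in>A. of_nat (lookup \<alpha> i) *
          e (\<alpha> = single i (d i)) i \<alpha> \<xi> * m (\<alpha> - single i 1) \<xi>)
     | _ \<Rightarrow> - (\<Sum>\<alpha>\<in>A. e (\<alpha> = single i1 (d i1)) i1 \<alpha> \<xi> * m \<alpha> \<xi>))" for w and \<xi> :: "'n param option + 'n option \<Rightarrow> complex"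
  define \<phi> :: "'n param option \<Rightarrow> (complex, 'n) vec \<times> complex \<Rightarrow> complex"
    where "\<phi> w = (case w of Some (Cost i) \<Rightarrow> (\<lambda>q. fst q $ i) | _ \<Rightarrow> snd)" for w
  have m: "m \<beta> (case_sum \<theta> (coords z)) = mon (fst z) \<beta>" for \<beta> \<theta> z
    by (simp add: m_def mon_def coords_def)
  show ?thesis
  proof (rule generic_system[where W = W and \<Psi> = \<Psi> and \<phi> = \<phi>])
    show "finite V" using finA by (simp add: finite_params V_def)
    show "W \<subseteq> V" by (auto simp: W_def V_def problem_params_def homotopy_params_def)
    show "card W = CARD('n option)" unfolding W_def by (rule card_range_Cost) (auto intro: injI)
    fix w assume w: "w \<in> W"
    define X where "X = (Inl ` (V - W) \<union> range Inr :: ('n param option + 'n option) set)"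
    have pm: "poly_fun X (m \<beta>)" for \<beta>
      unfolding m_def by (intro poly_fun_intros) (auto simp: X_def)
    have pe: "poly_fun X (e b i \<alpha>)" if "\<alpha> \<in> A" for b i \<alpha>
    proof -
      have "poly_fun X (\<lambda>\<xi>. if b then \<xi> (Inl (Some (Start i))) else 0)"
        by (cases b) (auto simp: X_def V_def W_def homotopy_params_def intro!: poly_fun_intros)
      moreover have "poly_fun X (\<lambda>\<xi>. \<xi> (Inl None) * \<xi> (Inl (Some (Coeff \<alpha>))))"
        using that by (intro poly_fun_intros) (auto simp: X_def V_def W_def homotopy_params_def problem_params_def)
      ultimately show ?thesis unfolding e_def by (rule poly_fun.add)
    qed
    have pl: "poly_fun X (\<lambda>\<xi>. \<xi> (Inr None))" by (intro poly_fun.var) (auto simp: X_def)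
    have "poly_fun X (\<Psi> w)"
      unfolding \<Psi>_def using w
      by (auto simp: W_def intro!: poly_fun.mult[OF pl] poly_fun_sum poly_fun.mult poly_fun.const pm pe poly_fun_uminus)
    then show "poly_fun (Inl ` (V - W) \<union> range Inr) (\<Psi> w)" by (simp only: X_def)
    show "bounded_linear (\<phi> w)"
      using w by (auto simp: W_def \<phi>_def intro: bounded_linear_snd bounded_linear_compose[OF bounded_linear_vec_nth bounded_linear_fst])
    show "\<Psi> w (case_sum \<theta> (coords z)) = \<theta> w - \<phi> w (pencil \<theta> z)" for \<theta> z
    proof -
      consider "w = Some Start0" | i where "w = Some (Cost i)" using w by (auto simp: W_def)
      then show ?thesis
      proof cases
        case 1
        have "(\<Sum>\<alpha>\<in>A. e (\<alpha> = single i1 (d i1)) i1 \<alpha> (case_sum \<theta> (coords z)) * mon (fst z) \<alpha>) + \<theta> (Some Start0) =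
          (\<Sum>\<alpha>\<in>A. e (\<alpha> = single i1 (d i1)) i1 \<alpha> (case_sum \<theta> (coords z)) * mon (fst z) \<alpha> +
             (if \<alpha> = 0 then \<theta> (Some Start0) else 0))"
          using finA zero_in by (simp add: sum.distrib)
        also have "\<dots> = (\<Sum>\<alpha>\<in>A. (start_constraint d (\<theta> (Some Start0)) (\<chi> j. \<theta> (Some (Start j))) \<alpha> + \<theta> None * \<theta> (Some (Coeff \<alpha>))) * mon (fst z) \<alpha>)"
          using vertex_neq_0[of i1] by (intro sum.cong refl) (auto simp: e_def start_constraint_def mon_zero algebra_simps)
        finally show ?thesis using 1
          by (simp add: \<Psi>_def \<phi>_def pencil_def critical_system_def case_prod_unfold m) (simp add: algebra_simps eq_neg_iff_add_eq_0)
      next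
        case (2 i)
        then show ?thesis
          by (simp add: \<Psi>_def \<phi>_def pencil_def critical_system_def case_prod_unfold m e_def coords_def start_gradient_def del: One_nat_def cong: if_cong)
      qed
    qed
  qed
qed

subsection \<open>The algebraic degree\<close>

text \<open>In the deformation the monomial \<open>\<alpha>\<close> of \<open>f\<close> is multiplied by \<open>\<epsilon> ^ deform_exponent \<alpha>\<close> and the cost of \<open>i\<close>
  by \<open>\<epsilon> ^ row_exponent i\<close>.  The equation of \<open>i\<close> is then divisible by \<open>\<epsilon> ^ row_exponent i\<close>, and in the
  quotient only the derivative of $x_i^{d_i}$ survives at \<open>\<epsilon> = 0\<close>.  In the constraint only the
  constant and $x_1^{d_1}$ survive, so the limit is a start system.\<close>

definition row_exponent :: "'n \<Rightarrow> nat" where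
  "row_exponent i = (if i = i1 then 0 else 1)"

definition deform_exponent :: "('n \<Rightarrow>\<^sub>0 nat) \<Rightarrow> nat" where
  "deform_exponent \<alpha> = (if \<alpha> = 0 \<or> \<alpha> = single i1 (d i1) then 0
     else if \<alpha> \<in> range (\<lambda>i. single i (d i)) then 1 else 2)"

lemma single_d_eq_iff: "single i (d i) = single j (d j) \<longleftrightarrow> i = j"
  using d_pos[of i] by (metis lookup_single_eq lookup_single_not_eq not_one_le_zero)

lemma deform_exponent_vertex: "deform_exponent (single i (d i)) = row_exponent i"
  using vertex_neq_0[of i] by (auto simp: deform_exponent_def row_exponent_def single_d_eq_iff)

lemma row_less_deform:
  assumes "lookup \<alpha> i > 0" "\<alpha> \<noteq> single i (d i)"
  shows "row_exponent i < deform_exponent \<alpha>"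
proof -
  have "\<alpha> \<noteq> 0" using assms(1) by auto
  moreover have "\<alpha> \<noteq> single j (d j)" if "i \<noteq> i1" for j
    using assms by (auto simp: lookup_single when_def split: if_splits)
  moreover have "\<alpha> \<noteq> single i1 (d i1)"
    using assms by (auto simp: lookup_single when_def split: if_splits)
  ultimately show ?thesis by (auto simp: row_exponent_def deform_exponent_def)
qed

lemma row_le_deform:
  "lookup \<alpha> i > 0 \<Longrightarrow> row_exponent i \<le> deform_exponent \<alpha>"
  using row_less_deform[of \<alpha> i] deform_exponent_vertex[of i]
  by (cases "\<alpha> = single i (d i)") auto

lemma C1_powers: "C1 (\<lambda>t::complex. t ^ k * c)"
  by (intro C1_mult C1_power C1_const C1_bounded_linear bounded_linear_ident)

text \<open>\<open>E \<epsilon>\<close> is the deformed system after the division, and \<open>T \<epsilon>\<close> undoes the division.  The parameters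
  \<open>\<theta> \<epsilon>\<close> are good at \<open>\<epsilon> = 1\<close>, hence at all but finitely many \<open>\<epsilon>\<close>, and the complement of finitely
  many points in the plane is connected.  So \<open>E 1\<close> has as many zeros as \<open>E 0\<close>, a start system.\<close>

theorem degree_of_generic_lagrange_system:
  assumes f: "keys f = A" and u: "\<And>i. u $ i \<noteq> 0"
    and disc: "discriminant (problem_params A) (param_system A) D" and D: "D (problem_point u f) \<noteq> 0"
  shows "has_algebraic_degree u f (d i1 * (\<Prod>i\<in>UNIV - {i1}. d i - 1))"
proof -
  note polyD = discriminantD(1)[OF disc] and nondeg = discriminantD(3)[OF disc] and bdd = discriminantD(4)[OF disc]
  define a where "a \<alpha> = complex_of_real (lookup f \<alpha>)" for \<alpha>
  define c where "c = (\<chi> i. a (single i (d i)))"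
  have a0: "a \<alpha> \<noteq> 0" if "\<alpha> \<in> A" for \<alpha> using that f by (auto simp: a_def in_keys_iff)
  have c: "c $ i \<noteq> 0" for i using a0[OF vertex_in] by (simp add: c_def)
  define \<theta> where "\<theta> \<epsilon> v = (case v of Cost i \<Rightarrow> \<epsilon> ^ row_exponent i * of_real (u $ i)
     | Coeff \<alpha> \<Rightarrow> \<epsilon> ^ deform_exponent \<alpha> * a \<alpha> | _ \<Rightarrow> 0)" for \<epsilon> v
  define E where "E \<epsilon> = critical_system A (\<lambda>i. of_real (u $ i))
     (\<lambda>i \<alpha>. \<epsilon> ^ (deform_exponent \<alpha> - row_exponent i) * a \<alpha>) (\<lambda>\<alpha>. \<epsilon> ^ deform_exponent \<alpha> * a \<alpha>)" for \<epsilon>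
  define T where "T \<epsilon> q = ((\<chi> i. \<epsilon> ^ row_exponent i * fst q $ i), snd q)" for \<epsilon> and q :: "(complex, 'n) vec \<times> complex"
  have T: "bounded_linear (T \<epsilon>)" for \<epsilon>
  proof -
    have "linear (T \<epsilon>)"
      by (rule linearI) (auto simp: T_def vec_eq_iff algebra_simps prod_eq_iff)
    then show ?thesis by (simp add: linear_conv_bounded_linear)
  qed
  have TE: "param_system A (\<theta> \<epsilon>) z = T \<epsilon> (E \<epsilon> z)" for \<epsilon> z
  proof -
    have "of_nat (lookup \<alpha> i) * (\<epsilon> ^ deform_exponent \<alpha> * a \<alpha>) =
        \<epsilon> ^ row_exponent i * (of_nat (lookup \<alpha> i) * (\<epsilon> ^ (deform_exponent \<alpha> - row_exponent i) * a \<alpha>))" for \<alpha> i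
    proof (cases "lookup \<alpha> i > 0")
      case True
      then have "\<epsilon> ^ deform_exponent \<alpha> = \<epsilon> ^ row_exponent i * \<epsilon> ^ (deform_exponent \<alpha> - row_exponent i)"
        using row_le_deform[of \<alpha> i] by (simp flip: power_add)
      then show ?thesis by (simp add: mult_ac)
    qed simp
    then have "(\<Sum>\<alpha>\<in>A. of_nat (lookup \<alpha> i) * (\<epsilon> ^ deform_exponent \<alpha> * a \<alpha>) * mon x (\<alpha> - single i 1)) =
      \<epsilon> ^ row_exponent i * (\<Sum>\<alpha>\<in>A. of_nat (lookup \<alpha> i) * (\<epsilon> ^ (deform_exponent \<alpha> - row_exponent i) * a \<alpha>) * mon x (\<alpha> - single i 1))" for i x
      unfolding sum_distrib_left by (intro sum.cong refl) (simp only: mult.assoc[symmetric])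
    then show ?thesis
      by (cases z) (simp add: param_system_def E_def T_def critical_system_def \<theta>_def vec_eq_iff algebra_simps del: One_nat_def)
  qed
  have \<theta>1: "D (\<theta> 1) = D (problem_point u f)"
    by (rule poly_fun_cong_vars[OF polyD]) (auto simp: \<theta>_def problem_point_def f a_def problem_params_def)
  define S where "S = UNIV - {\<epsilon>. D (\<theta> \<epsilon>) = 0 \<and> \<epsilon> \<noteq> 0}"
  have "finite {\<epsilon>. D (\<theta> \<epsilon>) = 0}"
  proof (rule poly_fun_curve_finite_zeros[OF polyD])
    show "D (\<theta> 1) \<noteq> 0" using \<theta>1 D by simp
    show "poly_fun {()} (\<lambda>x. \<theta> (x ()) v)" for v
      unfolding \<theta>_def by (cases v) (auto intro!: poly_fun_intros)
  qed
  then have "countable {\<epsilon>. D (\<theta> \<epsilon>) = 0 \<and> \<epsilon> \<noteq> 0}" by (intro countable_finite) simp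
  then have S: "connected S"
    unfolding S_def Compl_eq_Diff_UNIV[symmetric]
    by (intro path_connected_imp_connected path_connected_complement_countable) simp_all
  have E1: "E 1 = lagrange_system u f"
    by (simp add: E_def lagrange_system_eq_critical_system f a_def)
  have E_start: "0 ^ (deform_exponent \<alpha> - row_exponent i) * a \<alpha> = start_gradient d c i \<alpha>"
      if "lookup \<alpha> i > 0" for i \<alpha>
      using row_less_deform[OF that] deform_exponent_vertex[of i]
      by (cases "\<alpha> = single i (d i)") (auto simp: start_gradient_def c_def power_0_left)
  have E_start': "0 ^ deform_exponent \<alpha> * a \<alpha> = start_constraint d (a 0) c \<alpha>" for \<alpha>
    by (auto simp: start_constraint_def deform_exponent_def c_def)
  have E0: "E 0 = start_system u d (a 0) c"
    unfolding E_def start_system_eq_critical_system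
    by (rule critical_system_cong) (simp_all only: E_start E_start')
  have C1: "C1 (\<lambda>(\<epsilon>, z). E \<epsilon> z)"
    unfolding E_def by (rule C1_critical_system) (rule C1_const C1_powers)+
  have nd: "nondegenerate (E \<epsilon>) z" if "\<epsilon> \<in> S" "E \<epsilon> z = 0" for \<epsilon> z
  proof (cases "\<epsilon> = 0")
    case True
    then show ?thesis using that(2) start_nondegenerate[OF u c a0[OF zero_in], of z] by (simp add: E0)
  next
    case False
    then have "D (\<theta> \<epsilon>) \<noteq> 0" using that by (auto simp: S_def)
    moreover have "param_system A (\<theta> \<epsilon>) z = 0"
      using T[of \<epsilon>] by (simp add: TE that(2) bounded_linear.linear linear_0)
    ultimately have "nondegenerate (param_system A (\<theta> \<epsilon>)) z" by (rule nondeg)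
    then show ?thesis by (rule nondegenerate_linear_image[OF _ T TE])
  qed
  have bd: "\<exists>e>0. \<exists>R. \<forall>s\<in>S \<inter> ball \<epsilon> e. \<forall>z. E s z = 0 \<longrightarrow> norm z \<le> R" if "\<epsilon> \<in> S" for \<epsilon>
  proof (cases "\<epsilon> = 0")
    case True
    have "\<exists>e>0. \<exists>R. \<forall>s\<in>ball 0 e. \<forall>z. E s z = 0 \<longrightarrow> norm z \<le> R"
      unfolding E_def
      by (rule zeros_bounded_near_start[where c = c and ?c0.0 = "a 0"])
        (use u c a0[OF zero_in] in \<open>auto simp: E_start E_start'\<close>)
    with True show ?thesis by blast
  next
    case False
    then have "D (\<theta> \<epsilon>) \<noteq> 0" using that by (auto simp: S_def)
    moreover have "isCont (\<lambda>\<epsilon>. \<theta> \<epsilon> v) \<epsilon>" for v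
      unfolding \<theta>_def by (cases v) (auto intro!: continuous_intros)
    ultimately obtain e M where e: "e > 0" "\<And>t z. t \<in> ball \<epsilon> e \<Longrightarrow> param_system A (\<theta> t) z = 0 \<Longrightarrow> norm z \<le> M"
      using bdd[of \<theta> \<epsilon>] by blast
    have "param_system A (\<theta> t) z = 0" if "E t z = 0" for t z
      using T[of t] by (simp add: TE that bounded_linear.linear linear_0)
    with e show ?thesis by blast
  qed
  have "0 \<in> S" "1 \<in> S" using \<theta>1 D by (auto simp: S_def)
  then have "finite {z. E 1 z = 0}" "card {z. E 1 z = 0} = card {z. E 0 z = 0}"
    using card_zeros_constant[OF C1 nd bd S, of 1 0] by auto
  then show ?thesis
    using card_zeros_start[OF u c a0[OF zero_in]]
    by (simp add: has_algebraic_degree_def zeros_def E1 E0)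
qed

end

section \<open>The homotopy\<close>

lemma homotopy_critical_system:
  "homotopy (critical_system A U p h) \<gamma> (critical_system A U' p' h') t =
    critical_system A (\<lambda>i. (1 - of_real t) * U i + \<gamma> * of_real t * U' i)
      (\<lambda>i \<alpha>. (1 - of_real t) * p i \<alpha> + \<gamma> * of_real t * p' i \<alpha>)
      (\<lambda>\<alpha>. (1 - of_real t) * h \<alpha> + \<gamma> * of_real t * h' \<alpha>)"
proof (rule ext)
  fix z :: "(complex, 'a) vec \<times> complex"
  obtain x l where z: "z = (x, l)" by (cases z)
  have 1: "(\<Sum>\<alpha>\<in>A. of_nat (lookup \<alpha> i) * ((1 - of_real t) * p i \<alpha> + \<gamma> * of_real t * p' i \<alpha>) * m \<alpha>) =
      (1 - of_real t) * (\<Sum>\<alpha>\<in>A. of_nat (lookup \<alpha> i) * p i \<alpha> * m \<alpha>) +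
      \<gamma> * of_real t * (\<Sum>\<alpha>\<in>A. of_nat (lookup \<alpha> i) * p' i \<alpha> * m \<alpha>)" for i and m :: "_ \<Rightarrow> complex"
    unfolding sum_distrib_left sum.distrib[symmetric] by (intro sum.cong refl) (simp add: algebra_simps)
  have 2: "(\<Sum>\<alpha>\<in>A. ((1 - of_real t) * h \<alpha> + \<gamma> * of_real t * h' \<alpha>) * m \<alpha>) =
      (1 - of_real t) * (\<Sum>\<alpha>\<in>A. h \<alpha> * m \<alpha>) + \<gamma> * of_real t * (\<Sum>\<alpha>\<in>A. h' \<alpha> * m \<alpha>)" for m :: "_ \<Rightarrow> complex"
    unfolding sum_distrib_left sum.distrib[symmetric] by (intro sum.cong refl) (simp add: algebra_simps)
  show "homotopy (critical_system A U p h) \<gamma> (critical_system A U' p' h') t z =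
    critical_system A (\<lambda>i. (1 - of_real t) * U i + \<gamma> * of_real t * U' i)
      (\<lambda>i \<alpha>. (1 - of_real t) * p i \<alpha> + \<gamma> * of_real t * p' i \<alpha>)
      (\<lambda>\<alpha>. (1 - of_real t) * h \<alpha> + \<gamma> * of_real t * h' \<alpha>) z"
    unfolding homotopy_def z critical_system_def prod.case 1 2 by (simp add: vec_eq_iff algebra_simps)
qed

definition pencil_point :: "('n param \<Rightarrow> complex) \<Rightarrow> complex \<Rightarrow> 'n param option \<Rightarrow> complex" where
  "pencil_point \<theta> s v = (case v of None \<Rightarrow> s | Some (Cost i) \<Rightarrow> (1 + s) * \<theta> (Cost i) | Some w \<Rightarrow> \<theta> w)"

definition solutions_reached :: "'n::finite system \<Rightarrow> 'n system \<Rightarrow> bool" where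
  "solutions_reached B L \<longleftrightarrow> (\<exists>G :: complex set. open G \<and> closure G = UNIV \<and>
     (\<forall>\<gamma>\<in>G. \<forall>z\<in>zeros L. \<exists>p. solution_path (homotopy B \<gamma> L) p \<and> p 0 \<in> zeros B \<and> (p \<longlongrightarrow> z) (at_left 1)))"

lemma C1_real: "C1 (\<lambda>t::real. (1 - of_real t) * a + \<gamma> * of_real t * (b :: complex))"
  by (intro C1_add C1_mult C1_diff C1_const C1_bounded_linear bounded_linear_of_real)

context simplex_support
begin

text \<open>Division by \<open>1 - t\<close> leaves the zeros and their nondegeneracy unchanged and moves the homotopy into the
  pencil.\<close>

lemma homotopy_eq_pencil:
  assumes f: "keys f = A" and t: "t \<noteq> 1"
  shows "pencil (pencil_point (homotopy_point u f c0 c) (\<gamma> * of_real t / (1 - of_real t))) z =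
    (1 / (1 - t)) *\<^sub>R homotopy (start_system u d c0 c) \<gamma> (lagrange_system u f) t z"
proof -
  define \<theta> where "\<theta> = homotopy_point u f c0 c"
  define s where "s = \<gamma> * of_real t / (1 - of_real t)"
  have t': "1 - complex_of_real t \<noteq> 0" using t by (metis eq_iff_diff_eq_0 of_real_eq_1_iff)
  define a where "a \<alpha> = complex_of_real (lookup f \<alpha>)" for \<alpha>
  have c: "(\<chi> j. \<theta> (Start j)) = c" by (simp add: \<theta>_def homotopy_point_def homotopy_params_def vec_eq_iff)
  have P: "pencil (pencil_point \<theta> s) = critical_system A (\<lambda>i. (1 + s) * of_real (u $ i))
      (\<lambda>i \<alpha>. start_gradient d c i \<alpha> + s * a \<alpha>) (\<lambda>\<alpha>. start_constraint d c0 c \<alpha> + s * a \<alpha>)"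
    unfolding pencil_def
    by (rule critical_system_cong)
      (simp_all add: pencil_point_def c, simp_all add: \<theta>_def homotopy_point_def homotopy_params_def problem_params_def a_def f)
  have H: "homotopy (start_system u d c0 c) \<gamma> (lagrange_system u f) t =
     critical_system A (\<lambda>i. (1 - of_real t) * of_real (u $ i) + \<gamma> * of_real t * of_real (u $ i))
      (\<lambda>i \<alpha>. (1 - of_real t) * start_gradient d c i \<alpha> + \<gamma> * of_real t * a \<alpha>)
      (\<lambda>\<alpha>. (1 - of_real t) * start_constraint d c0 c \<alpha> + \<gamma> * of_real t * a \<alpha>)"
    unfolding start_system_eq_critical_system lagrange_system_eq_critical_system f homotopy_critical_system a_def ..
  have e: "(1 - of_real t) * (b + s * b') = (1 - of_real t) * b + \<gamma> * of_real t * b'" for b b'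
  proof -
    have "(1 - of_real t) * s = \<gamma> * of_real t" using t' by (simp add: s_def)
    then show ?thesis by (simp add: distrib_left mult.assoc[symmetric])
  qed
  have e': "(1 - of_real t) * ((1 + s) * b) = (1 - of_real t) * b + \<gamma> * of_real t * b" for b
    unfolding distrib_right mult_1 by (rule e)
  have "critical_system A (\<lambda>i. (1 - of_real t) * ((1 + s) * of_real (u $ i)))
      (\<lambda>i \<alpha>. (1 - of_real t) * (start_gradient d c i \<alpha> + s * a \<alpha>)) (\<lambda>\<alpha>. (1 - of_real t) * (start_constraint d c0 c \<alpha> + s * a \<alpha>)) z
    = (1 - t) *\<^sub>R pencil (pencil_point \<theta> s) z"
  proof -
    obtain x l where z: "z = (x, l)" by (cases z)
    have 1: "(\<Sum>\<alpha>\<in>A. of_nat (lookup \<alpha> i) * ((1 - of_real t) * g \<alpha>) * m \<alpha>) =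
      (1 - of_real t) * (\<Sum>\<alpha>\<in>A. of_nat (lookup \<alpha> i) * g \<alpha> * m \<alpha>)" for i and g m :: "_ \<Rightarrow> complex"
      unfolding sum_distrib_left by (intro sum.cong refl) (simp add: algebra_simps)
    have 2: "(\<Sum>\<alpha>\<in>A. ((1 - of_real t) * g \<alpha>) * m \<alpha>) = (1 - of_real t) * (\<Sum>\<alpha>\<in>A. g \<alpha> * m \<alpha>)" for g m :: "_ \<Rightarrow> complex"
      unfolding sum_distrib_left by (intro sum.cong refl) (simp add: algebra_simps)
    show ?thesis
      unfolding P z critical_system_def prod.case 1 2 by (simp add: vec_eq_iff scaleR_conv_of_real[where 'a = complex] right_diff_distrib mult.left_commute)
  qed
  then have "homotopy (start_system u d c0 c) \<gamma> (lagrange_system u f) t z = (1 - t) *\<^sub>R pencil (pencil_point \<theta> s) z"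
    unfolding H e e' .
  then show ?thesis using t by (simp add: s_def \<theta>_def)
qed

text \<open>For $0 < t < 1$ the homotopy is at the member $s = \gamma t / (1 - t)$ of the pencil, which is bad
  only if \<open>\<gamma>\<close> is a real multiple of one of the finitely many bad \<open>s\<close>.  At $t = 0$ the pencil need not
  be good; there the explicit facts about the start system take over.  At $t = 1$ the
  homotopy is \<open>\<gamma>\<close> times the Lagrange system.\<close>

theorem homotopy_reaches_all_solutions:
  assumes f: "keys f = A" and u: "\<And>i. u $ i \<noteq> 0" and c: "\<And>i. c $ i \<noteq> 0" and c0: "c0 \<noteq> 0"
    and lagrange: "\<And>z. lagrange_system u f z = 0 \<Longrightarrow> nondegenerate (lagrange_system u f) z"
    and disc: "discriminant (insert None (Some ` homotopy_params A)) pencil D"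
    and D: "D (pencil_point (homotopy_point u f c0 c) s0) \<noteq> 0"
  shows "solutions_reached (start_system u d c0 c) (lagrange_system u f)"
proof -
  note polyD = discriminantD(1)[OF disc] and nondeg = discriminantD(3)[OF disc] and bdd = discriminantD(4)[OF disc]
  define \<theta> where "\<theta> = pencil_point (homotopy_point u f c0 c)"
  define Bad where "Bad = {s. D (\<theta> s) = 0}"
  have "finite Bad"
    unfolding Bad_def
  proof (rule poly_fun_curve_finite_zeros[OF polyD])
    show "D (\<theta> s0) \<noteq> 0" using D by (simp add: \<theta>_def)
    show "poly_fun {()} (\<lambda>x. \<theta> (x ()) v)" for v
    proof (cases v)
      case (Some w)
      then show ?thesis unfolding \<theta>_def pencil_point_def by (cases w) (auto intro!: poly_fun_intros)
    qed (auto simp: \<theta>_def pencil_point_def intro!: poly_fun_intros)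
  qed
  then have finR: "finite (insert 0 Bad)" by simp
  define G where "G = - (\<Union>r\<in>insert 0 Bad. span {r})"
  have "closed (\<Union>r\<in>insert 0 Bad. span {r})" using finR by (intro closed_UN closed_span ballI)
  then have "open G" unfolding G_def by (rule open_Compl)
  moreover have "closure G = UNIV"
    unfolding G_def closure_complement interior_Union_lines[OF finR] by simp
  moreover have "\<exists>p. solution_path (homotopy (start_system u d c0 c) \<gamma> (lagrange_system u f)) p \<and>
           p 0 \<in> zeros (start_system u d c0 c) \<and> (p \<longlongrightarrow> z) (at_left 1)"
    if \<gamma>: "\<gamma> \<in> G" and z: "z \<in> zeros (lagrange_system u f)" for \<gamma> z
  proof -
    define H where "H = homotopy (start_system u d c0 c) \<gamma> (lagrange_system u f)"
    define a where "a \<alpha> = complex_of_real (lookup f \<alpha>)" for \<alpha>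
    define s where "s t = \<gamma> * of_real t / (1 - of_real t)" for t :: real
    have H: "H t = critical_system A (\<lambda>i. (1 - of_real t) * of_real (u $ i) + \<gamma> * of_real t * of_real (u $ i))
      (\<lambda>i \<alpha>. (1 - of_real t) * start_gradient d c i \<alpha> + \<gamma> * of_real t * a \<alpha>)
      (\<lambda>\<alpha>. (1 - of_real t) * start_constraint d c0 c \<alpha> + \<gamma> * of_real t * a \<alpha>)" for t
      unfolding H_def start_system_eq_critical_system lagrange_system_eq_critical_system f homotopy_critical_system a_def ..
    have \<gamma>0: "\<gamma> \<noteq> 0" using \<gamma> by (auto simp: G_def)
    have H0: "H 0 = start_system u d c0 c" by (rule ext) (simp add: H_def homotopy_def)
    have H1: "lagrange_system u f y = (inverse \<gamma> *s fst (H 1 y), inverse \<gamma> * snd (H 1 y))" for y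
      using \<gamma>0 by (simp add: H_def homotopy_def vec_eq_iff prod_eq_iff)
    have Hs: "pencil (\<theta> (s t)) y = (1 / (1 - t)) *\<^sub>R H t y" if "t \<noteq> 1" for t y
      unfolding \<theta>_def s_def H_def by (rule homotopy_eq_pencil[OF f that])
    have good: "D (\<theta> (s t)) \<noteq> 0" if t: "t \<in> {0<..<1}" for t
    proof
      assume "D (\<theta> (s t)) = 0"
      then have "s t \<in> Bad" by (simp add: Bad_def)
      moreover have "\<gamma> = ((1 - t) / t) *\<^sub>R s t"
      proof -
        have "complex_of_real t \<noteq> 0" "1 - complex_of_real t \<noteq> 0"
          using t by (auto simp: complex_eq_iff)
        then show ?thesis by (simp add: s_def scaleR_conv_of_real)
      qed
      then have "\<gamma> \<in> span {s t}" by (metis insertI1 span_base span_scale)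
      ultimately show False using \<gamma> by (auto simp: G_def)
    qed
    have C1: "C1 (\<lambda>(t, z). H t z)" unfolding H by (rule C1_critical_system) (rule C1_real)+
    have nd: "nondegenerate (H t) y" if t: "t \<in> {0..<1}" and y: "H t y = 0" for t y
    proof (cases "t = 0")
      case True
      then show ?thesis using y start_nondegenerate[OF u c c0, of y] by (simp add: H0)
    next
      case False
      with t have t': "t \<in> {0<..<1}" by auto
      have "pencil (\<theta> (s t)) y = 0" using t y by (simp add: Hs)
      then have "nondegenerate (pencil (\<theta> (s t))) y" by (rule nondeg[OF good[OF t']])
      then show ?thesis
        by (rule nondegenerate_linear_image[OF _ bounded_linear_scaleR_right[of "1 / (1 - t)"]]) (use Hs t' in auto)
    qed
    have bd: "\<exists>e>0. \<exists>R. \<forall>t'\<in>{0..<1} \<inter> ball t e. \<forall>y. H t' y = 0 \<longrightarrow> norm y \<le> R" if t: "t \<in> {0..<1}" for t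
    proof (cases "t = 0")
      case True
      have "\<exists>e>0. \<exists>R. \<forall>t\<in>ball 0 e. \<forall>z. H t z = 0 \<longrightarrow> norm z \<le> R"
        unfolding H
        by (rule zeros_bounded_near_start[where c = c and ?c0.0 = c0]) (use u c c0 in auto)
      with True show ?thesis by blast
    next
      case False
      with t have t': "t \<in> {0<..<1}" by auto
      have "isCont (\<lambda>s. \<theta> s v) (s t)" for v
      proof (cases v)
        case (Some w)
        then show ?thesis unfolding \<theta>_def pencil_point_def by (cases w) (auto intro!: continuous_intros)
      qed (auto simp: \<theta>_def pencil_point_def)
      then obtain e M where e: "e > 0" "\<And>r y. r \<in> ball (s t) e \<Longrightarrow> pencil (\<theta> r) y = 0 \<Longrightarrow> norm y \<le> M"
        using bdd[of \<theta> "s t"] good[OF t'] by blast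
      have "1 - complex_of_real t \<noteq> 0" using t by (auto simp: complex_eq_iff)
      then have "isCont s t" unfolding s_def by (intro continuous_intros)
      then obtain e' where e': "e' > 0" "\<And>r. dist r t < e' \<Longrightarrow> dist (s r) (s t) < e"
        using e(1) unfolding continuous_at_eps_delta by blast
      have "norm y \<le> M" if r: "r \<in> {0..<1} \<inter> ball t e'" and y: "H r y = 0" for r y
      proof (rule e(2))
        show "s r \<in> ball (s t) e" using e'(2)[of r] r by (simp add: dist_commute)
        show "pencil (\<theta> (s r)) y = 0" using r y by (simp add: Hs)
      qed
      with e'(1) show ?thesis by blast
    qed
    have zL: "lagrange_system u f z = 0" using z by (simp add: zeros_def)
    have "H 1 z = 0" by (simp add: H_def homotopy_def zL zero_prod_def)
    moreover have "nondegenerate (H 1) z"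
    proof (rule nondegenerate_linear_image[where T = "\<lambda>q. (inverse \<gamma> *s fst q, inverse \<gamma> * snd q)", OF lagrange[OF zL] _ H1])
      have "linear (\<lambda>q :: (complex, 'n) vec \<times> complex. (inverse \<gamma> *s fst q, inverse \<gamma> * snd q))"
        by (rule linearI) (auto simp: vec_eq_iff algebra_simps)
      then show "bounded_linear (\<lambda>q :: (complex, 'n) vec \<times> complex. (inverse \<gamma> *s fst q, inverse \<gamma> * snd q))"
        by (simp add: linear_conv_bounded_linear)
    qed
    ultimately obtain p where p: "continuous_on {0..<1} p" "\<forall>t\<in>{0..<1}. H t (p t) = 0" "(p \<longlongrightarrow> z) (at_left 1)"
      using zero_path_lifting[OF C1 nd bd] by blast
    have "H 0 (p 0) = 0" using p(2) by simp
    then have "p 0 \<in> zeros (start_system u d c0 c)" by (simp add: H0 zeros_def)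
    then show ?thesis using p unfolding solution_path_def H_def by blast
  qed
  ultimately show ?thesis unfolding solutions_reached_def by blast
qed

lemma lagrange_part:
  "\<exists>Z. proper_subvariety (problem_params A) Z \<and>
     (\<forall>u f. keys f = A \<and> problem_point u f \<notin> Z \<longrightarrow>
        has_algebraic_degree u f (d i1 * (\<Prod>i\<in>UNIV - {i1}. d i - 1)))"
proof -
  obtain D \<theta>0 where disc: "discriminant (problem_params A) (param_system A) D" and D: "D \<theta>0 \<noteq> 0"
    using generic_lagrange[OF finA zero_in] discriminantD(2) by blast
  note polyD = discriminantD(1)[OF disc]
  define P where "P = (\<lambda>\<theta>. D \<theta> * (\<Prod>i\<in>UNIV. \<theta> (Cost i :: 'n param)))"
  have pc: "poly_fun (problem_params A) (\<lambda>\<theta>. \<Prod>i\<in>UNIV. \<theta> (Cost i :: 'n param))"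
    by (intro poly_fun_intros) (simp add: problem_params_def)
  have "poly_fun (problem_params A) P" unfolding P_def by (rule poly_fun.mult[OF polyD pc])
  moreover obtain \<theta>1 where "P \<theta>1 \<noteq> 0"
    using poly_fun_mult_nonzero[OF polyD pc D, of "\<lambda>_. 1"] by (auto simp: P_def)
  ultimately have "proper_subvariety (problem_params A) {\<theta> \<in> problem_params A \<rightarrow>\<^sub>E UNIV. \<forall>i\<in>{()}. P \<theta> = 0}"
    using proper_subvariety_of_poly_funs[OF finite_params(1)[OF finA], of "{()}" "\<lambda>_. P" "()" \<theta>1] by simp
  moreover have "has_algebraic_degree u f (d i1 * (\<Prod>i\<in>UNIV - {i1}. d i - 1))"
    if f: "keys f = A" and Z: "problem_point u f \<notin> {\<theta> \<in> problem_params A \<rightarrow>\<^sub>E UNIV. \<forall>i\<in>{()}. P \<theta> = 0}" for u f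
  proof (rule degree_of_generic_lagrange_system[OF f _ disc])
    have "problem_point u f \<in> problem_params A \<rightarrow>\<^sub>E UNIV" by (simp add: problem_point_def f)
    with Z have *: "P (problem_point u f) \<noteq> 0" by simp
    then show "D (problem_point u f) \<noteq> 0" by (simp add: P_def)
    show "u $ i \<noteq> 0" for i
    proof -
      have "problem_point u f (Cost i) \<noteq> 0" using * by (simp add: P_def)
      then show ?thesis by (simp add: problem_point_def problem_params_def)
    qed
  qed
  ultimately show ?thesis by blast
qed

text \<open>Besides good parameters of the Lagrange system and nonzero constants, some member of the pencil has
  to be good.  That no \<open>s\<close> gives a good member is a system of polynomial equations in the other
  parameters, one for each \<open>s\<close>.\<close>

lemma homotopy_part:
  "\<exists>Z. proper_subvariety (homotopy_params A) Z \<and>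
     (\<forall>u f c0 c. keys f = A \<and> homotopy_point u f c0 c \<notin> Z \<longrightarrow>
        solutions_reached (start_system u d c0 c) (lagrange_system u f))"
proof -
  define V where "V = homotopy_params A"
  obtain D1 \<theta>1 where disc1: "discriminant (problem_params A) (param_system A) D1" and D1: "D1 \<theta>1 \<noteq> 0"
    using generic_lagrange[OF finA zero_in] discriminantD(2) by blast
  obtain D2 \<theta>2 where disc2: "discriminant (insert None (Some ` V)) pencil D2" and D2: "D2 \<theta>2 \<noteq> 0"
    using generic_pencil discriminantD(2) unfolding V_def by blast
  note polyD1 = discriminantD(1)[OF disc1] and polyD2 = discriminantD(1)[OF disc2]
  define N where "N = (\<lambda>\<theta> :: 'n param \<Rightarrow> complex. \<theta> Start0 * (\<Prod>i\<in>UNIV. \<theta> (Cost i) * \<theta> (Start i :: 'n param)))"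
  have N: "poly_fun V N"
    unfolding N_def by (intro poly_fun_intros) (auto simp: V_def homotopy_params_def problem_params_def)
  have D1V: "poly_fun V D1" by (rule poly_fun_mono[OF polyD1]) (auto simp: V_def homotopy_params_def)
  define P where "P s \<theta> = D2 (pencil_point \<theta> s) * (D1 \<theta> * N \<theta>)" for s \<theta>
  have D2V: "poly_fun V (\<lambda>\<theta>. D2 (pencil_point \<theta> s))" for s
  proof (rule poly_fun_subst[OF polyD2])
    fix v assume v: "v \<in> insert None (Some ` V)"
    show "poly_fun V (\<lambda>\<theta>. pencil_point \<theta> s v)"
    proof (cases v)
      case (Some w)
      with v have "w \<in> V" by auto
      then show ?thesis unfolding pencil_point_def Some by (cases w) (auto intro!: poly_fun_intros)
    qed (auto simp: pencil_point_def intro: poly_fun_intros)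
  qed
  have P: "poly_fun V (P s)" for s
    unfolding P_def by (intro poly_fun.mult D2V D1V N)
  have "\<exists>s \<theta>. P s \<theta> \<noteq> 0"
  proof -
    have "poly_fun (insert None (Some ` V)) (\<lambda>\<theta>. 1 + \<theta> None)" by (intro poly_fun_intros) auto
    \<comment> \<open>A good member with \<open>s \<noteq> -1\<close> is needed to recover the costs \<open>u\<close> from \<open>(1 + s) * u\<close>.\<close>
    from poly_fun_mult_nonzero[OF polyD2 this D2, of "\<lambda>_. 0"]
    obtain \<theta>' where \<theta>': "D2 \<theta>' \<noteq> 0" "1 + \<theta>' None \<noteq> 0" by auto
    define s where "s = \<theta>' None"
    define \<theta> where "\<theta> w = (case w of Cost i \<Rightarrow> \<theta>' (Some (Cost i)) / (1 + s) | w \<Rightarrow> \<theta>' (Some w))" for w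
    have "pencil_point \<theta> s = \<theta>'"
    proof
      show "pencil_point \<theta> s v = \<theta>' v" for v
      proof (cases v)
        case (Some w)
        then show ?thesis using \<theta>'(2) by (cases w) (auto simp: pencil_point_def \<theta>_def s_def)
      qed (simp add: pencil_point_def s_def)
    qed
    then have 1: "D2 (pencil_point \<theta> s) \<noteq> 0" using \<theta>'(1) by simp
    obtain \<theta>3 where 2: "D1 \<theta>3 * N \<theta>3 \<noteq> 0"
      using poly_fun_mult_nonzero[OF D1V N D1, of "\<lambda>_. 1"] by (auto simp: N_def)
    have "\<exists>\<theta>. D2 (pencil_point \<theta> s) * (D1 \<theta> * N \<theta>) \<noteq> 0"
      by (rule poly_fun_mult_nonzero[where f = "\<lambda>\<theta>. D2 (pencil_point \<theta> s)" and g = "\<lambda>\<theta>. D1 \<theta> * N \<theta>"])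
        (rule D2V, rule poly_fun.mult[OF D1V N], rule 1, rule 2)
    then show ?thesis unfolding P_def by blast
  qed
  then obtain s1 \<theta>s where "P s1 \<theta>s \<noteq> 0" by blast
  then have "proper_subvariety V {\<theta> \<in> V \<rightarrow>\<^sub>E UNIV. \<forall>s\<in>UNIV. P s \<theta> = 0}"
    using proper_subvariety_of_poly_funs[of V UNIV P s1 \<theta>s] P finite_params(2)[OF finA] by (simp add: V_def)
  moreover have "solutions_reached (start_system u d c0 c) (lagrange_system u f)"
    if f: "keys f = A" and Z: "homotopy_point u f c0 c \<notin> {\<theta> \<in> V \<rightarrow>\<^sub>E UNIV. \<forall>s\<in>UNIV. P s \<theta> = 0}" for u f c0 c
  proof -
    define h where "h = homotopy_point u f c0 c"
    have "h \<in> V \<rightarrow>\<^sub>E UNIV" by (simp add: h_def homotopy_point_def f V_def)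
    with Z obtain s0 where s0: "P s0 h \<noteq> 0" unfolding h_def by blast
    then have N0: "N h \<noteq> 0" by (simp add: P_def)
    have h: "h Start0 = c0" "h (Cost i) = of_real (u $ i)" "h (Start i) = c $ i" for i
      by (simp_all add: h_def homotopy_point_def homotopy_params_def problem_params_def)
    have "D1 (problem_point u f) = D1 h"
      by (rule poly_fun_cong_vars[OF polyD1]) (auto simp: h_def homotopy_point_def problem_point_def f homotopy_params_def problem_params_def)
    then have d1: "D1 (problem_point u f) \<noteq> 0" using s0 by (auto simp: P_def)
    show ?thesis
    proof (rule homotopy_reaches_all_solutions[OF f _ _ _ _ disc2[unfolded V_def]])
      show "u $ i \<noteq> 0" "c $ i \<noteq> 0" "c0 \<noteq> 0" for i using N0 by (auto simp: N_def h)
      show "nondegenerate (lagrange_system u f) z" if "lagrange_system u f z = 0" for z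
        using discriminantD(3)[OF disc1 d1] that by (simp add: lagrange_system_eq_param_system f)
      show "D2 (pencil_point (homotopy_point u f c0 c) s0) \<noteq> 0" using s0 by (simp add: P_def h_def)
    qed
  qed
  ultimately show ?thesis unfolding V_def by blast
qed

end

section \<open>Newton polytopes\<close>

lemma simplex_vertex_unique:
  fixes d :: "'n::finite \<Rightarrow> nat"
  assumes d: "\<And>i. 1 \<le> d i" and below: "(\<Sum>i\<in>UNIV. real (lookup \<alpha> i) / real (d i)) \<le> 1"
    and k: "d k \<le> lookup \<alpha> k"
  shows "\<alpha> = single k (d k)"
proof -
  have "real (lookup \<alpha> k) / real (d k) + (\<Sum>j\<in>UNIV - {k}. real (lookup \<alpha> j) / real (d j)) \<le> 1"
    using below by (subst (asm) sum.remove[of _ k]) auto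
  moreover have "real (lookup \<alpha> k) / real (d k) \<ge> 1" using k d[of k] by (simp add: field_simps)
  moreover have "(\<Sum>j\<in>UNIV - {k}. real (lookup \<alpha> j) / real (d j)) \<ge> 0" by (intro sum_nonneg) auto
  ultimately have "(\<Sum>j\<in>UNIV - {k}. real (lookup \<alpha> j) / real (d j)) = 0"
    and 1: "real (lookup \<alpha> k) / real (d k) = 1" by linarith+
  then have "\<forall>j\<in>UNIV - {k}. real (lookup \<alpha> j) / real (d j) = 0"
    by (subst (asm) sum_nonneg_eq_0_iff) auto
  then have "lookup \<alpha> j = 0" if "j \<noteq> k" for j using that d[of j] by auto
  moreover have "lookup \<alpha> k = d k" using 1 d[of k] by (simp add: field_simps)
  ultimately show ?thesis by (intro poly_mapping_eqI) (auto simp: lookup_single when_def)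
qed

text \<open>Both polytopes lie in the same half-spaces.  A half-space that contains all of the support except a
  vertex of the simplex would cut off this vertex.\<close>

lemma newton_polytope_simplexD:
  fixes d :: "'n::finite \<Rightarrow> nat" and f :: "('n, real) mpoly"
  assumes d: "\<And>i. 1 \<le> d i"
    and N: "newton_polytope f = convex hull (insert 0 (range (\<lambda>i. axis i (real (d i)))))"
  shows "\<alpha> \<in> keys f \<Longrightarrow> (\<Sum>i\<in>UNIV. real (lookup \<alpha> i) / real (d i)) \<le> 1"
    and "0 \<in> keys f" and "single i (d i) \<in> keys f"
proof -
  define emb :: "('n \<Rightarrow>\<^sub>0 nat) \<Rightarrow> real ^ 'n" where "emb \<alpha> = (\<chi> i. real (lookup \<alpha> i))" for \<alpha>
  define T :: "(real ^ 'n) set" where "T = insert 0 (range (\<lambda>i. axis i (real (d i))))"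
  have N': "convex hull (emb ` keys f) = convex hull T"
    using N by (simp add: newton_polytope_def emb_def T_def)
  have half: "convex {x :: real ^ 'n. (\<Sum>j\<in>UNIV. b j * x $ j) \<le> r}" for b r
    using convex_halfspace_le[of "\<chi> j. b j" r] by (simp add: inner_vec_def)
  have hull: "y \<in> {x. (\<Sum>j\<in>UNIV. b j * x $ j) \<le> r}"
    if "y \<in> convex hull X" "X \<subseteq> {x. (\<Sum>j\<in>UNIV. b j * x $ j) \<le> r}" for y :: "real ^ 'n" and b r X
    using hull_minimal[OF that(2), of convex] half that(1) by blast
  have ax: "(\<Sum>j\<in>UNIV. b j * (axis i r :: real ^ 'n) $ j) = b i * r" for b i r
    by (simp add: axis_def if_distrib sum.delta cong: if_cong)
  have below: "(\<Sum>i\<in>UNIV. real (lookup \<alpha> i) / real (d i)) \<le> 1" if "\<alpha> \<in> keys f" for \<alpha>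
  proof -
    have "emb \<alpha> \<in> convex hull T" unfolding N'[symmetric] using that by (intro hull_inc) auto
    moreover have "T \<subseteq> {x. (\<Sum>j\<in>UNIV. 1 / real (d j) * x $ j) \<le> 1}"
    proof -
      have "(\<Sum>j\<in>UNIV. 1 / real (d j) * (axis i (real (d i)) :: real ^ 'n) $ j) \<le> 1" for i
        unfolding ax by simp
      then show ?thesis unfolding T_def by auto
    qed
    ultimately have "emb \<alpha> \<in> {x. (\<Sum>j\<in>UNIV. 1 / real (d j) * x $ j) \<le> 1}" by (rule hull)
    then show ?thesis by (simp add: emb_def)
  qed
  then show "\<alpha> \<in> keys f \<Longrightarrow> (\<Sum>i\<in>UNIV. real (lookup \<alpha> i) / real (d i)) \<le> 1" .
  show "0 \<in> keys f"
  proof (rule ccontr)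
    assume 0: "0 \<notin> keys f"
    have "0 \<in> convex hull (emb ` keys f)" unfolding N' T_def by (intro hull_inc) auto
    moreover have "emb ` keys f \<subseteq> {x. (\<Sum>j\<in>UNIV. (- 1) * x $ j) \<le> - 1}"
    proof clarify
      fix \<alpha> assume "\<alpha> \<in> keys f"
      with 0 have "\<alpha> \<noteq> 0" by auto
      then obtain i where "lookup \<alpha> i \<noteq> 0" by (metis lookup_zero poly_mapping_eqI)
      then have "1 \<le> real (lookup \<alpha> i)" by simp
      also have "\<dots> \<le> (\<Sum>j\<in>UNIV. real (lookup \<alpha> j))" by (rule member_le_sum) auto
      finally show "(\<Sum>j\<in>UNIV. (- 1) * emb \<alpha> $ j) \<le> - 1" by (simp add: emb_def sum_negf)
    qed
    ultimately have "0 \<in> {x :: real ^ 'n. (\<Sum>j\<in>UNIV. (- 1) * x $ j) \<le> - 1}" by (rule hull)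
    then show False by simp
  qed
  show "single i (d i) \<in> keys f"
  proof (rule ccontr)
    assume i: "single i (d i) \<notin> keys f"
    define b where "b j = (if j = i then 1 else 0 :: real)" for j
    have b: "(\<Sum>j\<in>UNIV. b j * x $ j) = x $ i" for x :: "real ^ 'n"
      by (simp add: b_def if_distrib[of "\<lambda>y. y * _"] sum.delta cong: if_cong)
    have "axis i (real (d i)) \<in> convex hull (emb ` keys f)"
      unfolding N' T_def by (intro hull_inc) auto
    moreover have "emb ` keys f \<subseteq> {x. (\<Sum>j\<in>UNIV. b j * x $ j) \<le> real (d i) - 1}"
    proof clarify
      fix \<alpha> assume \<alpha>: "\<alpha> \<in> keys f"
      have "lookup \<alpha> i < d i"
        using simplex_vertex_unique[OF d below[OF \<alpha>], of i] \<alpha> i by (metis not_less)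
      then show "(\<Sum>j\<in>UNIV. b j * emb \<alpha> $ j) \<le> real (d i) - 1" unfolding b by (simp add: emb_def)
    qed
    ultimately have "axis i (real (d i)) \<in> {x :: real ^ 'n. (\<Sum>j\<in>UNIV. b j * x $ j) \<le> real (d i) - 1}" by (rule hull)
    then show False by (simp add: b axis_def)
  qed
qed

text \<open>If \<open>d i = d j = 1\<close>, then the derivatives of \<open>f\<close> with respect to both variables are constants, and the
  equations of \<open>i\<close> and \<open>j\<close> force \<open>u\<close> to be proportional to them.\<close>

lemma linear_variables_no_solution:
  fixes d :: "'n::finite \<Rightarrow> nat" and f :: "('n, real) mpoly"
  assumes d: "\<And>i. 1 \<le> d i"
    and below: "\<And>\<alpha>. \<alpha> \<in> keys f \<Longrightarrow> (\<Sum>i\<in>UNIV. real (lookup \<alpha> i) / real (d i)) \<le> 1"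
    and vertex: "\<And>i. single i (d i) \<in> keys f"
    and ij: "d i = 1" "d j = 1"
    and neq: "complex_of_real (u $ i) * of_real (lookup f (single j 1)) \<noteq>
       complex_of_real (u $ j) * of_real (lookup f (single i 1))"
  shows "zeros (lagrange_system u f) = {}"
proof -
  have only: "\<alpha> = single k 1" if "\<alpha> \<in> keys f" "lookup \<alpha> k > 0" "d k = 1" for \<alpha> k
    using simplex_vertex_unique[OF d below[OF that(1)], of k] that by simp
  have "of_real (u $ k) = snd z * complex_of_real (lookup f (single k 1))"
    if z: "lagrange_system u f z = 0" and k: "d k = 1" for z k
  proof -
    obtain x l where xl: "z = (x, l)" by (cases z)
    have "of_real (u $ k) = l * (\<Sum>\<alpha>\<in>keys f. of_nat (lookup \<alpha> k) *
        of_real (lookup f \<alpha>) * mon x (\<alpha> - single k 1))"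
      using z unfolding lagrange_system_eq_critical_system xl critical_system_eq_0_iff by blast
    also have "(\<Sum>\<alpha>\<in>keys f. of_nat (lookup \<alpha> k) *
        of_real (lookup f \<alpha>) * mon x (\<alpha> - single k 1)) =
       (\<Sum>\<alpha>\<in>{single k 1}. of_nat (lookup \<alpha> k) *
        of_real (lookup f \<alpha>) * mon x (\<alpha> - single k 1))"
    proof (rule sum.mono_neutral_right)
      show "{single k 1} \<subseteq> keys f" using vertex[of k] by (simp add: k)
      show "\<forall>\<alpha>\<in>keys f - {single k 1}. of_nat (lookup \<alpha> k) *
        of_real (lookup f \<alpha>) * mon x (\<alpha> - single k 1) = 0"
      proof
        fix \<alpha> assume \<alpha>: "\<alpha> \<in> keys f - {single k 1}"
        then have "\<not> 0 < lookup \<alpha> k" using only[of \<alpha> k] k by blast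
        then show "of_nat (lookup \<alpha> k) *
          of_real (lookup f \<alpha>) * mon x (\<alpha> - single k 1) = 0" by simp
      qed
    qed simp
    finally show ?thesis by (simp add: xl mon_zero)
  qed
  then have "of_real (u $ i) * complex_of_real (lookup f (single j 1)) =
      of_real (u $ j) * complex_of_real (lookup f (single i 1))"
    if "lagrange_system u f z = 0" for z
    using that ij by (simp only: mult_ac)
  with neq have "lagrange_system u f z \<noteq> 0" for z by blast
  then show ?thesis by (auto simp: zeros_def)
qed

lemma empty_proper_subvariety: "finite V \<Longrightarrow> proper_subvariety V {}"
  using proper_subvariety_of_poly_funs[of V "{()}" "\<lambda>_ _. 1" "()" "\<lambda>_. 0"] by (auto intro: poly_fun_intros)

theorem theorem4p1:
  fixes d :: "'n::{finite,linorder} \<Rightarrow> nat" and A :: "('n \<Rightarrow>\<^sub>0 nat) set"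
  assumes "\<forall>i. 1 \<le> d i" and "mono d" and "finite A"
  shows
    "(\<exists>Z. proper_subvariety (problem_params A) Z \<and>
       (\<forall>(u :: (real, 'n) vec) (f :: ('n, real) mpoly).
          Poly_Mapping.keys f = A \<and>
          newton_polytope f = convex hull (insert 0 (range (\<lambda>i. axis i (real (d i))))) \<and>
          problem_point u f \<notin> Z \<longrightarrow>
          has_algebraic_degree u f (d (Min UNIV) * (\<Prod>i\<in>UNIV - {Min UNIV}. (d i - 1))))) \<and>
     (\<exists>Z. proper_subvariety (homotopy_params A) Z \<and>
       (\<forall>(u :: (real, 'n) vec) (f :: ('n, real) mpoly) (c0 :: complex) (c :: (complex, 'n) vec).
          Poly_Mapping.keys f = A \<and>
          newton_polytope f = convex hull (insert 0 (range (\<lambda>i. axis i (real (d i))))) \<and>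
          homotopy_point u f c0 c \<notin> Z \<longrightarrow>
          (\<exists>G :: complex set. open G \<and> closure G = UNIV \<and>
             (\<forall>\<gamma>\<in>G. \<forall>z\<in>zeros (lagrange_system u f).
                \<exists>p. solution_path (homotopy (start_system u d c0 c) \<gamma> (lagrange_system u f)) p \<and>
                    p 0 \<in> zeros (start_system u d c0 c) \<and>
                    (p \<longlongrightarrow> z) (at_left 1)))))"
proof -
  have d: "1 \<le> d i" for i using assms(1) by blast
  define Simplex where "Simplex f \<longleftrightarrow> keys f = A \<and>
      newton_polytope f = convex hull (insert 0 (range (\<lambda>i. axis i (real (d i)))))" for f :: "('n, real) mpoly"
  consider "\<nexists>f. Simplex f" | g where "Simplex g" "\<forall>i. i \<noteq> Min UNIV \<longrightarrow> 2 \<le> d i"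
    | g j where "Simplex g" "j \<noteq> Min UNIV" "\<not> 2 \<le> d j" by blast
  then show ?thesis
  proof cases
    \<comment> \<open>For a support without the prescribed Newton polytope the statement is vacuous.\<close>
    case 1
    then show ?thesis
      using empty_proper_subvariety[OF finite_params(1)[OF assms(3)]]
        empty_proper_subvariety[OF finite_params(2)[OF assms(3)]] unfolding Simplex_def by blast
  next
    case (2 g)
    then have g: "keys g = A"
      and N: "newton_polytope g = convex hull (insert 0 (range (\<lambda>i. axis i (real (d i)))))"
      by (simp_all add: Simplex_def)
    interpret simplex_support d A
      using assms 2(2) newton_polytope_simplexD[OF d N] unfolding g by unfold_locales auto
    show ?thesis using lagrange_part homotopy_part unfolding solutions_reached_def by blast
  next
    case (3 g j)
    define i where "i = (Min UNIV :: 'n)"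
    have g: "keys g = A"
      and N: "newton_polytope g = convex hull (insert 0 (range (\<lambda>i. axis i (real (d i)))))"
      using 3 by (simp_all add: Simplex_def)
    have dj: "d j = 1" using 3 d[of j] by auto
    have "d i \<le> d j" using assms(2) by (rule monoD) (simp add: i_def)
    then have di: "d i = 1" using dj d[of i] by simp
    have verts: "single i 1 \<in> A" "single j 1 \<in> A"
      using newton_polytope_simplexD(3)[OF d N, of i] newton_polytope_simplexD(3)[OF d N, of j] by (simp_all add: g di dj)
    define P where "P \<theta> = \<theta> (Cost i) * \<theta> (Coeff (single j 1)) -
        \<theta> (Cost j) * \<theta> (Coeff (single i 1))" for \<theta> :: "'n param \<Rightarrow> complex"
    have P: "poly_fun V P" if "problem_params A \<subseteq> V" for V
      unfolding P_def using that verts by (intro poly_fun_intros) (auto simp: problem_params_def)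
    have P1: "P (\<lambda>v. if v = Cost i \<or> v = Coeff (single j 1) then 1 else 0) \<noteq> 0"
      using 3(2) by (simp add: P_def i_def)
    define Z where "Z V = {\<theta> \<in> V \<rightarrow>\<^sub>E UNIV. \<forall>i\<in>{()}. P \<theta> = 0}" for V
    have proper: "proper_subvariety V (Z V)" if "finite V" "problem_params A \<subseteq> V" for V
      unfolding Z_def
      by (rule proper_subvariety_of_poly_funs[where f = "\<lambda>_. P" and I = "{()}" and i = "()", OF that(1) P[OF that(2)] _ P1]) simp
    have empty: "zeros (lagrange_system u f) = {}" if "Simplex f" "P (problem_point u f) \<noteq> 0" for u f
    proof (rule linear_variables_no_solution[OF d _ _ di dj])
      have N: "newton_polytope f = convex hull (insert 0 (range (\<lambda>i. axis i (real (d i)))))"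
        and k: "keys f = A" using that by (simp_all add: Simplex_def)
      show "\<alpha> \<in> keys f \<Longrightarrow> (\<Sum>i\<in>UNIV. real (lookup \<alpha> i) / real (d i)) \<le> 1"
        "single i (d i) \<in> keys f" for \<alpha> i
        using newton_polytope_simplexD[OF d N] by auto
      show "complex_of_real (u $ i) * of_real (lookup f (single j 1)) \<noteq>
       complex_of_real (u $ j) * of_real (lookup f (single i 1))"
        using that(2) verts by (simp add: P_def problem_point_def problem_params_def k)
    qed
    have zero: "d (Min UNIV) * (\<Prod>i\<in>UNIV - {Min UNIV}. (d i - 1)) = 0"
    proof -
      have "(\<Prod>i\<in>UNIV - {Min UNIV}. (d i - 1)) = 0"
        by (rule prod_zero) (use 3(2) dj in \<open>auto intro: bexI[of _ j]\<close>)
      then show ?thesis by simp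
    qed
    have degree: "has_algebraic_degree u f (d (Min UNIV) * (\<Prod>i\<in>UNIV - {Min UNIV}. (d i - 1)))"
      if f: "Simplex f" and Z: "problem_point u f \<notin> Z (problem_params A)" for u f
    proof -
      have "problem_point u f \<in> problem_params A \<rightarrow>\<^sub>E UNIV"
        using f by (simp add: problem_point_def Simplex_def)
      with Z have "P (problem_point u f) \<noteq> 0" by (simp add: Z_def)
      with f have "zeros (lagrange_system u f) = {}" by (rule empty)
      then show ?thesis unfolding zero by (simp add: has_algebraic_degree_def)
    qed
    have paths: "solutions_reached (start_system u d c0 c) (lagrange_system u f)"
      if f: "Simplex f" and Z: "homotopy_point u f c0 c \<notin> Z (homotopy_params A)" for u f c0 c
    proof -
      have k: "keys f = A" using f by (simp add: Simplex_def)
      then have "homotopy_point u f c0 c \<in> homotopy_params A \<rightarrow>\<^sub>E UNIV" by (simp add: homotopy_point_def)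
      with Z have "P (homotopy_point u f c0 c) \<noteq> 0" by (simp add: Z_def)
      moreover have "P (homotopy_point u f c0 c) = P (problem_point u f)"
        by (intro poly_fun_cong_vars[OF P[OF order_refl]])
          (auto simp: k homotopy_point_def problem_point_def homotopy_params_def problem_params_def)
      ultimately have "P (problem_point u f) \<noteq> 0" by simp
      with f have "zeros (lagrange_system u f) = {}" by (rule empty)
      then show ?thesis unfolding solutions_reached_def by (intro exI[of _ UNIV]) auto
    qed
    have "proper_subvariety (problem_params A) (Z (problem_params A))"
      by (rule proper[OF finite_params(1)[OF assms(3)]]) simp
    moreover have "proper_subvariety (homotopy_params A) (Z (homotopy_params A))"
      by (rule proper[OF finite_params(2)[OF assms(3)]]) (auto simp: homotopy_params_def)
    ultimately show ?thesis
      using degree paths unfolding Simplex_def solutions_reached_def by blast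
  qed
qed

end
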